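(* Let $\rho:\mathbb{N}\times\mathbb{N}\to\mathbb{R}_{>0}$, $(j,n)\mapsto\rho(j,n)=\rho_j(n)$, satisfy $$\sum_{n=0}^\infty\frac{\rho(j,n)}{\rho(j+1,n)}<\infty\quad\text{for all }j\in\mathbb{N}.$$ Then the bornological $R$-modules $\kappa(\rho):=\varinjlim_{j}\ell^1_*(\rho_j^{-1})$ and $\lambda(\rho):=\varprojlim_j\ell^1_*(\rho_j)$ (limit and colimit in $\mathbf{Ind}(\mathbf{Ban}_R)$, transition maps the identity on elements) are nuclear.
   Context: $(R,|\cdot|)$ is a Banach ring (commutative unital, complete, submultiplicative norm with $|1|\le1$). $\mathbf{Ban}_R$ is the category of Banach $R$-modules (complete normed $R$-modules with $\|ax\|\le|a|\|x\|$) and bounded linear maps; $\mathbf{Ind}(\mathbf{Ban}_R)$ is its Ind-completion, with completed projective tensor product $\widehat{\otimes}$ and duals $M^\vee=\underline{\mathrm{Hom}}_R(M,R)$ (for Banach $M$, the bounded linear functionals with operator norm). For $w:\mathbb{N}\to\mathbb{R}_{>0}$, $\ell^1(w)$ is the Banach module of $(x_n)\in R^{\mathbb{N}}$ with $\sum|x_n|w(n)<\infty$ (norm this sum), $\ell^1_{\mathrm{na}}(w)$ the module of sequences with $|x_n|w(n)\to0$ (sup norm $\sup|x_n|w(n)$), and $\ell^1_*(w)$ means $\ell^1(w)$, or $\ell^1_{\mathrm{na}}(w)$ when $R$ is non-archimedean and one works with non-archimedean Banach modules; $w^{-1}(n)=w(n)^{-1}$. A bounded map $f:M\to N$ of Banach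 modules is nuclear if there are $\xi_n\in M^\vee$, $y_n\in N$ with $\sum_n\|\xi_n\|\|y_n\|<\infty$ (in the non-archimedean case: $\|\xi_n\|\|y_n\|\to0$) and $f(x)=\sum_n\xi_n(x)y_n$ for all $x\in M$. An object $M$ of $\mathbf{Ind}(\mathbf{Ban}_R)$ is nuclear if it is isomorphic to the colimit of a filtered system $(M_i)_{i\in I}$ of Banach modules such that for each $i$ there is $i\to j$ in $I$ with $M_i\to M_j$ nuclear. *)

theory Defs
  imports Complex_Main "HOL-Library.FuncSet" "HOL-Algebra.Module"
begin

section \<open>Categories, limits and colimits\<close>

text \<open>
  Hom-sets need not be disjoint, so composition takes the three objects as arguments:
  \<open>Comp C X Y Z g f\<close> is the composite of \<open>f : X \<rightarrow> Y\<close> and \<open>g : Y \<rightarrow> Z\<close>.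
\<close>

record ('o, 'a) cat =
  Ob :: "'o set"
  Hom :: "'o \<Rightarrow> 'o \<Rightarrow> 'a set"
  Id :: "'o \<Rightarrow> 'a"
  Comp :: "'o \<Rightarrow> 'o \<Rightarrow> 'o \<Rightarrow> 'a \<Rightarrow> 'a \<Rightarrow> 'a"

locale category =
  fixes C :: "('o, 'a) cat"
  assumes Id_in: "X \<in> Ob C \<Longrightarrow> Id C X \<in> Hom C X X"
    and Comp_in: "\<lbrakk>X \<in> Ob C; Y \<in> Ob C; Z \<in> Ob C; f \<in> Hom C X Y; g \<in> Hom C Y Z\<rbrakk>
        \<Longrightarrow> Comp C X Y Z g f \<in> Hom C X Z"
    and Comp_Id_right: "\<lbrakk>X \<in> Ob C; Y \<in> Ob C; f \<in> Hom C X Y\<rbrakk> \<Longrightarrow> Comp C X X Y f (Id C X) = f"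
    and Comp_Id_left: "\<lbrakk>X \<in> Ob C; Y \<in> Ob C; f \<in> Hom C X Y\<rbrakk> \<Longrightarrow> Comp C X Y Y (Id C Y) f = f"
    and Comp_assoc: "\<lbrakk>W \<in> Ob C; X \<in> Ob C; Y \<in> Ob C; Z \<in> Ob C;
          f \<in> Hom C W X; g \<in> Hom C X Y; h \<in> Hom C Y Z\<rbrakk>
        \<Longrightarrow> Comp C W X Z (Comp C X Y Z h g) f = Comp C W Y Z h (Comp C W X Y g f)"

definition isomorphic :: "('o, 'a) cat \<Rightarrow> 'o \<Rightarrow> 'o \<Rightarrow> bool" where
  "isomorphic C X Y \<longleftrightarrow> X \<in> Ob C \<and> Y \<in> Ob C \<and>
     (\<exists>f \<in> Hom C X Y. \<exists>g \<in> Hom C Y X.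
        Comp C X Y X g f = Id C X \<and> Comp C Y X Y f g = Id C Y)"

definition op_cat :: "('o, 'a) cat \<Rightarrow> ('o, 'a) cat" where
  "op_cat C = \<lparr>Ob = Ob C, Hom = (\<lambda>X Y. Hom C Y X), Id = Id C,
     Comp = (\<lambda>X Y Z g f. Comp C Z Y X f g)\<rparr>"

text \<open>The ordered set of natural numbers: one arrow from \<open>i\<close> to \<open>j\<close> if \<open>i \<le> j\<close>, none otherwise.\<close>

definition nat_cat :: "(nat, unit) cat" where
  "nat_cat = \<lparr>Ob = UNIV, Hom = (\<lambda>i j. if i \<le> j then {()} else {}), Id = (\<lambda>_. ()),
     Comp = (\<lambda>_ _ _ _ _. ())\<rparr>"

record ('i, 'k, 'o, 'a) diag =
  shape :: "('i, 'k) cat"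
  dob :: "'i \<Rightarrow> 'o"
  dar :: "'i \<Rightarrow> 'i \<Rightarrow> 'k \<Rightarrow> 'a"

locale diagram_in =
  fixes C :: "('o, 'a) cat" and D :: "('i, 'k, 'o, 'a) diag"
  assumes shape: "category (shape D)"
    and dob_in: "i \<in> Ob (shape D) \<Longrightarrow> dob D i \<in> Ob C"
    and dar_in: "\<lbrakk>i \<in> Ob (shape D); j \<in> Ob (shape D); u \<in> Hom (shape D) i j\<rbrakk>
        \<Longrightarrow> dar D i j u \<in> Hom C (dob D i) (dob D j)"
    and dar_Id: "i \<in> Ob (shape D) \<Longrightarrow> dar D i i (Id (shape D) i) = Id C (dob D i)"
    and dar_Comp: "\<lbrakk>i \<in> Ob (shape D); j \<in> Ob (shape D); k \<in> Ob (shape D);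
          u \<in> Hom (shape D) i j; v \<in> Hom (shape D) j k\<rbrakk>
        \<Longrightarrow> dar D i k (Comp (shape D) i j k v u) =
            Comp C (dob D i) (dob D j) (dob D k) (dar D j k v) (dar D i j u)"

definition is_cone ::
    "('o, 'a) cat \<Rightarrow> ('i, 'k, 'o, 'a) diag \<Rightarrow> 'o \<Rightarrow> ('i \<Rightarrow> 'a) \<Rightarrow> bool" where
  "is_cone C D X p \<longleftrightarrow> X \<in> Ob C \<and>
     (\<forall>i \<in> Ob (shape D). p i \<in> Hom C X (dob D i)) \<and>
     (\<forall>i \<in> Ob (shape D). \<forall>j \<in> Ob (shape D). \<forall>u \<in> Hom (shape D) i j.
        Comp C X (dob D i) (dob D j) (dar D i j u) (p i) = p j)"

definition is_cocone ::
    "('o, 'a) cat \<Rightarrow> ('i, 'k, 'o, 'a) diag \<Rightarrow> 'o \<Rightarrow> ('i \<Rightarrow> 'a) \<Rightarrow> bool" where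
  "is_cocone C D X q \<longleftrightarrow> X \<in> Ob C \<and>
     (\<forall>i \<in> Ob (shape D). q i \<in> Hom C (dob D i) X) \<and>
     (\<forall>i \<in> Ob (shape D). \<forall>j \<in> Ob (shape D). \<forall>u \<in> Hom (shape D) i j.
        Comp C (dob D i) (dob D j) X (q j) (dar D i j u) = q i)"

definition is_limit ::
    "('o, 'a) cat \<Rightarrow> ('i, 'k, 'o, 'a) diag \<Rightarrow> 'o \<Rightarrow> ('i \<Rightarrow> 'a) \<Rightarrow> bool" where
  "is_limit C D L p \<longleftrightarrow> diagram_in C D \<and> is_cone C D L p \<and>
     (\<forall>X r. is_cone C D X r \<longrightarrow>
        (\<exists>!f. f \<in> Hom C X L \<and> (\<forall>i \<in> Ob (shape D). Comp C X L (dob D i) (p i) f = r i)))"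

definition is_colimit ::
    "('o, 'a) cat \<Rightarrow> ('i, 'k, 'o, 'a) diag \<Rightarrow> 'o \<Rightarrow> ('i \<Rightarrow> 'a) \<Rightarrow> bool" where
  "is_colimit C D L q \<longleftrightarrow> diagram_in C D \<and> is_cocone C D L q \<and>
     (\<forall>X r. is_cocone C D X r \<longrightarrow>
        (\<exists>!f. f \<in> Hom C L X \<and> (\<forall>i \<in> Ob (shape D). Comp C (dob D i) L X f (q i) = r i)))"


section \<open>The Ind-completion\<close>

locale filtered_category = category J for J :: "('i, 'k) cat" +
  assumes nonempty: "Ob J \<noteq> {}"
    and upper_bound: "\<lbrakk>i \<in> Ob J; j \<in> Ob J\<rbrakk>
        \<Longrightarrow> \<exists>k \<in> Ob J. (\<exists>u. u \<in> Hom J i k) \<and> (\<exists>v. v \<in> Hom J j k)"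
    and coequalize: "\<lbrakk>i \<in> Ob J; j \<in> Ob J; u \<in> Hom J i j; v \<in> Hom J i j\<rbrakk>
        \<Longrightarrow> \<exists>k \<in> Ob J. \<exists>w \<in> Hom J j k. Comp J i j k w u = Comp J i j k w v"

definition ind_objects :: "('o, 'a) cat \<Rightarrow> ('i, 'k, 'o, 'a) diag set" where
  "ind_objects C = {F. filtered_category (shape F) \<and> diagram_in C F}"

text \<open>
  For a filtered system \<open>F\<close>, the set \<open>colim_Hom C X F\<close> is the colimit over \<open>j\<close> of the sets
  \<open>Hom C X (dob F j)\<close>: pairs \<open>(j, f)\<close> modulo equality at a later stage.
\<close>

definition germ_rel ::
    "('o, 'a) cat \<Rightarrow> 'o \<Rightarrow> ('i, 'k, 'o, 'a) diag \<Rightarrow> (('i \<times> 'a) \<times> ('i \<times> 'a)) set" where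
  "germ_rel C X F = {((j, f), (j', f')).
     j \<in> Ob (shape F) \<and> f \<in> Hom C X (dob F j) \<and>
     j' \<in> Ob (shape F) \<and> f' \<in> Hom C X (dob F j') \<and>
     (\<exists>k \<in> Ob (shape F). \<exists>u \<in> Hom (shape F) j k. \<exists>v \<in> Hom (shape F) j' k.
        Comp C X (dob F j) (dob F k) (dar F j k u) f =
        Comp C X (dob F j') (dob F k) (dar F j' k v) f')}"

definition colim_Hom ::
    "('o, 'a) cat \<Rightarrow> 'o \<Rightarrow> ('i, 'k, 'o, 'a) diag \<Rightarrow> ('i \<times> 'a) set set" where
  "colim_Hom C X F = (SIGMA j : Ob (shape F). Hom C X (dob F j)) // germ_rel C X F"

text \<open>Precomposition \<open>colim_Hom C Y F \<rightarrow> colim_Hom C X F\<close> with \<open>a : X \<rightarrow> Y\<close>.\<close>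

definition germ_pullback ::
    "('o, 'a) cat \<Rightarrow> 'o \<Rightarrow> 'o \<Rightarrow> ('i, 'k, 'o, 'a) diag \<Rightarrow> 'a \<Rightarrow> ('i \<times> 'a) set \<Rightarrow> ('i \<times> 'a) set" where
  "germ_pullback C X Y F a c =
     (\<Union>(j, f) \<in> c. germ_rel C X F `` {(j, Comp C X Y (dob F j) f a)})"

text \<open>
  Arrows \<open>F \<rightarrow> G\<close> are the elements of the limit over \<open>i\<close> of the sets
  \<open>colim_Hom C (dob F i) G\<close>, that is, compatible families of germs.
\<close>

definition ind_Hom ::
    "('o, 'a) cat \<Rightarrow> ('i, 'k, 'o, 'a) diag \<Rightarrow> ('i, 'k, 'o, 'a) diag \<Rightarrow> ('i \<Rightarrow> ('i \<times> 'a) set) set" where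
  "ind_Hom C F G = {\<phi> \<in> (\<Pi>\<^sub>E i \<in> Ob (shape F). colim_Hom C (dob F i) G).
     \<forall>i \<in> Ob (shape F). \<forall>i' \<in> Ob (shape F). \<forall>u \<in> Hom (shape F) i i'.
       germ_pullback C (dob F i) (dob F i') G (dar F i i' u) (\<phi> i') = \<phi> i}"

definition Ind ::
    "('o, 'a) cat \<Rightarrow> (('i, 'k, 'o, 'a) diag, 'i \<Rightarrow> ('i \<times> 'a) set) cat" where
  "Ind C = \<lparr>Ob = ind_objects C, Hom = ind_Hom C,
     Id = (\<lambda>F. \<lambda>i \<in> Ob (shape F). germ_rel C (dob F i) F `` {(i, Id C (dob F i))}),
     Comp = (\<lambda>F G H \<psi> \<phi>. \<lambda>i \<in> Ob (shape F).
       \<Union>(j, f) \<in> \<phi> i. \<Union>(k, g) \<in> \<psi> j.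
         germ_rel C (dob F i) H `` {(k, Comp C (dob F i) (dob G j) (dob H k) g f)})\<rparr>"

text \<open>
  The embedding of \<open>C\<close> into \<open>Ind C\<close> by constant systems over the one-arrow category, and the diagram
  in \<open>Ind C\<close> induced by a diagram in \<open>C\<close>.
\<close>

definition point_cat :: "('i, 'k) cat" where
  "point_cat = \<lparr>Ob = {undefined}, Hom = (\<lambda>_ _. {undefined}), Id = (\<lambda>_. undefined),
     Comp = (\<lambda>_ _ _ _ _. undefined)\<rparr>"

definition ind_embed :: "('o, 'a) cat \<Rightarrow> 'o \<Rightarrow> ('i, 'k, 'o, 'a) diag" where
  "ind_embed C X = \<lparr>shape = point_cat, dob = (\<lambda>_. X), dar = (\<lambda>_ _ _. Id C X)\<rparr>"

definition ind_embed_arr ::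
    "('o, 'a) cat \<Rightarrow> ('i, 'k, 'o, 'a) diag itself \<Rightarrow> 'o \<Rightarrow> 'o \<Rightarrow> 'a \<Rightarrow> 'i \<Rightarrow> ('i \<times> 'a) set" where
  "ind_embed_arr C T X Y f = (\<lambda>i \<in> {undefined}.
     germ_rel C X (ind_embed C Y :: ('i, 'k, 'o, 'a) diag) `` {(undefined, f)})"

definition ind_diag :: "('o, 'a) cat \<Rightarrow> ('j, 'l, 'o, 'a) diag \<Rightarrow>
    ('j, 'l, ('i, 'k, 'o, 'a) diag, 'i \<Rightarrow> ('i \<times> 'a) set) diag" where
  "ind_diag C D = \<lparr>shape = shape D, dob = (\<lambda>j. ind_embed C (dob D j)),
     dar = (\<lambda>j j' u. ind_embed_arr C TYPE(('i, 'k, 'o, 'a) diag)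
       (dob D j) (dob D j') (dar D j j' u))\<rparr>"


section \<open>Banach rings and Banach modules\<close>

record 'r normed_ring = "'r ring" +
  ring_norm :: "'r \<Rightarrow> real"

record ('r, 'm) normed_module = "('r, 'm) module" +
  mod_norm :: "'m \<Rightarrow> real"

definition complete_norm :: "('a, 'z) ring_scheme \<Rightarrow> ('a \<Rightarrow> real) \<Rightarrow> bool" where
  "complete_norm G N \<longleftrightarrow>
     (\<forall>x \<in> carrier G. 0 \<le> N x \<and> (N x = 0 \<longleftrightarrow> x = \<zero>\<^bsub>G\<^esub>) \<and> N (\<ominus>\<^bsub>G\<^esub> x) = N x) \<and>
     (\<forall>x \<in> carrier G. \<forall>y \<in> carrier G. N (x \<oplus>\<^bsub>G\<^esub> y) \<le> N x + N y) \<and>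
     (\<forall>s. (\<forall>n::nat. s n \<in> carrier G) \<longrightarrow>
        (\<forall>e > 0. \<exists>K. \<forall>m \<ge> K. \<forall>n \<ge> K. N (s m \<ominus>\<^bsub>G\<^esub> s n) < e) \<longrightarrow>
        (\<exists>x \<in> carrier G. (\<lambda>n. N (s n \<ominus>\<^bsub>G\<^esub> x)) \<longlonglongrightarrow> 0))"

definition ultrametric :: "('a, 'z) ring_scheme \<Rightarrow> ('a \<Rightarrow> real) \<Rightarrow> bool" where
  "ultrametric G N \<longleftrightarrow> (\<forall>x \<in> carrier G. \<forall>y \<in> carrier G. N (x \<oplus>\<^bsub>G\<^esub> y) \<le> max (N x) (N y))"

definition banach_ring :: "'r normed_ring \<Rightarrow> bool" where
  "banach_ring R \<longleftrightarrow> cring R \<and> complete_norm R (ring_norm R) \<and>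
     (\<forall>a \<in> carrier R. \<forall>b \<in> carrier R.
        ring_norm R (a \<otimes>\<^bsub>R\<^esub> b) \<le> ring_norm R a * ring_norm R b) \<and>
     ring_norm R \<one>\<^bsub>R\<^esub> \<le> 1"

definition banach_module :: "'r normed_ring \<Rightarrow> ('r, 'm) normed_module \<Rightarrow> bool" where
  "banach_module R M \<longleftrightarrow> module R M \<and> complete_norm M (mod_norm M) \<and>
     (\<forall>a \<in> carrier R. \<forall>x \<in> carrier M.
        mod_norm M (a \<odot>\<^bsub>M\<^esub> x) \<le> ring_norm R a * mod_norm M x)"

definition bounded_maps ::
    "'r normed_ring \<Rightarrow> ('r, 'm) normed_module \<Rightarrow> ('r, 'n) normed_module \<Rightarrow> ('m \<Rightarrow> 'n) set" where
  "bounded_maps R M N = {f \<in> carrier M \<rightarrow>\<^sub>E carrier N.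
     (\<forall>x \<in> carrier M. \<forall>y \<in> carrier M. f (x \<oplus>\<^bsub>M\<^esub> y) = f x \<oplus>\<^bsub>N\<^esub> f y) \<and>
     (\<forall>a \<in> carrier R. \<forall>x \<in> carrier M. f (a \<odot>\<^bsub>M\<^esub> x) = a \<odot>\<^bsub>N\<^esub> f x) \<and>
     (\<exists>B. \<forall>x \<in> carrier M. mod_norm N (f x) \<le> B * mod_norm M x)}"

definition op_norm ::
    "('r, 'm) normed_module \<Rightarrow> ('r, 'n) normed_module \<Rightarrow> ('m \<Rightarrow> 'n) \<Rightarrow> real" where
  "op_norm M N f = Inf {B. 0 \<le> B \<and> (\<forall>x \<in> carrier M. mod_norm N (f x) \<le> B * mod_norm M x)}"

text \<open>
  The flag \<open>na\<close> selects the non-archimedean setting, in which all Banach modules are required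
  to be ultrametric. The elements of the modules are taken from the type \<open>'m\<close>, and the index
  categories of Ind-objects from the types \<open>'i\<close> (objects) and \<open>'k\<close> (arrows). These types play
  the role of a universe; it is large enough for the purposes below as soon as \<open>nat \<Rightarrow> 'r\<close> injects
  into \<open>'m\<close> and \<open>nat \<Rightarrow> real\<close> into \<open>'i\<close>.
\<close>

definition Ban :: "bool \<Rightarrow> 'r normed_ring \<Rightarrow> (('r, 'm) normed_module, 'm \<Rightarrow> 'm) cat" where
  "Ban na R = \<lparr>Ob = {M. banach_module R M \<and> (na \<longrightarrow> ultrametric M (mod_norm M))},
     Hom = bounded_maps R, Id = (\<lambda>M. \<lambda>x \<in> carrier M. x),
     Comp = (\<lambda>L M N g f. compose (carrier L) g f)\<rparr>"


section \<open>Nuclear maps and nuclear objects\<close>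

definition self_module :: "'r normed_ring \<Rightarrow> ('r, 'r) normed_module" where
  "self_module R = \<lparr>carrier = carrier R, mult = mult R, one = \<one>\<^bsub>R\<^esub>,
     zero = \<zero>\<^bsub>R\<^esub>, add = add R, smult = mult R, mod_norm = ring_norm R\<rparr>"

definition nuclear_map :: "bool \<Rightarrow> 'r normed_ring \<Rightarrow>
    ('r, 'm) normed_module \<Rightarrow> ('r, 'n) normed_module \<Rightarrow> ('m \<Rightarrow> 'n) \<Rightarrow> bool" where
  "nuclear_map na R M N f \<longleftrightarrow> f \<in> bounded_maps R M N \<and>
     (\<exists>\<xi> y. (\<forall>n::nat. \<xi> n \<in> bounded_maps R M (self_module R) \<and> y n \<in> carrier N) \<and>
        (if na then (\<lambda>n. op_norm M (self_module R) (\<xi> n) * mod_norm N (y n)) \<longlonglongrightarrow> 0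
         else summable (\<lambda>n. op_norm M (self_module R) (\<xi> n) * mod_norm N (y n))) \<and>
        (\<forall>x \<in> carrier M.
           (\<lambda>k. mod_norm N ((\<Oplus>\<^bsub>N\<^esub>n \<in> {..<k}. \<xi> n x \<odot>\<^bsub>N\<^esub> y n) \<ominus>\<^bsub>N\<^esub> f x)) \<longlonglongrightarrow> 0))"

definition nuclear_object :: "bool \<Rightarrow> 'r normed_ring \<Rightarrow>
    ('i, 'k, ('r, 'm) normed_module, 'm \<Rightarrow> 'm) diag \<Rightarrow> bool" where
  "nuclear_object na R M \<longleftrightarrow>
     (\<exists>(S :: ('i, 'k, ('r, 'm) normed_module, 'm \<Rightarrow> 'm) diag) K q.
        filtered_category (shape S) \<and> diagram_in (Ban na R) S \<and>
        (\<forall>i \<in> Ob (shape S). \<exists>j \<in> Ob (shape S). \<exists>u \<in> Hom (shape S) i j.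
           nuclear_map na R (dob S i) (dob S j) (dar S i j u)) \<and>
        is_colimit (Ind (Ban na R)) (ind_diag (Ban na R) S) K q \<and>
        isomorphic (Ind (Ban na R)) M K)"


section \<open>Weighted sequence modules\<close>

definition ell1 :: "'r normed_ring \<Rightarrow> (nat \<Rightarrow> real) \<Rightarrow> ('r, nat \<Rightarrow> 'r) normed_module" where
  "ell1 R w = \<lparr>
     carrier = {x. (\<forall>n. x n \<in> carrier R) \<and> summable (\<lambda>n. ring_norm R (x n) * w n)},
     mult = undefined, one = undefined,
     zero = (\<lambda>n. \<zero>\<^bsub>R\<^esub>), add = (\<lambda>x y n. x n \<oplus>\<^bsub>R\<^esub> y n),
     smult = (\<lambda>a x n. a \<otimes>\<^bsub>R\<^esub> x n),
     mod_norm = (\<lambda>x. \<Sum>n. ring_norm R (x n) * w n)\<rparr>"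

definition ell1_na :: "'r normed_ring \<Rightarrow> (nat \<Rightarrow> real) \<Rightarrow> ('r, nat \<Rightarrow> 'r) normed_module" where
  "ell1_na R w = \<lparr>
     carrier = {x. (\<forall>n. x n \<in> carrier R) \<and> (\<lambda>n. ring_norm R (x n) * w n) \<longlonglongrightarrow> 0},
     mult = undefined, one = undefined,
     zero = (\<lambda>n. \<zero>\<^bsub>R\<^esub>), add = (\<lambda>x y n. x n \<oplus>\<^bsub>R\<^esub> y n),
     smult = (\<lambda>a x n. a \<otimes>\<^bsub>R\<^esub> x n),
     mod_norm = (\<lambda>x. SUP n. ring_norm R (x n) * w n)\<rparr>"

text \<open>Transport of structure along an injection \<open>e\<close> of the element type into the universe.\<close>

definition transport :: "('a \<Rightarrow> 'm) \<Rightarrow> ('r, 'a) normed_module \<Rightarrow> ('r, 'm) normed_module" where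
  "transport e M = \<lparr>carrier = e ` carrier M, mult = undefined, one = undefined,
     zero = e \<zero>\<^bsub>M\<^esub>, add = (\<lambda>x y. e (the_inv e x \<oplus>\<^bsub>M\<^esub> the_inv e y)),
     smult = (\<lambda>a x. e (a \<odot>\<^bsub>M\<^esub> the_inv e x)),
     mod_norm = (\<lambda>x. mod_norm M (the_inv e x))\<rparr>"

definition ell_star :: "bool \<Rightarrow> 'r normed_ring \<Rightarrow> ((nat \<Rightarrow> 'r) \<Rightarrow> 'm) \<Rightarrow>
    (nat \<Rightarrow> real) \<Rightarrow> ('r, 'm) normed_module" where
  "ell_star na R e w = transport e (if na then ell1_na R w else ell1 R w)"

definition kappa_diag :: "bool \<Rightarrow> 'r normed_ring \<Rightarrow> ((nat \<Rightarrow> 'r) \<Rightarrow> 'm) \<Rightarrow>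
    (nat \<Rightarrow> nat \<Rightarrow> real) \<Rightarrow> (nat, unit, ('r, 'm) normed_module, 'm \<Rightarrow> 'm) diag" where
  "kappa_diag na R e \<rho> = \<lparr>shape = nat_cat,
     dob = (\<lambda>j. ell_star na R e (\<lambda>n. inverse (\<rho> j n))),
     dar = (\<lambda>i j u. \<lambda>x \<in> carrier (ell_star na R e (\<lambda>n. inverse (\<rho> i n))). x)\<rparr>"

definition lambda_diag :: "bool \<Rightarrow> 'r normed_ring \<Rightarrow> ((nat \<Rightarrow> 'r) \<Rightarrow> 'm) \<Rightarrow>
    (nat \<Rightarrow> nat \<Rightarrow> real) \<Rightarrow> (nat, unit, ('r, 'm) normed_module, 'm \<Rightarrow> 'm) diag" where
  "lambda_diag na R e \<rho> = \<lparr>shape = op_cat nat_cat,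
     dob = (\<lambda>j. ell_star na R e (\<rho> j)),
     dar = (\<lambda>i j u. \<lambda>x \<in> carrier (ell_star na R e (\<rho> i)). x)\<rparr>"

definition is_kappa :: "bool \<Rightarrow> 'r normed_ring \<Rightarrow> ((nat \<Rightarrow> 'r) \<Rightarrow> 'm) \<Rightarrow>
    (nat \<Rightarrow> nat \<Rightarrow> real) \<Rightarrow> ('i, 'k, ('r, 'm) normed_module, 'm \<Rightarrow> 'm) diag \<Rightarrow> bool" where
  "is_kappa na R e \<rho> K \<longleftrightarrow>
     (\<exists>q. is_colimit (Ind (Ban na R)) (ind_diag (Ban na R) (kappa_diag na R e \<rho>)) K q)"

definition is_lambda :: "bool \<Rightarrow> 'r normed_ring \<Rightarrow> ((nat \<Rightarrow> 'r) \<Rightarrow> 'm) \<Rightarrow>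
    (nat \<Rightarrow> nat \<Rightarrow> real) \<Rightarrow> ('i, 'k, ('r, 'm) normed_module, 'm \<Rightarrow> 'm) diag \<Rightarrow> bool" where
  "is_lambda na R e \<rho> L \<longleftrightarrow>
     (\<exists>p. is_limit (Ind (Ban na R)) (ind_diag (Ban na R) (lambda_diag na R e \<rho>)) L p)"

end

theory Submission
  imports Defs
begin

text \<open>
  The filtered system \<open>(\<ell>(1/\<rho>\<^sub>j))\<^sub>j\<close>, regarded as an Ind-object, is its own colimit, and the inclusion
  \<open>\<ell>(1/\<rho>\<^sub>j) \<rightarrow> \<ell>(1/\<rho>\<^sub>j\<^sub>+\<^sub>1)\<close> is the nuclear map \<open>x \<mapsto> \<Sum>\<^sub>n x\<^sub>n \<delta>\<^sub>n\<close>, since \<open>\<parallel>x \<mapsto> x\<^sub>n\<parallel> \<parallel>\<delta>\<^sub>n\<parallel> \<le> \<rho>\<^sub>j(n)/\<rho>\<^sub>j\<^sub>+\<^sub>1(n)\<close>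
  is summable.

  The limit of the \<open>\<ell>(\<rho>\<^sub>j)\<close> is the filtered system of all \<open>\<ell>(w)\<close> with \<open>w\<close> dominating every \<open>\<rho>\<^sub>j\<close> up to a
  constant. Both this and its nuclearity rest on one fact: every dominating weight \<open>u\<close> admits a
  dominating \<open>w\<close> with \<open>\<Sum>\<^sub>n w(n)/u(n) < \<infinity>\<close>. Indeed \<open>\<rho>\<^sub>j/u\<close> is bounded by a multiple of the summable sequence
  \<open>\<rho>\<^sub>j/\<rho>\<^sub>j\<^sub>+\<^sub>1\<close>, and countably many summable sequences are dominated by a single one.
\<close>

section \<open>The Ind-completion as a category\<close>

text \<open>An arrow from a Banach module \<open>X\<close> into the limit is one linear map that is
  bounded into the module of every \<open>\<rho> j\<close>, with operator bounds \<open>B j\<close>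
  that may grow arbitrarily in \<open>j\<close>. The weight through which it factors must therefore
  depend on the map: with constants \<open>A j\<close> at least \<open>B j\<close>, and large enough
  to make the supremum finite, the weight u(n) = sup over j of \<open>\<rho> j n / A j\<close> turns
  all these bounds into one bound per coordinate. That is only a uniform bound on N(x_n) u(n); a
  second weight w with w/u summable turns it into membership in the module of w. As w varies with
  the map, the limit is a system over all dominating weights. Uniqueness of the factorization is
  easy because all transition maps are identities on elements. The universal property concerns cones
  over arbitrary Ind-objects. It is reduced to vertices in the base category: lifts found stage by
  stage are compatible because lifts are unique. Both settings are treated together. A summable
  sequence tends to zero, so summable bounds settle the non-archimedean case as well.\<close>

definition germ :: "('o, 'a) cat \<Rightarrow> 'o \<Rightarrow> ('i, 'k, 'o, 'a) diag \<Rightarrow> 'i \<Rightarrow> 'a \<Rightarrow> ('i \<times> 'a) set" where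
  "germ C X F j f = germ_rel C X F `` {(j, f)}"

lemma ind_objects_iff: "F \<in> ind_objects C \<longleftrightarrow> filtered_category (shape F) \<and> diagram_in C F"
  by (simp add: ind_objects_def)

lemma Ind_simps [simp]:
  "Ob (Ind C) = ind_objects C"
  "Hom (Ind C) = ind_Hom C"
  "Id (Ind C) = (\<lambda>F. \<lambda>i \<in> Ob (shape F). germ C (dob F i) F i (Id C (dob F i)))"
  by (simp_all add: Ind_def germ_def)

context category
begin

section \<open>Germs of arrows into a filtered system, and their restriction\<close>

lemma dar_Comp_apply:
  assumes "diagram_in C F" "X \<in> Ob C"
    and ob: "i \<in> Ob (shape F)" "j \<in> Ob (shape F)" "k \<in> Ob (shape F)"
    and u: "u \<in> Hom (shape F) i j" and v: "v \<in> Hom (shape F) j k"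
    and f: "f \<in> Hom C X (dob F i)"
  shows "Comp C X (dob F i) (dob F k) (dar F i k (Comp (shape F) i j k v u)) f =
    Comp C X (dob F j) (dob F k) (dar F j k v) (Comp C X (dob F i) (dob F j) (dar F i j u) f)"
proof -
  interpret diagram_in C F by fact
  show ?thesis
    using assms by (simp add: dar_Comp dob_in dar_in Comp_assoc[OF _ _ _ _ f])
qed

text \<open>Filteredness enters through transitivity. The two witnessing stages \<open>k\<close> and
  \<open>k'\<close> are joined at a stage \<open>m\<close>, where the two resulting arrows out of
  the middle index \<open>j'\<close> may still differ; they are coequalized at a further stage
  \<open>n\<close>, where all three representatives agree.\<close>

lemma equiv_germ_rel:
  assumes F: "F \<in> ind_objects C" and X: "X \<in> Ob C"
  shows "equiv (SIGMA j : Ob (shape F). Hom C X (dob F j)) (germ_rel C X F)"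
proof -
  interpret J: filtered_category "shape F" using F by (simp add: ind_objects_iff)
  interpret diagram_in C F using F by (simp add: ind_objects_iff)
  note dc = dar_Comp_apply[OF diagram_in_axioms X]
  show ?thesis
  proof (rule equivI)
    show "germ_rel C X F \<subseteq> (SIGMA j : Ob (shape F). Hom C X (dob F j)) \<times> (SIGMA j : Ob (shape F). Hom C X (dob F j))"
      by (auto simp: germ_rel_def)
    show "refl_on (SIGMA j : Ob (shape F). Hom C X (dob F j)) (germ_rel C X F)"
      by (auto simp: refl_on_def germ_rel_def intro: J.Id_in)
    show "sym (germ_rel C X F)"
      unfolding sym_def germ_rel_def by force
    show "trans (germ_rel C X F)"
    proof (rule transI, clarsimp simp: germ_rel_def)
      fix j f j' f' j'' f'' k u v k' u' v'
      assume ob: "j \<in> Ob (shape F)" "j' \<in> Ob (shape F)" "j'' \<in> Ob (shape F)"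
          "k \<in> Ob (shape F)" "k' \<in> Ob (shape F)"
        and f: "f \<in> Hom C X (dob F j)" "f' \<in> Hom C X (dob F j')" "f'' \<in> Hom C X (dob F j'')"
        and u: "u \<in> Hom (shape F) j k" "v \<in> Hom (shape F) j' k"
        and u': "u' \<in> Hom (shape F) j' k'" "v' \<in> Hom (shape F) j'' k'"
        and eq: "Comp C X (dob F j) (dob F k) (dar F j k u) f =
                 Comp C X (dob F j') (dob F k) (dar F j' k v) f'"
        and eq': "Comp C X (dob F j') (dob F k') (dar F j' k' u') f' =
                  Comp C X (dob F j'') (dob F k') (dar F j'' k' v') f''"
      obtain m s t where m: "m \<in> Ob (shape F)" "s \<in> Hom (shape F) k m" "t \<in> Hom (shape F) k' m"
        using J.upper_bound ob by meson
      have sv: "Comp (shape F) j' k m s v \<in> Hom (shape F) j' m"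
        and tu: "Comp (shape F) j' k' m t u' \<in> Hom (shape F) j' m"
        using J.Comp_in ob m u u' by auto
      obtain n w where n: "n \<in> Ob (shape F)" "w \<in> Hom (shape F) m n"
        and w: "Comp (shape F) j' m n w (Comp (shape F) j' k m s v) =
                Comp (shape F) j' m n w (Comp (shape F) j' k' m t u')"
        using J.coequalize[OF ob(2) m(1) sv tu] by blast
      have ws: "Comp (shape F) k m n w s \<in> Hom (shape F) k n"
        and wt: "Comp (shape F) k' m n w t \<in> Hom (shape F) k' n"
        using J.Comp_in ob m n by auto
      let ?a = "Comp (shape F) j k n (Comp (shape F) k m n w s) u"
      let ?b = "Comp (shape F) j'' k' n (Comp (shape F) k' m n w t) v'"
      have ab: "?a \<in> Hom (shape F) j n" "?b \<in> Hom (shape F) j'' n"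
        using J.Comp_in ob n u u' ws wt by auto
      have w': "Comp (shape F) j' k n (Comp (shape F) k m n w s) v =
                Comp (shape F) j' k' n (Comp (shape F) k' m n w t) u'"
        using w J.Comp_assoc[of j' k m n v s w] J.Comp_assoc[of j' k' m n u' t w] ob m n u u' by simp
      have "Comp C X (dob F j) (dob F n) (dar F j n ?a) f =
            Comp C X (dob F j') (dob F n) (dar F j' n (Comp (shape F) j' k n (Comp (shape F) k m n w s) v)) f'"
        using ob n f u ws by (simp add: dc eq)
      also have "\<dots> = Comp C X (dob F j'') (dob F n) (dar F j'' n ?b) f''"
        unfolding w' using ob n f u' wt by (simp add: dc eq')
      finally show "\<exists>k\<in>Ob (shape F). \<exists>u\<in>Hom (shape F) j k. \<exists>v\<in>Hom (shape F) j'' k.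
          Comp C X (dob F j) (dob F k) (dar F j k u) f =
          Comp C X (dob F j'') (dob F k) (dar F j'' k v) f''"
        using n ab by blast
    qed
  qed
qed

lemma germ_in_colim_Hom:
  assumes "j \<in> Ob (shape F)" "f \<in> Hom C X (dob F j)"
  shows "germ C X F j f \<in> colim_Hom C X F"
  unfolding colim_Hom_def germ_def using assms by (intro quotientI) auto

lemma colim_Hom_cases:
  assumes "c \<in> colim_Hom C X F"
  obtains j f where "j \<in> Ob (shape F)" "f \<in> Hom C X (dob F j)" "c = germ C X F j f"
  using assms unfolding colim_Hom_def germ_def by (auto elim!: quotientE)

lemma germ_eq_iff:
  assumes "F \<in> ind_objects C" "X \<in> Ob C"
    and "j \<in> Ob (shape F)" "f \<in> Hom C X (dob F j)"
    and "j' \<in> Ob (shape F)" "f' \<in> Hom C X (dob F j')"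
  shows "germ C X F j f = germ C X F j' f' \<longleftrightarrow> ((j, f), (j', f')) \<in> germ_rel C X F"
  unfolding germ_def using assms by (intro eq_equiv_class_iff[OF equiv_germ_rel]) auto

lemma germ_memD:
  assumes "(j', f') \<in> germ C X F j f"
  shows "j' \<in> Ob (shape F)" "f' \<in> Hom C X (dob F j')" "((j, f), (j', f')) \<in> germ_rel C X F"
  using assms by (auto simp: germ_def germ_rel_def)

lemma germ_self:
  assumes "F \<in> ind_objects C" "X \<in> Ob C" "j \<in> Ob (shape F)" "f \<in> Hom C X (dob F j)"
  shows "(j, f) \<in> germ C X F j f"
  unfolding germ_def using assms by (intro equiv_class_self[OF equiv_germ_rel]) auto

lemma germ_eqI:
  assumes "F \<in> ind_objects C" "X \<in> Ob C"
    and "j \<in> Ob (shape F)" "f \<in> Hom C X (dob F j)"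
    and "j' \<in> Ob (shape F)" "f' \<in> Hom C X (dob F j')"
    and "k \<in> Ob (shape F)" "u \<in> Hom (shape F) j k" "v \<in> Hom (shape F) j' k"
    and "Comp C X (dob F j) (dob F k) (dar F j k u) f =
         Comp C X (dob F j') (dob F k) (dar F j' k v) f'"
  shows "germ C X F j f = germ C X F j' f'"
  using assms unfolding germ_eq_iff[OF assms(1-6)] by (auto simp: germ_rel_def)

text \<open>Both representatives meet at stage \<open>k\<close>, one carried there by the identity
  of \<open>k\<close>, the other by \<open>u\<close>.\<close>

lemma germ_dar:
  assumes F: "F \<in> ind_objects C" and X: "X \<in> Ob C"
    and ob: "j \<in> Ob (shape F)" "k \<in> Ob (shape F)"
    and f: "f \<in> Hom C X (dob F j)" and u: "u \<in> Hom (shape F) j k"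
  shows "germ C X F k (Comp C X (dob F j) (dob F k) (dar F j k u) f) = germ C X F j f"
proof -
  interpret J: filtered_category "shape F" using F by (simp add: ind_objects_iff)
  interpret diagram_in C F using F by (simp add: ind_objects_iff)
  have "Comp C X (dob F j) (dob F k) (dar F j k u) f \<in> Hom C X (dob F k)"
    using Comp_in X ob f u dob_in dar_in by blast
  moreover from this have "Comp C X (dob F k) (dob F k) (dar F k k (Id (shape F) k)) (Comp C X (dob F j) (dob F k) (dar F j k u) f)
     = Comp C X (dob F j) (dob F k) (dar F j k u) f"
    by (simp add: dar_Id ob X dob_in Comp_Id_left)
  ultimately show ?thesis
    using germ_eqI[OF F X ob(2) _ ob(1) f ob(2) J.Id_in[OF ob(2)] u] by simp
qed

text \<open>Well-definedness: the union in \<open>germ_pullback\<close> runs over all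
  representatives, but precomposition with \<open>a\<close> commutes with the transition maps of
  \<open>F\<close>, so every representative contributes the same germ and the union
  collapses.\<close>

lemma germ_pullback_germ:
  assumes F: "F \<in> ind_objects C" and X: "X \<in> Ob C" and Y: "Y \<in> Ob C" and a: "a \<in> Hom C X Y"
    and j: "j \<in> Ob (shape F)" and f: "f \<in> Hom C Y (dob F j)"
  shows "germ_pullback C X Y F a (germ C Y F j f) = germ C X F j (Comp C X Y (dob F j) f a)"
proof -
  interpret diagram_in C F using F by (simp add: ind_objects_iff)
  have const: "germ C X F j' (Comp C X Y (dob F j') f' a) = germ C X F j (Comp C X Y (dob F j) f a)"
    if mem: "(j', f') \<in> germ C Y F j f" for j' f'
  proof -
    obtain k u v where k: "k \<in> Ob (shape F)" "u \<in> Hom (shape F) j k" "v \<in> Hom (shape F) j' k"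
      and eq: "Comp C Y (dob F j) (dob F k) (dar F j k u) f = Comp C Y (dob F j') (dob F k) (dar F j' k v) f'"
      and j': "j' \<in> Ob (shape F)" and f': "f' \<in> Hom C Y (dob F j')"
      using germ_memD[OF mem] by (auto simp: germ_rel_def)
    have "Comp C X (dob F j) (dob F k) (dar F j k u) (Comp C X Y (dob F j) f a) =
          Comp C X (dob F j') (dob F k) (dar F j' k v) (Comp C X Y (dob F j') f' a)"
      using X Y a f f' j j' k dob_in dar_in
      by (simp flip: Comp_assoc add: eq)
    then show ?thesis
      using X Y a f f' j j' k dob_in dar_in
      by (intro germ_eqI[symmetric, OF F X _ _ _ _ k]) (simp_all add: Comp_in[of X Y])
  qed
  show ?thesis
    unfolding germ_pullback_def germ_def[symmetric]
    by (rule UN_constant_eq[OF germ_self[OF F Y j f]]) (unfold Ball_def split_paired_All prod.case, intro allI impI const)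
qed

lemma germ_pullback_in:
  assumes F: "F \<in> ind_objects C" and X: "X \<in> Ob C" and Y: "Y \<in> Ob C" and a: "a \<in> Hom C X Y"
    and c: "c \<in> colim_Hom C Y F"
  shows "germ_pullback C X Y F a c \<in> colim_Hom C X F"
proof -
  interpret diagram_in C F using F by (simp add: ind_objects_iff)
  show ?thesis
    using c assms dob_in Comp_in[OF X Y]
    by (auto elim!: colim_Hom_cases simp: germ_pullback_germ intro!: germ_in_colim_Hom)
qed

lemma germ_pullback_Comp:
  assumes F: "F \<in> ind_objects C" and ob: "X \<in> Ob C" "Y \<in> Ob C" "Z \<in> Ob C"
    and a: "a \<in> Hom C X Y" and b: "b \<in> Hom C Y Z" and c: "c \<in> colim_Hom C Z F"
  shows "germ_pullback C X Y F a (germ_pullback C Y Z F b c) = germ_pullback C X Z F (Comp C X Y Z b a) c"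
proof -
  interpret diagram_in C F using F by (simp add: ind_objects_iff)
  obtain j f where j: "j \<in> Ob (shape F)" and f: "f \<in> Hom C Z (dob F j)" and c: "c = germ C Z F j f"
    using c by (rule colim_Hom_cases)
  show ?thesis
    unfolding c using F ob a b j f dob_in[OF j]
    by (simp add: germ_pullback_germ Comp_in[of X Y Z] Comp_in[of Y Z "dob F j"] Comp_assoc)
qed

lemma germ_pullback_Id:
  assumes F: "F \<in> ind_objects C" and X: "X \<in> Ob C" and c: "c \<in> colim_Hom C X F"
  shows "germ_pullback C X X F (Id C X) c = c"
proof -
  interpret diagram_in C F using F by (simp add: ind_objects_iff)
  show ?thesis
    using c F X by (auto elim!: colim_Hom_cases simp: germ_pullback_germ Id_in Comp_Id_right dob_in)
qed

end

text \<open>An arrow \<open>\<phi> : F \<rightarrow> G\<close> acts on the generalised elements \<open>X \<rightarrow> F\<close> with \<open>X\<close> in \<open>C\<close>; composition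
  in \<open>Ind C\<close> is this action at \<open>X = dob F i\<close>, which reduces its laws to those of the action.\<close>

definition germ_act ::
    "('o, 'a) cat \<Rightarrow> 'o \<Rightarrow> ('i, 'k, 'o, 'a) diag \<Rightarrow> ('i, 'k, 'o, 'a) diag \<Rightarrow>
      ('i \<Rightarrow> ('i \<times> 'a) set) \<Rightarrow> ('i \<times> 'a) set \<Rightarrow> ('i \<times> 'a) set" where
  "germ_act C X F G \<phi> c = (\<Union>(j, f) \<in> c. germ_pullback C X (dob F j) G f (\<phi> j))"

lemma Comp_Ind:
  "Comp (Ind C) F G H \<psi> \<phi> = (\<lambda>i \<in> Ob (shape F). germ_act C (dob F i) G H \<psi> (\<phi> i))"
  by (simp add: Ind_def germ_act_def germ_pullback_def)

lemma ind_Hom_colim_Hom: "\<phi> \<in> ind_Hom C F G \<Longrightarrow> i \<in> Ob (shape F) \<Longrightarrow> \<phi> i \<in> colim_Hom C (dob F i) G"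
  by (auto simp: ind_Hom_def)

lemma ind_Hom_pullback:
  "\<phi> \<in> ind_Hom C F G \<Longrightarrow> i \<in> Ob (shape F) \<Longrightarrow> i' \<in> Ob (shape F) \<Longrightarrow> u \<in> Hom (shape F) i i' \<Longrightarrow>
    germ_pullback C (dob F i) (dob F i') G (dar F i i' u) (\<phi> i') = \<phi> i"
  by (auto simp: ind_Hom_def)

lemma ind_Hom_eqI:
  assumes "\<phi> \<in> ind_Hom C F G" "\<psi> \<in> ind_Hom C F G" "\<And>i. i \<in> Ob (shape F) \<Longrightarrow> \<phi> i = \<psi> i"
  shows "\<phi> = \<psi>"
  using assms by (auto simp: ind_Hom_def intro: PiE_ext)

context category
begin

text \<open>Independence of the representative once more. Two representatives agree at a stage
  \<open>k\<close>, and the compatibility of the family \<open>\<phi>\<close> rewrites each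
  contribution as the pullback of \<open>\<phi> k\<close> along the common map to stage
  \<open>k\<close>.\<close>

lemma germ_act_germ:
  assumes F: "F \<in> ind_objects C" and G: "G \<in> ind_objects C" and X: "X \<in> Ob C"
    and \<phi>: "\<phi> \<in> ind_Hom C F G" and j: "j \<in> Ob (shape F)" and f: "f \<in> Hom C X (dob F j)"
  shows "germ_act C X F G \<phi> (germ C X F j f) = germ_pullback C X (dob F j) G f (\<phi> j)"
proof -
  interpret diagram_in C F using F by (simp add: ind_objects_iff)
  have const: "germ_pullback C X (dob F j') G f' (\<phi> j') = germ_pullback C X (dob F j) G f (\<phi> j)"
    if mem: "(j', f') \<in> germ C X F j f" for j' f'
  proof -
    obtain k u v where k: "k \<in> Ob (shape F)" "u \<in> Hom (shape F) j k" "v \<in> Hom (shape F) j' k"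
      and eq: "Comp C X (dob F j) (dob F k) (dar F j k u) f = Comp C X (dob F j') (dob F k) (dar F j' k v) f'"
      and j': "j' \<in> Ob (shape F)" and f': "f' \<in> Hom C X (dob F j')"
      using germ_memD[OF mem] by (auto simp: germ_rel_def)
    have *: "germ_pullback C X (dob F i) G h (\<phi> i) =
        germ_pullback C X (dob F k) G (Comp C X (dob F i) (dob F k) (dar F i k w) h) (\<phi> k)"
      if "i \<in> Ob (shape F)" "h \<in> Hom C X (dob F i)" "w \<in> Hom (shape F) i k" for i h w
      using that k(1) ind_Hom_pullback[OF \<phi> that(1) k(1) that(3)] G X dob_in dar_in
        ind_Hom_colim_Hom[OF \<phi>]
      by (simp flip: germ_pullback_Comp)
    show ?thesis using *[OF j f k(2)] *[OF j' f' k(3)] eq by simp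
  qed
  show ?thesis
    unfolding germ_act_def by (rule UN_constant_eq[OF germ_self[OF F X j f]]) (unfold Ball_def split_paired_All prod.case, intro allI impI const)
qed

lemma germ_act_in:
  assumes "F \<in> ind_objects C" "G \<in> ind_objects C" "X \<in> Ob C"
    and "\<phi> \<in> ind_Hom C F G" "c \<in> colim_Hom C X F"
  shows "germ_act C X F G \<phi> c \<in> colim_Hom C X G"
proof -
  interpret diagram_in C F using assms by (simp add: ind_objects_iff)
  show ?thesis
    using assms(5,1-4)
    by (auto elim!: colim_Hom_cases simp: germ_act_germ
      intro!: germ_pullback_in dob_in ind_Hom_colim_Hom)
qed

text \<open>Naturality of the action in the test object. It makes composites in \<open>Ind C\<close>
  compatible families, and later shows that lifts of a cone fit together.\<close>

lemma germ_pullback_germ_act: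
  assumes F: "F \<in> ind_objects C" and G: "G \<in> ind_objects C" and X: "X \<in> Ob C" and Y: "Y \<in> Ob C"
    and \<phi>: "\<phi> \<in> ind_Hom C F G" and a: "a \<in> Hom C X Y" and c: "c \<in> colim_Hom C Y F"
  shows "germ_pullback C X Y G a (germ_act C Y F G \<phi> c) = germ_act C X F G \<phi> (germ_pullback C X Y F a c)"
proof -
  interpret diagram_in C F using assms by (simp add: ind_objects_iff)
  obtain j f where j: "j \<in> Ob (shape F)" and f: "f \<in> Hom C Y (dob F j)" and c: "c = germ C Y F j f"
    using c by (rule colim_Hom_cases)
  show ?thesis
    unfolding c using assms j f dob_in[OF j] ind_Hom_colim_Hom[OF \<phi> j]
    by (simp add: germ_act_germ germ_pullback_germ germ_pullback_Comp Comp_in[of X Y])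
qed

lemma Comp_Ind_in:
  assumes F: "F \<in> ind_objects C" and G: "G \<in> ind_objects C" and H: "H \<in> ind_objects C"
    and \<phi>: "\<phi> \<in> ind_Hom C F G" and \<psi>: "\<psi> \<in> ind_Hom C G H"
  shows "Comp (Ind C) F G H \<psi> \<phi> \<in> ind_Hom C F H"
proof -
  interpret diagram_in C F using assms by (simp add: ind_objects_iff)
  show ?thesis
    unfolding Comp_Ind
    using assms dob_in dar_in ind_Hom_colim_Hom[OF \<phi>] ind_Hom_pullback[OF \<phi>]
    by (auto simp: ind_Hom_def[of C F H] germ_act_in germ_pullback_germ_act)
qed

text \<open>At \<open>X = dob F i\<close> and \<open>c = \<phi> i\<close> this becomes associativity
  of composition in \<open>Ind C\<close>.\<close>

lemma germ_act_Comp: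
  assumes F: "F \<in> ind_objects C" and G: "G \<in> ind_objects C" and H: "H \<in> ind_objects C"
    and X: "X \<in> Ob C" and \<phi>: "\<phi> \<in> ind_Hom C F G" and \<psi>: "\<psi> \<in> ind_Hom C G H"
    and c: "c \<in> colim_Hom C X F"
  shows "germ_act C X F H (Comp (Ind C) F G H \<psi> \<phi>) c = germ_act C X G H \<psi> (germ_act C X F G \<phi> c)"
proof -
  interpret diagram_in C F using assms by (simp add: ind_objects_iff)
  obtain j f where j: "j \<in> Ob (shape F)" and f: "f \<in> Hom C X (dob F j)" and c: "c = germ C X F j f"
    using c by (rule colim_Hom_cases)
  show ?thesis
    unfolding c using assms j f dob_in[OF j] ind_Hom_colim_Hom[OF \<phi> j]
    by (simp add: germ_act_germ Comp_Ind_in)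
      (simp add: Comp_Ind germ_pullback_germ_act)
qed

lemma Id_Ind_in:
  assumes F: "F \<in> ind_objects C"
  shows "Id (Ind C) F \<in> ind_Hom C F F"
proof -
  interpret diagram_in C F using assms by (simp add: ind_objects_iff)
  have "germ C (dob F i) F i' (dar F i i' u) = germ C (dob F i) F i (Id C (dob F i))"
    if "i \<in> Ob (shape F)" "i' \<in> Ob (shape F)" "u \<in> Hom (shape F) i i'" for i i' u
    using that F dob_in dar_in[of i i' u] germ_dar[OF F dob_in that(1,2) Id_in[OF dob_in] that(3)]
    by (simp add: Comp_Id_right)
  then show ?thesis
    using F dob_in dar_in
    by (simp add: ind_Hom_def Id_in germ_pullback_germ Comp_Id_left germ_in_colim_Hom)
qed

lemma category_Ind: "category (Ind C :: (('i, 'k, 'o, 'a) diag, 'i \<Rightarrow> ('i \<times> 'a) set) cat)"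
proof
  fix F G H K :: "('i, 'k, 'o, 'a) diag" and \<phi> \<psi> \<chi>
  note [simp] = Comp_Ind_in ind_Hom_colim_Hom
  show "Id (Ind C) F \<in> Hom (Ind C) F F" if "F \<in> Ob (Ind C)"
    using that Id_Ind_in[of F] by simp
  show "Comp (Ind C) F G H \<psi> \<phi> \<in> Hom (Ind C) F H"
    if "F \<in> Ob (Ind C)" "G \<in> Ob (Ind C)" "H \<in> Ob (Ind C)" "\<phi> \<in> Hom (Ind C) F G" "\<psi> \<in> Hom (Ind C) G H"
    using that by simp
  show "Comp (Ind C) F F G \<phi> (Id (Ind C) F) = \<phi>"
    if *: "F \<in> Ob (Ind C)" "G \<in> Ob (Ind C)" "\<phi> \<in> Hom (Ind C) F G"
  proof (rule ind_Hom_eqI)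
    interpret diagram_in C F using that by (simp add: ind_objects_iff)
    show "Comp (Ind C) F F G \<phi> (Id (Ind C) F) \<in> ind_Hom C F G" "\<phi> \<in> ind_Hom C F G"
      using * Id_Ind_in[of F] by (simp_all del: Ind_simps(3))
    show "Comp (Ind C) F F G \<phi> (Id (Ind C) F) i = \<phi> i" if "i \<in> Ob (shape F)" for i
      using * that dob_in[OF that]
      by (simp add: Comp_Ind germ_act_germ Id_in germ_pullback_Id)
  qed
  show "Comp (Ind C) F G G (Id (Ind C) G) \<phi> = \<phi>"
    if *: "F \<in> Ob (Ind C)" "G \<in> Ob (Ind C)" "\<phi> \<in> Hom (Ind C) F G"
  proof (rule ind_Hom_eqI)
    interpret diagram_in C F using that by (simp add: ind_objects_iff)
    interpret G: diagram_in C G using that by (simp add: ind_objects_iff)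
    show "Comp (Ind C) F G G (Id (Ind C) G) \<phi> \<in> ind_Hom C F G" "\<phi> \<in> ind_Hom C F G"
      using * Id_Ind_in[of G] by (simp_all del: Ind_simps(3))
    show "Comp (Ind C) F G G (Id (Ind C) G) \<phi> i = \<phi> i" if i: "i \<in> Ob (shape F)" for i
    proof -
      obtain j f where j: "j \<in> Ob (shape G)" and f: "f \<in> Hom C (dob F i) (dob G j)"
        and \<phi>: "\<phi> i = germ C (dob F i) G j f"
        using * i ind_Hom_colim_Hom colim_Hom_cases by (metis Ind_simps(2))
      show ?thesis
        using * i j f dob_in[OF i] G.dob_in[OF j] Id_Ind_in[of G]
        by (simp add: Comp_Ind \<phi> germ_act_germ germ_pullback_germ Id_in Comp_Id_left)
    qed
  qed
  show "Comp (Ind C) F G K (Comp (Ind C) G H K \<chi> \<psi>) \<phi> = Comp (Ind C) F H K \<chi> (Comp (Ind C) F G H \<psi> \<phi>)"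
    if *: "F \<in> Ob (Ind C)" "G \<in> Ob (Ind C)" "H \<in> Ob (Ind C)" "K \<in> Ob (Ind C)"
      "\<phi> \<in> Hom (Ind C) F G" "\<psi> \<in> Hom (Ind C) G H" "\<chi> \<in> Hom (Ind C) H K"
  proof (rule ind_Hom_eqI)
    interpret diagram_in C F using that by (simp add: ind_objects_iff)
    show "Comp (Ind C) F G K (Comp (Ind C) G H K \<chi> \<psi>) \<phi> \<in> ind_Hom C F K"
      "Comp (Ind C) F H K \<chi> (Comp (Ind C) F G H \<psi> \<phi>) \<in> ind_Hom C F K"
      using * by simp_all
    show "Comp (Ind C) F G K (Comp (Ind C) G H K \<chi> \<psi>) \<phi> i =
        Comp (Ind C) F H K \<chi> (Comp (Ind C) F G H \<psi> \<phi>) i" if i: "i \<in> Ob (shape F)" for i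
    proof -
      have "germ_act C (dob F i) G K (Comp (Ind C) G H K \<chi> \<psi>) (\<phi> i) =
          germ_act C (dob F i) H K \<chi> (germ_act C (dob F i) G H \<psi> (\<phi> i))"
        using * i dob_in[OF i] by (intro germ_act_Comp) simp_all
      then show ?thesis using i by (simp add: Comp_Ind[of C F])
    qed
  qed
qed

end

section \<open>Limits and colimits in the Ind-completion\<close>

context category
begin

section \<open>Uniqueness of limits and colimits up to isomorphism\<close>

lemma limit_isomorphic:
  assumes L: "is_limit C D L p" and L': "is_limit C D L' p'"
  shows "isomorphic C L L'"
proof -
  interpret diagram_in C D using L by (simp add: is_limit_def)
  have cone: "is_cone C D L p" and cone': "is_cone C D L' p'"
    and ex: "\<And>X r. is_cone C D X r \<Longrightarrow>
      \<exists>!f. f \<in> Hom C X L \<and> (\<forall>i \<in> Ob (shape D). Comp C X L (dob D i) (p i) f = r i)"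
    and ex': "\<And>X r. is_cone C D X r \<Longrightarrow>
      \<exists>!f. f \<in> Hom C X L' \<and> (\<forall>i \<in> Ob (shape D). Comp C X L' (dob D i) (p' i) f = r i)"
    using L L' by (auto simp: is_limit_def)
  have ob: "L \<in> Ob C" "L' \<in> Ob C"
    and p: "\<And>i. i \<in> Ob (shape D) \<Longrightarrow> p i \<in> Hom C L (dob D i)"
      "\<And>i. i \<in> Ob (shape D) \<Longrightarrow> p' i \<in> Hom C L' (dob D i)"
    using cone cone' by (auto simp: is_cone_def)
  obtain f where f: "f \<in> Hom C L L'" "\<And>i. i \<in> Ob (shape D) \<Longrightarrow> Comp C L L' (dob D i) (p' i) f = p i"
    using ex'[OF cone] by auto
  obtain g where g: "g \<in> Hom C L' L" "\<And>i. i \<in> Ob (shape D) \<Longrightarrow> Comp C L' L (dob D i) (p i) g = p' i"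
    using ex[OF cone'] by auto
  have "Comp C L L' L g f = Id C L"
  proof -
    have "Comp C L L (dob D i) (p i) (Comp C L L' L g f) = p i" if "i \<in> Ob (shape D)" for i
      using that ob f g p dob_in by (simp flip: Comp_assoc)
    moreover have "Comp C L L (dob D i) (p i) (Id C L) = p i" if "i \<in> Ob (shape D)" for i
      using that ob p dob_in by (simp add: Comp_Id_right)
    ultimately show ?thesis
      using ex[OF cone] Comp_in[OF ob ob(1) f(1) g(1)] Id_in[OF ob(1)] by blast
  qed
  moreover have "Comp C L' L L' f g = Id C L'"
  proof -
    have "Comp C L' L' (dob D i) (p' i) (Comp C L' L L' f g) = p' i" if "i \<in> Ob (shape D)" for i
      using that ob f g p dob_in by (simp flip: Comp_assoc)
    moreover have "Comp C L' L' (dob D i) (p' i) (Id C L') = p' i" if "i \<in> Ob (shape D)" for i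
      using that ob p dob_in by (simp add: Comp_Id_right)
    ultimately show ?thesis
      using ex'[OF cone'] Comp_in[OF ob(2,1,2) g(1) f(1)] Id_in[OF ob(2)] by blast
  qed
  ultimately show ?thesis
    using ob f g by (auto simp: isomorphic_def)
qed

lemma colimit_isomorphic:
  assumes L: "is_colimit C D L q" and L': "is_colimit C D L' q'"
  shows "isomorphic C L L'"
proof -
  interpret diagram_in C D using L by (simp add: is_colimit_def)
  have cocone: "is_cocone C D L q" and cocone': "is_cocone C D L' q'"
    and ex: "\<And>X r. is_cocone C D X r \<Longrightarrow>
      \<exists>!f. f \<in> Hom C L X \<and> (\<forall>i \<in> Ob (shape D). Comp C (dob D i) L X f (q i) = r i)"
    and ex': "\<And>X r. is_cocone C D X r \<Longrightarrow>
      \<exists>!f. f \<in> Hom C L' X \<and> (\<forall>i \<in> Ob (shape D). Comp C (dob D i) L' X f (q' i) = r i)"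
    using L L' by (auto simp: is_colimit_def)
  have ob: "L \<in> Ob C" "L' \<in> Ob C"
    and q: "\<And>i. i \<in> Ob (shape D) \<Longrightarrow> q i \<in> Hom C (dob D i) L"
      "\<And>i. i \<in> Ob (shape D) \<Longrightarrow> q' i \<in> Hom C (dob D i) L'"
    using cocone cocone' by (auto simp: is_cocone_def)
  obtain f where f: "f \<in> Hom C L L'" "\<And>i. i \<in> Ob (shape D) \<Longrightarrow> Comp C (dob D i) L L' f (q i) = q' i"
    using ex[OF cocone'] by auto
  obtain g where g: "g \<in> Hom C L' L" "\<And>i. i \<in> Ob (shape D) \<Longrightarrow> Comp C (dob D i) L' L g (q' i) = q i"
    using ex'[OF cocone] by auto
  have "Comp C L L' L g f = Id C L"
  proof -
    have "Comp C (dob D i) L L (Comp C L L' L g f) (q i) = q i" if "i \<in> Ob (shape D)" for i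
      using that ob f g q dob_in by (simp add: Comp_assoc)
    moreover have "Comp C (dob D i) L L (Id C L) (q i) = q i" if "i \<in> Ob (shape D)" for i
      using that ob q dob_in by (simp add: Comp_Id_left)
    ultimately show ?thesis
      using ex[OF cocone] Comp_in[OF ob ob(1) f(1) g(1)] Id_in[OF ob(1)] by blast
  qed
  moreover have "Comp C L' L L' f g = Id C L'"
  proof -
    have "Comp C (dob D i) L' L' (Comp C L' L L' f g) (q' i) = q' i" if "i \<in> Ob (shape D)" for i
      using that ob f g q dob_in by (simp add: Comp_assoc)
    moreover have "Comp C (dob D i) L' L' (Id C L') (q' i) = q' i" if "i \<in> Ob (shape D)" for i
      using that ob q dob_in by (simp add: Comp_Id_left)
    ultimately show ?thesis
      using ex'[OF cocone'] Comp_in[OF ob(2,1,2) g(1) f(1)] Id_in[OF ob(2)] by blast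
  qed
  ultimately show ?thesis
    using ob f g by (auto simp: isomorphic_def)
qed

end

section \<open>Constant systems and the diagrams they form\<close>

lemma point_cat_simps [simp]:
  "Ob point_cat = {undefined}"
  "Hom point_cat i j = {undefined}"
  "Id point_cat i = undefined"
  "Comp point_cat i j k v u = undefined"
  by (simp_all add: point_cat_def)

lemma ind_embed_simps [simp]:
  "shape (ind_embed C X) = point_cat"
  "dob (ind_embed C X) i = X"
  "dar (ind_embed C X) i j u = Id C X"
  by (simp_all add: ind_embed_def)

lemma ind_diag_simps [simp]:
  "shape (ind_diag C D) = shape D"
  "dob (ind_diag C D) j = ind_embed C (dob D j)"
  by (simp_all add: ind_diag_def)

lemma restrict_singleton_eq_iff [simp]: "restrict f {a} = restrict g {a} \<longleftrightarrow> f a = g a"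
  by (auto simp: restrict_def fun_eq_iff)

lemma ind_diag_dar:
  "dar (ind_diag C D :: ('j, 'l, ('i, 'k, 'o, 'a) diag, 'i \<Rightarrow> ('i \<times> 'a) set) diag) j j' u =
    (\<lambda>i \<in> {undefined}. germ C (dob D j) (ind_embed C (dob D j') :: ('i, 'k, 'o, 'a) diag) undefined (dar D j j' u))"
  by (simp add: ind_diag_def ind_embed_arr_def germ_def)

context category
begin

lemma ind_embed_in:
  assumes "X \<in> Ob C"
  shows "ind_embed C X \<in> ind_objects C"
  unfolding ind_objects_iff
  by (intro conjI filtered_category.intro category.intro filtered_category_axioms.intro diagram_in.intro)
    (use assms in \<open>simp_all add: Id_in Comp_Id_left\<close>)

lemma colim_Hom_embed:
  assumes "c \<in> colim_Hom C X (ind_embed C Y :: ('i, 'k, 'o, 'a) diag)"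
  shows "\<exists>f \<in> Hom C X Y. c = germ C X (ind_embed C Y :: ('i, 'k, 'o, 'a) diag) undefined f"
  using assms by (auto elim!: colim_Hom_cases)

lemma germ_embed_in:
  "f \<in> Hom C X Y \<Longrightarrow> germ C X (ind_embed C Y :: ('i, 'k, 'o, 'a) diag) undefined f \<in> colim_Hom C X (ind_embed C Y :: ('i, 'k, 'o, 'a) diag)"
  by (simp add: germ_in_colim_Hom)

text \<open>A constant system has a single stage and only the identity as transition map, so nothing
  gets identified at a later stage.\<close>

lemma germ_embed_eq_iff:
  assumes "X \<in> Ob C" "Y \<in> Ob C" "f \<in> Hom C X Y" "g \<in> Hom C X Y"
  shows "germ C X (ind_embed C Y :: ('i, 'k, 'o, 'a) diag) undefined f = germ C X (ind_embed C Y :: ('i, 'k, 'o, 'a) diag) undefined g \<longleftrightarrow> f = g"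
  using assms by (auto simp: germ_eq_iff ind_embed_in germ_rel_def Comp_Id_left)

lemma germ_pullback_embed:
  assumes "X \<in> Ob C" "Y \<in> Ob C" "Z \<in> Ob C" "a \<in> Hom C X Y" "f \<in> Hom C Y Z"
  shows "germ_pullback C X Y (ind_embed C Z :: ('i, 'k, 'o, 'a) diag) a (germ C Y (ind_embed C Z :: ('i, 'k, 'o, 'a) diag) undefined f) =
    germ C X (ind_embed C Z :: ('i, 'k, 'o, 'a) diag) undefined (Comp C X Y Z f a)"
  using assms by (simp add: germ_pullback_germ ind_embed_in)

text \<open>The only compatibility condition is the one for the identity arrow of the point, and it
  holds by \<open>germ_pullback_Id\<close>. Arrows out of a constant system are thus single germs,
  stored at the index \<open>undefined\<close>.\<close>

lemma ind_Hom_embed_iff: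
  assumes X: "X \<in> Ob C" and G: "G \<in> ind_objects C"
  shows "\<phi> \<in> ind_Hom C (ind_embed C X :: ('i, 'k, 'o, 'a) diag) G \<longleftrightarrow> \<phi> \<in> {undefined} \<rightarrow>\<^sub>E colim_Hom C X G"
  using germ_pullback_Id[OF G X] by (simp add: ind_Hom_def) (metis PiE_mem singletonI)

lemma germ_act_embed:
  assumes "X \<in> Ob C" "Y \<in> Ob C" "G \<in> ind_objects C" "\<phi> \<in> ind_Hom C (ind_embed C Y :: ('i, 'k, 'o, 'a) diag) G" "f \<in> Hom C X Y"
  shows "germ_act C X (ind_embed C Y :: ('i, 'k, 'o, 'a) diag) G \<phi> (germ C X (ind_embed C Y :: ('i, 'k, 'o, 'a) diag) undefined f) =
    germ_pullback C X Y G f (\<phi> undefined)"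
  using assms by (simp add: germ_act_germ ind_embed_in)

lemma diagram_in_ind_diag:
  assumes "diagram_in C D"
  shows "diagram_in (Ind C) (ind_diag C D ::
    ('j, 'l, ('i, 'k, 'o, 'a) diag, 'i \<Rightarrow> ('i \<times> 'a) set) diag)" (is "diagram_in _ ?D")
proof -
  interpret D: diagram_in C D by fact
  let ?E = "\<lambda>j. ind_embed C (dob D j) :: ('i, 'k, 'o, 'a) diag"
  have dar: "dar ?D j j' u \<in> ind_Hom C (dob ?D j) (dob ?D j')"
    if "j \<in> Ob (shape D)" "j' \<in> Ob (shape D)" "u \<in> Hom (shape D) j j'" for j j' u
    using that D.dob_in D.dar_in
    by (simp add: ind_diag_dar ind_Hom_embed_iff ind_embed_in germ_embed_in)
  show ?thesis
  proof (rule diagram_in.intro)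
    show "category (shape ?D)" using D.shape by simp
    show "dob ?D j \<in> Ob (Ind C)" if "j \<in> Ob (shape ?D)" for j
      using that D.dob_in by (simp add: ind_embed_in)
    show "dar ?D j j' u \<in> Hom (Ind C) (dob ?D j) (dob ?D j')"
      if "j \<in> Ob (shape ?D)" "j' \<in> Ob (shape ?D)" "u \<in> Hom (shape ?D) j j'" for j j' u
      using that dar by simp
    show "dar ?D j j (Id (shape ?D) j) = Id (Ind C) (dob ?D j)" if "j \<in> Ob (shape ?D)" for j
      using that D.dar_Id by (simp add: ind_diag_dar)
    show "dar ?D i k (Comp (shape ?D) i j k v u) =
        Comp (Ind C) (dob ?D i) (dob ?D j) (dob ?D k) (dar ?D j k v) (dar ?D i j u)"
      if "i \<in> Ob (shape ?D)" "j \<in> Ob (shape ?D)" "k \<in> Ob (shape ?D)"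
        "u \<in> Hom (shape ?D) i j" "v \<in> Hom (shape ?D) j k" for i j k u v
    proof -
      have "germ_act C (dob D i) (?E j) (?E k) (dar ?D j k v) (germ C (dob D i) (?E j) undefined (dar D i j u)) =
        germ C (dob D i) (?E k) undefined (dar D i k (Comp (shape D) i j k v u))"
        using that dar[of j k v] D.dob_in D.dar_in
        by (simp add: germ_act_embed ind_embed_in)
          (simp add: ind_diag_dar germ_pullback_embed D.dar_Comp)
      then show ?thesis
        by (simp add: Comp_Ind ind_diag_dar[of C D i])
    qed
  qed
qed

text \<open>The bijection \<open>\<sigma>\<close> only serves to move the index category of \<open>D\<close> into the types over which
  Ind-objects are indexed.\<close>

lemma is_colimit_ind_diag:
  fixes D :: "('j, 'l, 'o, 'a) diag" and F :: "('i, 'k, 'o, 'a) diag"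
  assumes D: "diagram_in C D" and F: "F \<in> ind_objects C"
    and \<sigma>: "bij_betw \<sigma> (Ob (shape D)) (Ob (shape F))"
    and dob: "\<And>j. j \<in> Ob (shape D) \<Longrightarrow> dob F (\<sigma> j) = dob D j"
    and to: "\<And>j j' u. \<lbrakk>j \<in> Ob (shape D); j' \<in> Ob (shape D); u \<in> Hom (shape D) j j'\<rbrakk> \<Longrightarrow>
      \<exists>v \<in> Hom (shape F) (\<sigma> j) (\<sigma> j'). dar F (\<sigma> j) (\<sigma> j') v = dar D j j' u"
    and fro: "\<And>j j' v. \<lbrakk>j \<in> Ob (shape D); j' \<in> Ob (shape D); v \<in> Hom (shape F) (\<sigma> j) (\<sigma> j')\<rbrakk> \<Longrightarrow>
      \<exists>u \<in> Hom (shape D) j j'. dar F (\<sigma> j) (\<sigma> j') v = dar D j j' u"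
  shows "is_colimit (Ind C) (ind_diag C D) F
    (\<lambda>j. \<lambda>i \<in> {undefined}. germ C (dob D j) F (\<sigma> j) (Id C (dob D j)))" (is "is_colimit _ _ _ ?q")
proof -
  interpret D: diagram_in C D by fact
  let ?D = "ind_diag C D :: ('j, 'l, ('i, 'k, 'o, 'a) diag, 'i \<Rightarrow> ('i \<times> 'a) set) diag"
  interpret DD: diagram_in "Ind C" ?D by (rule diagram_in_ind_diag[OF D])
  let ?E = "\<lambda>j. ind_embed C (dob D j) :: ('i, 'k, 'o, 'a) diag"
  have \<sigma>_in: "\<sigma> j \<in> Ob (shape F)" if "j \<in> Ob (shape D)" for j
    using \<sigma> that by (auto simp: bij_betw_def)
  \<comment> \<open>Both sides are families over the one-point index set, so their equality is
    tested at \<open>undefined\<close>. The cocone condition becomes a condition on germs.\<close>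
  have compat: "Comp (Ind C) (dob ?D j) (dob ?D j') G r' (dar ?D j j' u) = r \<longleftrightarrow>
      germ_pullback C (dob D j) (dob D j') G (dar D j j' u) (r' undefined) = r undefined"
    if "G \<in> ind_objects C" "j \<in> Ob (shape D)" "j' \<in> Ob (shape D)" "u \<in> Hom (shape D) j j'"
      "r' \<in> ind_Hom C (?E j') G" "r \<in> ind_Hom C (?E j) G" for G j j' u r r'
  proof -
    have "Comp (Ind C) (dob ?D j) (dob ?D j') G r' (dar ?D j j' u) =
        (\<lambda>i \<in> {undefined}. germ_pullback C (dob D j) (dob D j') G (dar D j j' u) (r' undefined))"
      using that D.dob_in D.dar_in
      by (simp add: Comp_Ind ind_diag_dar germ_act_embed)
    moreover have "r = (\<lambda>i \<in> {undefined}. r undefined)"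
      using that D.dob_in by (auto simp: ind_Hom_embed_iff PiE_iff extensional_def restrict_def fun_eq_iff)
    ultimately show ?thesis by (metis restrict_apply' singletonI)
  qed
  have q: "?q j \<in> ind_Hom C (?E j) F" if "j \<in> Ob (shape D)" for j
    using that F D.dob_in germ_in_colim_Hom[OF \<sigma>_in[OF that], of "Id C (dob D j)" "dob D j"]
    by (simp add: ind_Hom_embed_iff dob Id_in)
  have cocone: "is_cocone (Ind C) ?D F ?q"
    unfolding is_cocone_def
  proof (intro conjI ballI)
    show "F \<in> Ob (Ind C)" using F by simp
    show "?q j \<in> Hom (Ind C) (dob ?D j) F" if "j \<in> Ob (shape ?D)" for j
      using that q by simp
    fix j j' u assume "j \<in> Ob (shape ?D)" "j' \<in> Ob (shape ?D)" "u \<in> Hom (shape ?D) j j'"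
    then have j: "j \<in> Ob (shape D)" "j' \<in> Ob (shape D)" "u \<in> Hom (shape D) j j'" by simp_all
    obtain v where v: "v \<in> Hom (shape F) (\<sigma> j) (\<sigma> j')" "dar F (\<sigma> j) (\<sigma> j') v = dar D j j' u"
      using to j by blast
    \<comment> \<open>The legs are germs of identities; their compatibility is
      \<open>germ_dar\<close> for the identity of \<open>dob D j\<close>.\<close>
    have "germ C (dob D j) F (\<sigma> j') (Comp C (dob D j) (dob D j') (dob D j') (Id C (dob D j')) (dar D j j' u)) =
        germ C (dob D j) F (\<sigma> j) (Id C (dob D j))"
      using germ_dar[OF F D.dob_in[OF j(1)] \<sigma>_in[OF j(1)] \<sigma>_in[OF j(2)] _ v(1), of "Id C (dob D j)"]
        j v(2) D.dob_in D.dar_in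
      by (simp add: dob Id_in Comp_Id_left Comp_Id_right)
    then show "Comp (Ind C) (dob ?D j) (dob ?D j') F (?q j') (dar ?D j j' u) = ?q j"
      using j F q D.dob_in D.dar_in \<sigma>_in
      by (simp only: compat) (simp add: germ_pullback_germ dob Id_in)
  qed
  have "\<exists>!\<phi>. \<phi> \<in> Hom (Ind C) F G \<and> (\<forall>j \<in> Ob (shape ?D). Comp (Ind C) (dob ?D j) F G \<phi> (?q j) = r j)"
    if "is_cocone (Ind C) ?D G r" for G r
  proof -
    have G: "G \<in> ind_objects C" and r: "\<And>j. j \<in> Ob (shape D) \<Longrightarrow> r j \<in> ind_Hom C (?E j) G"
      and rr: "\<And>j j' u. \<lbrakk>j \<in> Ob (shape D); j' \<in> Ob (shape D); u \<in> Hom (shape D) j j'\<rbrakk> \<Longrightarrow>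
        germ_pullback C (dob D j) (dob D j') G (dar D j j' u) (r j' undefined) = r j undefined"
      using that by (auto simp: is_cocone_def compat[symmetric])
    have r_in: "r j undefined \<in> colim_Hom C (dob D j) G" if "j \<in> Ob (shape D)" for j
      using r[OF that] that G D.dob_in by (auto simp: ind_Hom_embed_iff)
    \<comment> \<open>Composing with the germ of an identity evaluates \<open>\<phi>\<close> at the
      stage \<open>\<sigma> j\<close>. The mediating arrow is therefore prescribed at every stage,
      which gives uniqueness at once.\<close>
    have comp: "Comp (Ind C) (dob ?D j) F G \<phi> (?q j) = r j \<longleftrightarrow> \<phi> (\<sigma> j) = r j undefined"
      if "j \<in> Ob (shape D)" "\<phi> \<in> ind_Hom C F G" for j \<phi>
    proof -
      have "Comp (Ind C) (dob ?D j) F G \<phi> (?q j) = (\<lambda>i \<in> {undefined}. \<phi> (\<sigma> j))"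
        using that F G D.dob_in[OF that(1)] \<sigma>_in[OF that(1)] ind_Hom_colim_Hom[OF that(2) \<sigma>_in[OF that(1)]]
        by (simp add: Comp_Ind germ_act_germ dob Id_in germ_pullback_Id)
      moreover have "r j = (\<lambda>i \<in> {undefined}. r j undefined)"
        using r[OF that(1)] that(1) G D.dob_in by (auto simp: ind_Hom_embed_iff PiE_iff extensional_def restrict_def fun_eq_iff)
      ultimately show ?thesis by (metis restrict_apply' singletonI)
    qed
    define \<tau> where "\<tau> = inv_into (Ob (shape D)) \<sigma>"
    have \<tau>: "\<tau> i \<in> Ob (shape D)" "\<sigma> (\<tau> i) = i" if "i \<in> Ob (shape F)" for i
      using that \<sigma> by (auto simp: \<tau>_def bij_betw_def inv_into_into f_inv_into_f)
    have \<tau>\<sigma>: "\<tau> (\<sigma> j) = j" if "j \<in> Ob (shape D)" for j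
      using that \<sigma> by (simp add: \<tau>_def bij_betw_def)
    \<comment> \<open>The mediating arrow is the cocone itself, read as a family of germs: the
      cocone identities are exactly the compatibility required in \<open>ind_Hom\<close>.\<close>
    define \<phi> where "\<phi> = (\<lambda>i \<in> Ob (shape F). r (\<tau> i) undefined)"
    have "\<phi> i \<in> colim_Hom C (dob F i) G" if "i \<in> Ob (shape F)" for i
      using that r_in[OF \<tau>(1)[OF that]] \<tau>[OF that] dob[OF \<tau>(1)[OF that]] by (simp add: \<phi>_def)
    moreover have "germ_pullback C (dob F i) (dob F i') G (dar F i i' v) (\<phi> i') = \<phi> i"
      if i: "i \<in> Ob (shape F)" "i' \<in> Ob (shape F)" and v: "v \<in> Hom (shape F) i i'" for i i' v
    proof -
      obtain u where "u \<in> Hom (shape D) (\<tau> i) (\<tau> i')" "dar F i i' v = dar D (\<tau> i) (\<tau> i') u"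
        using fro[of "\<tau> i" "\<tau> i'" v] i v \<tau> by auto
      then show ?thesis
        using rr[of "\<tau> i" "\<tau> i'" u] i \<tau> dob[of "\<tau> i"] dob[of "\<tau> i'"] by (simp add: \<phi>_def)
    qed
    ultimately have \<phi>: "\<phi> \<in> ind_Hom C F G"
      by (auto simp: ind_Hom_def \<phi>_def)
    show ?thesis
    proof (rule ex1I)
      show "\<phi> \<in> Hom (Ind C) F G \<and> (\<forall>j \<in> Ob (shape ?D). Comp (Ind C) (dob ?D j) F G \<phi> (?q j) = r j)"
        unfolding Ind_simps ind_diag_simps(1)
        using \<phi> by (intro conjI ballI comp[THEN iffD2]) (simp_all add: \<phi>_def \<tau>\<sigma> \<sigma>_in)
      fix \<psi> assume "\<psi> \<in> Hom (Ind C) F G \<and> (\<forall>j \<in> Ob (shape ?D). Comp (Ind C) (dob ?D j) F G \<psi> (?q j) = r j)"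
      then have \<psi>: "\<psi> \<in> ind_Hom C F G" and eq: "\<And>j. j \<in> Ob (shape D) \<Longrightarrow> \<psi> (\<sigma> j) = r j undefined"
        by (auto simp only: Ind_simps ind_diag_simps(1) comp)
      show "\<psi> = \<phi>"
        using \<psi> \<phi> by (rule ind_Hom_eqI) (metis \<phi>_def \<tau> eq restrict_apply')
    qed
  qed
  then show ?thesis
    using DD.diagram_in_axioms cocone by (simp add: is_colimit_def del: Ind_simps)
qed

text \<open>For a vertex \<open>X\<close> in \<open>C\<close>, the assumptions \<open>ex\<close> and
  \<open>uniq\<close> say that germs from \<open>X\<close> to \<open>F\<close> correspond
  bijectively to cones over \<open>D\<close> with vertex \<open>X\<close>. This is enough for all
  Ind-objects: a cone with vertex \<open>G\<close> gives a cone on every stage of \<open>G\<close>,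
  and uniqueness forces the lifts of these to be compatible.\<close>

lemma is_limit_ind_diag:
  fixes D :: "('j, 'l, 'o, 'a) diag" and F :: "('i, 'k, 'o, 'a) diag"
  assumes D: "diagram_in C D" and F: "F \<in> ind_objects C"
    and \<pi>: "\<And>i j. \<lbrakk>i \<in> Ob (shape F); j \<in> Ob (shape D)\<rbrakk> \<Longrightarrow> \<pi> i j \<in> Hom C (dob F i) (dob D j)"
    and \<pi>_F: "\<And>i i' u j. \<lbrakk>i \<in> Ob (shape F); i' \<in> Ob (shape F); u \<in> Hom (shape F) i i'; j \<in> Ob (shape D)\<rbrakk> \<Longrightarrow>
      Comp C (dob F i) (dob F i') (dob D j) (\<pi> i' j) (dar F i i' u) = \<pi> i j"
    and \<pi>_D: "\<And>i j j' v. \<lbrakk>i \<in> Ob (shape F); j \<in> Ob (shape D); j' \<in> Ob (shape D); v \<in> Hom (shape D) j j'\<rbrakk> \<Longrightarrow>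
      Comp C (dob F i) (dob D j) (dob D j') (dar D j j' v) (\<pi> i j) = \<pi> i j'"
    and ex: "\<And>X h. is_cone C D X h \<Longrightarrow>
      \<exists>i \<in> Ob (shape F). \<exists>g \<in> Hom C X (dob F i). \<forall>j \<in> Ob (shape D). Comp C X (dob F i) (dob D j) (\<pi> i j) g = h j"
    and uniq: "\<And>X i i' g g'. \<lbrakk>X \<in> Ob C; i \<in> Ob (shape F); i' \<in> Ob (shape F);
        g \<in> Hom C X (dob F i); g' \<in> Hom C X (dob F i');
        \<And>j. j \<in> Ob (shape D) \<Longrightarrow> Comp C X (dob F i) (dob D j) (\<pi> i j) g = Comp C X (dob F i') (dob D j) (\<pi> i' j) g'\<rbrakk> \<Longrightarrow>
      germ C X F i g = germ C X F i' g'"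
  shows "is_limit (Ind C) (ind_diag C D) F
    (\<lambda>j. \<lambda>i \<in> Ob (shape F). germ C (dob F i) (ind_embed C (dob D j) :: ('i, 'k, 'o, 'a) diag) undefined (\<pi> i j))" (is "is_limit _ _ _ ?p")
proof -
  interpret D: diagram_in C D by fact
  interpret F: diagram_in C F using F by (simp add: ind_objects_iff)
  let ?E = "\<lambda>j. ind_embed C (dob D j) :: ('i, 'k, 'o, 'a) diag"
  let ?D = "ind_diag C D :: ('j, 'l, ('i, 'k, 'o, 'a) diag, 'i \<Rightarrow> ('i \<times> 'a) set) diag"
  interpret DD: diagram_in "Ind C" ?D by (rule diagram_in_ind_diag[OF D])
  have E: "?E j \<in> ind_objects C" if "j \<in> Ob (shape D)" for j
    using that D.dob_in ind_embed_in by blast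
  have p: "?p j \<in> ind_Hom C F (?E j)" if "j \<in> Ob (shape D)" for j
    using that \<pi> \<pi>_F F.dob_in F.dar_in D.dob_in
    by (auto simp: ind_Hom_def germ_embed_in germ_pullback_embed)
  have act_p: "germ_act C X F (?E j) (?p j) (germ C X F i g) =
      germ C X (?E j) undefined (Comp C X (dob F i) (dob D j) (\<pi> i j) g)"
    if "X \<in> Ob C" "i \<in> Ob (shape F)" "j \<in> Ob (shape D)" "g \<in> Hom C X (dob F i)" for X i j g
    using that p[OF that(3)] F E \<pi> F.dob_in D.dob_in
    by (simp add: germ_act_germ germ_pullback_embed)
  have act_dar: "germ_act C X (?E j) (?E j') (dar ?D j j' v) (germ C X (?E j) undefined g) =
      germ C X (?E j') undefined (Comp C X (dob D j) (dob D j') (dar D j j' v) g)"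
    if "X \<in> Ob C" "j \<in> Ob (shape D)" "j' \<in> Ob (shape D)" "v \<in> Hom (shape D) j j'" "g \<in> Hom C X (dob D j)" for X j j' v g
  proof -
    have "dar ?D j j' v \<in> ind_Hom C (?E j) (?E j')"
      using that DD.dar_in[of j j' v] by simp
    then show ?thesis
      using that D.dob_in D.dar_in E by (simp add: germ_act_embed) (simp add: ind_diag_dar germ_pullback_embed)
  qed
  have cone: "is_cone (Ind C) ?D F ?p"
    unfolding is_cone_def
  proof (intro conjI ballI)
    show "F \<in> Ob (Ind C)" using F by simp
    show "?p j \<in> Hom (Ind C) F (dob ?D j)" if "j \<in> Ob (shape ?D)" for j
      using that p by simp
    show "Comp (Ind C) F (dob ?D j) (dob ?D j') (dar ?D j j' v) (?p j) = ?p j'"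
      if "j \<in> Ob (shape ?D)" "j' \<in> Ob (shape ?D)" "v \<in> Hom (shape ?D) j j'" for j j' v
      unfolding Comp_Ind using that by (intro restrict_ext) (simp add: act_dar \<pi> \<pi>_D F.dob_in)
  qed
  \<comment> \<open>The legs are jointly injective on generalised elements. This serves twice: for
    the compatibility of the lifts and for the uniqueness of the mediating arrow.\<close>
  have inj: "c = c'"
    if X: "X \<in> Ob C" and c: "c \<in> colim_Hom C X F" "c' \<in> colim_Hom C X F"
      and eq: "\<And>j. j \<in> Ob (shape D) \<Longrightarrow> germ_act C X F (?E j) (?p j) c = germ_act C X F (?E j) (?p j) c'" for X c c'
  proof -
    obtain i g where i: "i \<in> Ob (shape F)" "g \<in> Hom C X (dob F i)" and c1: "c = germ C X F i g"
      using c(1) by (rule colim_Hom_cases)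
    obtain i' g' where i': "i' \<in> Ob (shape F)" "g' \<in> Hom C X (dob F i')" and c2: "c' = germ C X F i' g'"
      using c(2) by (rule colim_Hom_cases)
    have "Comp C X (dob F i) (dob D j) (\<pi> i j) g = Comp C X (dob F i') (dob D j) (\<pi> i' j) g'"
      if j: "j \<in> Ob (shape D)" for j
    proof (rule germ_embed_eq_iff[THEN iffD1])
      show "Comp C X (dob F i) (dob D j) (\<pi> i j) g \<in> Hom C X (dob D j)"
        "Comp C X (dob F i') (dob D j) (\<pi> i' j) g' \<in> Hom C X (dob D j)"
        using X i i' j \<pi> D.dob_in F.dob_in by (simp_all add: Comp_in)
      show "germ C X (?E j) undefined (Comp C X (dob F i) (dob D j) (\<pi> i j) g) =
          germ C X (?E j) undefined (Comp C X (dob F i') (dob D j) (\<pi> i' j) g')"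
        using eq[OF j] i i' j X unfolding c1 c2 by (simp only: act_p)
    qed (use X D.dob_in j in auto)
    then show ?thesis unfolding c1 c2 using X i i' by (intro uniq)
  qed
  have "\<exists>!\<phi>. \<phi> \<in> Hom (Ind C) G F \<and> (\<forall>j \<in> Ob (shape ?D). Comp (Ind C) G F (dob ?D j) (?p j) \<phi> = r j)"
    if cone_r: "is_cone (Ind C) ?D G r" for G r
  proof -
    have G: "G \<in> ind_objects C" and r: "\<And>j. j \<in> Ob (shape D) \<Longrightarrow> r j \<in> ind_Hom C G (?E j)"
      and rr: "\<And>j j' v. \<lbrakk>j \<in> Ob (shape D); j' \<in> Ob (shape D); v \<in> Hom (shape D) j j'\<rbrakk> \<Longrightarrow>
        Comp (Ind C) G (?E j) (?E j') (dar ?D j j' v) (r j) = r j'"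
      using cone_r by (auto simp: is_cone_def)
    interpret G: diagram_in C G using G by (simp add: ind_objects_iff)
    have "\<exists>c \<in> colim_Hom C (dob G y) F. \<forall>j \<in> Ob (shape D). germ_act C (dob G y) F (?E j) (?p j) c = r j y"
      if y: "y \<in> Ob (shape G)" for y
    proof -
      \<comment> \<open>The targets are constant systems, so each germ \<open>r j y\<close> comes
        from an honest arrow \<open>h j\<close>. These arrows form a cone in \<open>C\<close>, to
        which \<open>ex\<close> applies.\<close>
      have "\<forall>j \<in> Ob (shape D). \<exists>h. h \<in> Hom C (dob G y) (dob D j) \<and> r j y = germ C (dob G y) (?E j) undefined h"
        using r y colim_Hom_embed ind_Hom_colim_Hom by meson
      then obtain h where h: "\<And>j. j \<in> Ob (shape D) \<Longrightarrow> h j \<in> Hom C (dob G y) (dob D j)"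
        and rh: "\<And>j. j \<in> Ob (shape D) \<Longrightarrow> r j y = germ C (dob G y) (?E j) undefined (h j)"
        by metis
      have "Comp C (dob G y) (dob D j) (dob D j') (dar D j j' v) (h j) = h j'"
        if j: "j \<in> Ob (shape D)" "j' \<in> Ob (shape D)" "v \<in> Hom (shape D) j j'" for j j' v
      proof (rule germ_embed_eq_iff[THEN iffD1])
        have "germ_act C (dob G y) (?E j) (?E j') (dar ?D j j' v) (r j y) = r j' y"
          using fun_cong[OF rr[OF j], of y] y by (simp add: Comp_Ind)
        then show "germ C (dob G y) (?E j') undefined (Comp C (dob G y) (dob D j) (dob D j') (dar D j j' v) (h j)) =
            germ C (dob G y) (?E j') undefined (h j')"
          using act_dar[OF G.dob_in[OF y] j h[OF j(1)]] rh j by simp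
      qed (use y G.dob_in D.dob_in D.dar_in j h in \<open>simp_all add: Comp_in\<close>)
      then have "is_cone C D (dob G y) h"
        using h G.dob_in[OF y] by (simp add: is_cone_def)
      from ex[OF this] obtain i g where i: "i \<in> Ob (shape F)" and g: "g \<in> Hom C (dob G y) (dob F i)"
        and "\<forall>j \<in> Ob (shape D). Comp C (dob G y) (dob F i) (dob D j) (\<pi> i j) g = h j"
        by blast
      then have "\<forall>j \<in> Ob (shape D). germ_act C (dob G y) F (?E j) (?p j) (germ C (dob G y) F i g) = r j y"
        using act_p[OF G.dob_in[OF y] i _ g] rh by simp
      then show ?thesis using germ_in_colim_Hom[OF i g] by blast
    qed
    then have "\<exists>c. \<forall>y \<in> Ob (shape G). c y \<in> colim_Hom C (dob G y) F \<and>
        (\<forall>j \<in> Ob (shape D). germ_act C (dob G y) F (?E j) (?p j) (c y) = r j y)"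
      by (intro bchoice) blast
    then obtain c where c: "\<And>y. y \<in> Ob (shape G) \<Longrightarrow> c y \<in> colim_Hom C (dob G y) F"
      and act_c: "\<And>y j. \<lbrakk>y \<in> Ob (shape G); j \<in> Ob (shape D)\<rbrakk> \<Longrightarrow>
        germ_act C (dob G y) F (?E j) (?p j) (c y) = r j y"
      by blast
    have comp: "Comp (Ind C) G F (dob ?D j) (?p j) \<phi> = r j \<longleftrightarrow>
        (\<forall>y \<in> Ob (shape G). germ_act C (dob G y) F (?E j) (?p j) (\<phi> y) = r j y)"
      if "j \<in> Ob (shape D)" for j \<phi>
    proof -
      have "r j \<in> extensional (Ob (shape G))" using r[OF that] by (auto simp: ind_Hom_def PiE_iff)
      then show ?thesis by (auto simp: Comp_Ind fun_eq_iff extensional_def)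
    qed
    define \<phi> where "\<phi> = (\<lambda>y \<in> Ob (shape G). c y)"
    \<comment> \<open>The lifts were chosen independently for each stage of \<open>G\<close>. They
      are compatible because both sides have the same image under every leg.\<close>
    have "germ_pullback C (dob G y) (dob G y') F (dar G y y' u) (c y') = c y"
      if y: "y \<in> Ob (shape G)" "y' \<in> Ob (shape G)" "u \<in> Hom (shape G) y y'" for y y' u
    proof (rule inj)
      show "dob G y \<in> Ob C" "c y \<in> colim_Hom C (dob G y) F"
        "germ_pullback C (dob G y) (dob G y') F (dar G y y' u) (c y') \<in> colim_Hom C (dob G y) F"
        using y c F G.dob_in G.dar_in by (simp_all add: germ_pullback_in)
      fix j assume j: "j \<in> Ob (shape D)"
      show "germ_act C (dob G y) F (?E j) (?p j) (germ_pullback C (dob G y) (dob G y') F (dar G y y' u) (c y')) =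
          germ_act C (dob G y) F (?E j) (?p j) (c y)"
        using germ_pullback_germ_act[OF F E[OF j] G.dob_in[OF y(1)] G.dob_in[OF y(2)] p[OF j] G.dar_in[OF y] c[OF y(2)]]
          act_c[OF y(1) j] act_c[OF y(2) j] ind_Hom_pullback[OF r[OF j] y]
        by simp
    qed
    then have \<phi>: "\<phi> \<in> ind_Hom C G F"
      using c by (auto simp: ind_Hom_def \<phi>_def)
    show ?thesis
    proof (rule ex1I)
      show "\<phi> \<in> Hom (Ind C) G F \<and> (\<forall>j \<in> Ob (shape ?D). Comp (Ind C) G F (dob ?D j) (?p j) \<phi> = r j)"
        unfolding Ind_simps ind_diag_simps(1)
        using \<phi> by (intro conjI ballI comp[THEN iffD2]) (simp_all add: \<phi>_def act_c)
      fix \<psi> assume "\<psi> \<in> Hom (Ind C) G F \<and> (\<forall>j \<in> Ob (shape ?D). Comp (Ind C) G F (dob ?D j) (?p j) \<psi> = r j)"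
      then have \<psi>: "\<psi> \<in> ind_Hom C G F" and eq: "\<And>j y. \<lbrakk>j \<in> Ob (shape D); y \<in> Ob (shape G)\<rbrakk> \<Longrightarrow>
          germ_act C (dob G y) F (?E j) (?p j) (\<psi> y) = r j y"
        by (auto simp only: Ind_simps ind_diag_simps(1) comp)
      show "\<psi> = \<phi>"
        using \<psi> \<phi>
      proof (rule ind_Hom_eqI)
        fix y assume y: "y \<in> Ob (shape G)"
        show "\<psi> y = \<phi> y"
          using inj[OF G.dob_in[OF y] ind_Hom_colim_Hom[OF \<psi> y] ind_Hom_colim_Hom[OF \<phi> y]] eq y act_c
          by (simp add: \<phi>_def)
      qed
    qed
  qed
  then show ?thesis
    using DD.diagram_in_axioms cone by (simp add: is_limit_def del: Ind_simps)
qed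

end

section \<open>Norms on nonnegative sequences\<close>

text \<open>Applied to the sequence of \<open>N (x n) * w n\<close>, this is the membership
  condition of \<open>ell1\<close> or \<open>ell1_na\<close>, and \<open>seq_norm\<close> is the
  norm. Isolating the two cases here lets the module theory be done once for both settings.\<close>

definition admissible :: "bool \<Rightarrow> (nat \<Rightarrow> real) \<Rightarrow> bool" where
  "admissible na a \<longleftrightarrow> (if na then a \<longlonglongrightarrow> 0 else summable a)"

definition seq_norm :: "bool \<Rightarrow> (nat \<Rightarrow> real) \<Rightarrow> real" where
  "seq_norm na a = (if na then SUP n. a n else suminf a)"

lemma LIMSEQ_bdd_above: "(a :: nat \<Rightarrow> real) \<longlonglongrightarrow> l \<Longrightarrow> bdd_above (range a)"
  by (intro Bseq_bdd_above convergent_imp_Bseq convergentI)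

lemma admissible_mono:
  assumes "admissible na b" "\<And>n. 0 \<le> a n" "\<And>n. a n \<le> b n"
  shows "admissible na a"
proof (cases na)
  case True
  then show ?thesis
    using assms tendsto_sandwich[of "\<lambda>_. 0" a sequentially b 0] by (simp add: admissible_def)
next
  case False
  then show ?thesis
    using assms summable_comparison_test'[of b 0 a] by (simp add: admissible_def)
qed

lemma seq_norm_mono:
  assumes "admissible na b" "\<And>n. 0 \<le> a n" "\<And>n. a n \<le> b n"
  shows "seq_norm na a \<le> seq_norm na b"
  using assms admissible_mono[OF assms] LIMSEQ_bdd_above[of b 0]
  by (auto simp: admissible_def seq_norm_def intro!: cSUP_mono suminf_le)

lemma seq_norm_upper:
  assumes "admissible na a" "\<And>n. 0 \<le> a n"
  shows "a n \<le> seq_norm na a"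
proof (cases na)
  case True
  then show ?thesis
    using assms by (auto simp: admissible_def seq_norm_def intro!: cSUP_upper LIMSEQ_bdd_above)
next
  case False
  then show ?thesis
    using assms sum_le_suminf[of a "{n}"] by (simp add: admissible_def seq_norm_def)
qed

lemma seq_norm_nonneg: "admissible na a \<Longrightarrow> (\<And>n. 0 \<le> a n) \<Longrightarrow> 0 \<le> seq_norm na a"
  using seq_norm_upper[of na a 0] order_trans by blast

lemma admissible_add: "admissible na a \<Longrightarrow> admissible na b \<Longrightarrow> admissible na (\<lambda>n. a n + b n)"
  using tendsto_add_zero by (auto simp: admissible_def intro: summable_add)

lemma seq_norm_add:
  assumes "admissible na a" "admissible na b" "\<And>n. 0 \<le> a n" "\<And>n. 0 \<le> b n"
  shows "seq_norm na (\<lambda>n. a n + b n) \<le> seq_norm na a + seq_norm na b"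
proof (cases na)
  case True
  then show ?thesis
    using assms seq_norm_upper[of na a] seq_norm_upper[of na b]
    by (auto simp: seq_norm_def intro!: cSUP_least add_mono)
next
  case False
  then show ?thesis using assms by (simp add: admissible_def seq_norm_def suminf_add)
qed

lemma seq_norm_max:
  assumes "admissible True a" "admissible True b" "\<And>n. 0 \<le> a n" "\<And>n. 0 \<le> b n"
  shows "seq_norm True (\<lambda>n. max (a n) (b n)) \<le> max (seq_norm True a) (seq_norm True b)"
  unfolding seq_norm_def[of _ "\<lambda>n. max (a n) (b n)"]
  using assms seq_norm_upper[of True a] seq_norm_upper[of True b]
  by (auto intro!: cSUP_least max.mono)

lemma admissible_mult: "admissible na a \<Longrightarrow> admissible na (\<lambda>n. c * a n)"
  using tendsto_mult_right_zero by (auto simp: admissible_def intro: summable_mult)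

lemma seq_norm_mult:
  assumes "admissible na a" "\<And>n. 0 \<le> a n" "0 \<le> c"
  shows "seq_norm na (\<lambda>n. c * a n) \<le> c * seq_norm na a"
proof (cases na)
  case True
  then show ?thesis
    using assms seq_norm_upper[of na a]
    by (auto simp: seq_norm_def intro!: cSUP_least mult_left_mono)
next
  case False
  then show ?thesis using assms by (simp add: admissible_def seq_norm_def suminf_mult)
qed

lemma admissible_summable: "summable a \<Longrightarrow> admissible na a"
  by (simp add: admissible_def summable_LIMSEQ_zero)

lemma seq_norm_le_suminf:
  assumes "summable a" "\<And>n. 0 \<le> a n"
  shows "seq_norm na a \<le> suminf a"
  using assms sum_le_suminf[of a "{_}"] by (auto simp: seq_norm_def intro!: cSUP_least)

lemma seq_norm_const_zero [simp]: "seq_norm na (\<lambda>_. 0) = 0"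
  by (simp add: seq_norm_def)

text \<open>A Fatou property: the norm is controlled by single terms or by finite partial sums, and
  bounds on these survive pointwise limits.\<close>

lemma seq_norm_limit_le:
  assumes c: "admissible na c" and d: "\<And>k. admissible na (d k)" "\<And>k. seq_norm na (d k) \<le> B"
    and nonneg: "\<And>k n. 0 \<le> d k n" and lim: "\<And>n. (\<lambda>k. d k n) \<longlonglongrightarrow> c n"
  shows "seq_norm na c \<le> B"
proof (cases na)
  case True
  have "d k n \<le> B" for k n
    using seq_norm_upper[OF d(1) nonneg] d(2) order_trans by blast
  then have "c n \<le> B" for n
    by (intro LIMSEQ_le_const2[OF lim]) auto
  then show ?thesis using True by (auto simp: seq_norm_def intro!: cSUP_least)
next
  case False
  have "sum (d k) {..<m} \<le> B" for k m
    using sum_le_suminf[of "d k" "{..<m}"] d[of k] nonneg False by (auto simp: admissible_def seq_norm_def)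
  then have "sum c {..<m} \<le> B" for m
    by (intro LIMSEQ_le_const2[OF tendsto_sum[OF lim]]) auto
  then show ?thesis using c False by (auto simp: admissible_def seq_norm_def intro!: suminf_le_const)
qed

text \<open>Shaped for completeness proofs: \<open>b\<close> is the candidate limit,
  \<open>a\<close> an approximating member and \<open>c\<close> the error, which is known only as a
  pointwise limit of small sequences. Convergence to zero uses every \<open>\<epsilon>\<close>; for
  summability the single value 1 already bounds the partial sums of \<open>c\<close>.\<close>

lemma admissible_limit:
  assumes b: "\<And>n. 0 \<le> b n"
    and approx: "\<And>\<epsilon>. \<epsilon> > 0 \<Longrightarrow> \<exists>a c d. admissible na a \<and> (\<forall>n. b n \<le> a n + c n) \<and>
      (\<forall>k. admissible na (d k) \<and> seq_norm na (d k) \<le> \<epsilon>) \<and> (\<forall>k n. 0 \<le> d k n) \<and>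
      (\<forall>n. (\<lambda>k. d k n) \<longlonglongrightarrow> c n)"
  shows "admissible na b"
proof (cases na)
  case True
  have "b \<longlonglongrightarrow> 0"
  proof (rule LIMSEQ_I)
    fix \<epsilon> :: real assume "\<epsilon> > 0"
    then obtain a c d where a: "admissible na a" and le: "\<And>n. b n \<le> a n + c n"
      and d: "\<And>k. admissible na (d k)" "\<And>k. seq_norm na (d k) \<le> \<epsilon> / 2" "\<And>k n. 0 \<le> d k n"
      and lim: "\<And>n. (\<lambda>k. d k n) \<longlonglongrightarrow> c n"
      using approx[of "\<epsilon> / 2"] by (metis half_gt_zero)
    have "d k n \<le> \<epsilon> / 2" for k n
      using seq_norm_upper[OF d(1,3)] d(2) order_trans by blast
    then have c: "c n \<le> \<epsilon> / 2" for n
      by (intro LIMSEQ_le_const2[OF lim]) auto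
    have "a \<longlonglongrightarrow> 0" using a True by (simp add: admissible_def)
    then obtain K where "\<And>n. n \<ge> K \<Longrightarrow> norm (a n) < \<epsilon> / 2"
      using \<open>\<epsilon> > 0\<close> LIMSEQ_D[of a 0 "\<epsilon> / 2"] by auto
    then show "\<exists>K. \<forall>n \<ge> K. norm (b n - 0) < \<epsilon>"
      using le c b by (intro exI[of _ K]) (smt (verit) real_norm_def field_sum_of_halves)
  qed
  then show ?thesis using True by (simp add: admissible_def)
next
  case False
  obtain a c d where a: "admissible na a" and le: "\<And>n. b n \<le> a n + c n"
    and d: "\<And>k. admissible na (d k)" "\<And>k. seq_norm na (d k) \<le> 1" "\<And>k n. 0 \<le> d k n"
    and lim: "\<And>n. (\<lambda>k. d k n) \<longlonglongrightarrow> c n"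
    using approx[of 1] by (metis zero_less_one)
  have "sum (d k) {..<m} \<le> 1" for k m
    using sum_le_suminf[of "d k" "{..<m}"] d(1,2)[of k] d(3) False by (auto simp: admissible_def seq_norm_def)
  then have "sum c {..<m} \<le> 1" for m
    by (intro LIMSEQ_le_const2[OF tendsto_sum[OF lim]]) auto
  moreover have "0 \<le> c n" for n
    using d(3) by (intro LIMSEQ_le_const[OF lim]) auto
  ultimately have "summable c"
    by (intro summableI_nonneg_bounded)
  then have "admissible na (\<lambda>n. a n + c n)"
    by (intro admissible_add[OF a admissible_summable])
  then show ?thesis using b le by (rule admissible_mono)
qed

text \<open>The remainder of the expansion of a sequence in unit vectors is such a tail, so this
  will give convergence of the nuclear series.\<close>

lemma seq_norm_tail:
  assumes a: "admissible na a" and nonneg: "\<And>n. 0 \<le> a n"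
  shows "(\<lambda>k. seq_norm na (\<lambda>n. if n < k then 0 else a n)) \<longlonglongrightarrow> 0"
proof (cases na)
  case True
  show ?thesis
  proof (rule LIMSEQ_I)
    fix \<epsilon> :: real assume "\<epsilon> > 0"
    have "a \<longlonglongrightarrow> 0" using a True by (simp add: admissible_def)
    then obtain K where K: "\<And>n. n \<ge> K \<Longrightarrow> norm (a n) < \<epsilon> / 2"
      using \<open>\<epsilon> > 0\<close> LIMSEQ_D[of a 0 "\<epsilon> / 2"] by auto
    have "norm (seq_norm na (\<lambda>n. if n < k then 0 else a n) - 0) < \<epsilon>" if "k \<ge> K" for k
    proof -
      have "(if n < k then 0 else a n) \<le> \<epsilon> / 2" for n
        using K[of n] that \<open>\<epsilon> > 0\<close> by auto
      then have "seq_norm na (\<lambda>n. if n < k then 0 else a n) \<le> \<epsilon> / 2"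
        unfolding seq_norm_def if_P[OF True] by (intro cSUP_least) simp
      moreover have "0 \<le> seq_norm na (\<lambda>n. if n < k then 0 else a n)"
        using nonneg by (intro seq_norm_nonneg admissible_mono[OF a]) auto
      ultimately show ?thesis using \<open>\<epsilon> > 0\<close> by simp
    qed
    then show "\<exists>K. \<forall>k \<ge> K. norm (seq_norm na (\<lambda>n. if n < k then 0 else a n) - 0) < \<epsilon>" by blast
  qed
next
  case False
  then have sum: "summable a" using a by (simp add: admissible_def)
  have "(\<lambda>n. if n < k then 0 else a n) sums (suminf a - sum a {..<k})" for k
  proof -
    have "(\<lambda>n. a n - (if n \<in> {..<k} then a n else 0)) sums (suminf a - sum a {..<k})"
      using sum by (intro sums_diff summable_sums sums_If_finite_set) auto
    moreover have "(\<lambda>n. a n - (if n \<in> {..<k} then a n else 0)) = (\<lambda>n. if n < k then 0 else a n)"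
      by auto
    ultimately show ?thesis by simp
  qed
  then have "seq_norm na (\<lambda>n. if n < k then 0 else a n) = suminf a - sum a {..<k}" for k
    using False by (simp add: seq_norm_def sums_unique[symmetric])
  moreover have "(\<lambda>k. suminf a - sum a {..<k}) \<longlonglongrightarrow> suminf a - suminf a"
    using sum by (intro tendsto_intros summable_LIMSEQ)
  ultimately show ?thesis by simp
qed

section \<open>Weights\<close>

text \<open>The dominator is a weighted sum of all the sequences, with weights \<open>c j\<close>
  that limit the total mass of the \<open>j\<close>-th one to \<open>(1/2)^j\<close>. Each
  \<open>r j\<close> is then at most \<open>v\<close> divided by \<open>c j\<close>.\<close>

lemma summable_dominator:
  fixes r :: "nat \<Rightarrow> nat \<Rightarrow> real"
  assumes sum: "\<And>j. summable (r j)" and pos: "\<And>j n. 0 < r j n"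
  shows "\<exists>v. summable v \<and> (\<forall>n. 0 < v n) \<and> (\<forall>j. \<exists>D. \<forall>n. r j n \<le> D * v n)"
proof -
  \<comment> \<open>The summand 1 keeps the denominator positive; the quotient of
    \<open>suminf (r j)\<close> by it is at most 1.\<close>
  define c where "c j = (1 / 2) ^ j / (1 + suminf (r j))" for j
  have geom: "summable (\<lambda>j. (1 / 2 :: real) ^ j)" by (simp add: summable_geometric)
  have S: "0 \<le> suminf (r j)" for j
    using sum pos by (intro suminf_nonneg less_imp_le)
  have c: "0 < c j" "c j * suminf (r j) \<le> (1 / 2) ^ j" for j
  proof -
    show "0 < c j" using S[of j] by (simp add: c_def add_pos_nonneg)
    have "c j * suminf (r j) = (1 / 2) ^ j * (suminf (r j) / (1 + suminf (r j)))" by (simp add: c_def)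
    also have "\<dots> \<le> (1 / 2) ^ j" using S[of j] by (intro mult_left_le) auto
    finally show "c j * suminf (r j) \<le> (1 / 2) ^ j" .
  qed
  have c_sum: "c j * (\<Sum>n<m. r j n) \<le> (1 / 2) ^ j" for j m
    using sum_le_suminf[OF sum[of j], of "{..<m}"] pos c[of j]
    by (meson finite_lessThan less_imp_le mult_left_mono order_trans)
  have "r j n \<le> suminf (r j)" for j n
    using sum_le_suminf[OF sum[of j], of "{n}"] pos by (simp add: less_imp_le)
  then have "c j * r j n \<le> (1 / 2) ^ j" for j n
    using c[of j] by (meson less_imp_le mult_left_mono order_trans)
  moreover have "0 \<le> c j * r j n" for j n
    using c(1)[of j] pos[of j n] by (simp add: less_imp_le)
  ultimately have "norm (c j * r j n) \<le> (1 / 2) ^ j" for j n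
    by (simp only: real_norm_def abs_of_nonneg)
  then have cr: "summable (\<lambda>j. c j * r j n)" for n
    by (rule summable_comparison_test'[OF geom])
  define v where "v n = (\<Sum>j. c j * r j n)" for n
  have v_ge: "c j * r j n \<le> v n" for j n
    using sum_le_suminf[OF cr[of n], of "{j}"] c pos by (simp add: v_def less_imp_le)
  have v_pos: "0 < v n" for n
    by (rule less_le_trans[OF mult_pos_pos[OF c(1) pos] v_ge])
  \<comment> \<open>Only a finite sum over \<open>n\<close> is exchanged with the series over
    \<open>j\<close>; uniformly bounded partial sums then give summability of the nonnegative
    \<open>v\<close>.\<close>
  have "(\<Sum>n<m. v n) \<le> (\<Sum>j. (1 / 2) ^ j)" for m
  proof -
    have "(\<Sum>n<m. v n) = (\<Sum>j. c j * (\<Sum>n<m. r j n))"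
      unfolding v_def using cr by (simp add: suminf_sum[symmetric] sum_distrib_left)
    also have "\<dots> \<le> (\<Sum>j. (1 / 2) ^ j)"
      using c_sum cr by (intro suminf_le geom) (auto simp: sum_distrib_left intro: summable_sum)
    finally show ?thesis .
  qed
  then have "summable v"
    using v_pos by (intro summableI_nonneg_bounded) (auto intro: less_imp_le)
  moreover have "r j n \<le> (1 / c j) * v n" for j n
    using v_ge[of j n] c(1)[of j] by (simp add: field_simps)
  ultimately show ?thesis using v_pos by blast
qed

text \<open>The weight is the supremum over \<open>j\<close> of \<open>\<rho> j n / A j\<close> with
  \<open>A j\<close> at least \<open>B j\<close>. The last clause collects infinitely many bounds
  with uncontrolled constants \<open>B j\<close> into one: in its use \<open>t\<close> is the norm
  of a coordinate of the image of a vector, \<open>C\<close> the norm of that vector and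
  \<open>B j\<close> the operator bound into the module of \<open>\<rho> j\<close>.\<close>

lemma dominating_weight:
  fixes \<rho> :: "nat \<Rightarrow> nat \<Rightarrow> real" and B :: "nat \<Rightarrow> real"
  assumes pos: "\<And>j n. 0 < \<rho> j n"
  shows "\<exists>u. (\<forall>n. 0 < u n) \<and> (\<forall>j. \<exists>c. \<forall>n. \<rho> j n \<le> c * u n) \<and>
    (\<forall>n t C. 0 \<le> t \<longrightarrow> 0 \<le> C \<longrightarrow> (\<forall>j. t * \<rho> j n \<le> B j * C) \<longrightarrow> t * u n \<le> C)"
proof -
  text \<open>The sum makes the supremum defining \<open>u n\<close> finite: its terms are at most 1 for \<open>j \<ge> n\<close>.\<close>
  define A where "A j = 1 + \<bar>B j\<bar> + (\<Sum>n\<le>j. \<rho> j n)" for j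
  have sum0: "0 \<le> (\<Sum>n\<le>j. \<rho> j n)" for j using pos by (intro sum_nonneg less_imp_le)
  have A: "0 < A j" "B j \<le> A j" for j using sum0[of j] by (simp_all add: A_def)
  have A': "\<rho> j n \<le> A j" if "n \<le> j" for j n
  proof -
    have "\<rho> j n \<le> (\<Sum>n\<le>j. \<rho> j n)" using that pos by (intro member_le_sum) (auto intro: less_imp_le)
    then show ?thesis by (simp add: A_def)
  qed
  define u where "u n = (SUP j. \<rho> j n / A j)" for n
  have bdd: "bdd_above (range (\<lambda>j. \<rho> j n / A j))" for n
  proof (rule bdd_aboveI2)
    fix j show "\<rho> j n / A j \<le> 1 + (\<Sum>j<n. \<rho> j n / A j)"
    proof (cases "n \<le> j")
      case True
      then have "\<rho> j n / A j \<le> 1" using A' A(1)[of j] by simp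
      moreover have "0 \<le> (\<Sum>j<n. \<rho> j n / A j)" using pos A by (intro sum_nonneg) (simp add: less_imp_le)
      ultimately show ?thesis by linarith
    next
      case False
      then have "\<rho> j n / A j \<le> (\<Sum>j<n. \<rho> j n / A j)"
        using pos A by (intro member_le_sum) (auto simp: less_imp_le)
      then show ?thesis by linarith
    qed
  qed
  have u_ge: "\<rho> j n / A j \<le> u n" for j n
    unfolding u_def using bdd by (rule cSUP_upper[OF UNIV_I])
  have u_pos: "0 < u n" for n
    using u_ge[of 0 n] pos[of 0 n] A(1)[of 0] by (meson divide_pos_pos less_le_trans)
  have "\<rho> j n \<le> A j * u n" for j n
    using u_ge[of j n] A(1)[of j] by (simp add: field_simps)
  moreover have "t * u n \<le> C" if t: "0 \<le> t" and C: "0 \<le> C" and le: "\<And>j. t * \<rho> j n \<le> B j * C" for n t C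
  proof (cases "t = 0")
    case False
    have "\<rho> j n / A j \<le> C / t" for j
    proof -
      have "t * \<rho> j n \<le> A j * C" using le[of j] A(2)[of j] C by (meson mult_right_mono order_trans)
      then show ?thesis using A(1)[of j] False t by (simp add: field_simps)
    qed
    then have "u n \<le> C / t" unfolding u_def by (intro cSUP_least) auto
    then show ?thesis using False t by (simp add: field_simps)
  qed (use C in simp)
  ultimately show ?thesis using u_pos by blast
qed

lemma refined_weight:
  fixes \<rho> :: "nat \<Rightarrow> nat \<Rightarrow> real"
  assumes pos: "\<And>j n. 0 < \<rho> j n" and sum: "\<And>j. summable (\<lambda>n. \<rho> j n / \<rho> (Suc j) n)"
    and u: "\<And>n. 0 < u n" "\<And>j. \<exists>c. \<forall>n. \<rho> j n \<le> c * u n"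
  shows "\<exists>w. (\<forall>n. 0 < w n) \<and> (\<forall>j. \<exists>c. \<forall>n. \<rho> j n \<le> c * w n) \<and> summable (\<lambda>n. w n / u n)"
proof -
  obtain v where v: "summable v" "\<And>n. 0 < v n"
    and dom: "\<And>j. \<exists>D. \<forall>n. \<rho> j n / \<rho> (Suc j) n \<le> D * v n"
    using summable_dominator[of "\<lambda>j n. \<rho> j n / \<rho> (Suc j) n"] sum pos by auto
  \<comment> \<open>The witness is \<open>v n * u n\<close>. Writing \<open>\<rho> j\<close> as the
    quotient by \<open>\<rho> (Suc j)\<close> times \<open>\<rho> (Suc j)\<close>, the quotient is
    absorbed by \<open>v\<close> and the remaining factor by \<open>u\<close>.\<close>
  have "\<exists>c. \<forall>n. \<rho> j n \<le> c * (v n * u n)" for j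
  proof -
    obtain D where D: "\<And>n. \<rho> j n / \<rho> (Suc j) n \<le> D * v n" using dom by blast
    obtain c where c: "\<And>n. \<rho> (Suc j) n \<le> c * u n" using u(2) by blast
    have "\<rho> j n \<le> (D * c) * (v n * u n)" for n
    proof -
      have "\<rho> j n = (\<rho> j n / \<rho> (Suc j) n) * \<rho> (Suc j) n" using pos[of "Suc j" n] by simp
      also have "\<dots> \<le> (D * v n) * (c * u n)"
        using D[of n] c[of n] pos[of j n] pos[of "Suc j" n]
        by (intro mult_mono) (auto intro: less_imp_le order_trans[of 0 "\<rho> j n / \<rho> (Suc j) n"])
      finally show ?thesis by (simp add: mult_ac)
    qed
    then show ?thesis by blast
  qed
  moreover have "(\<lambda>n. v n * u n / u n) = v" using u(1) by (auto simp: fun_eq_iff dest: less_imp_neq[symmetric])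
  ultimately show ?thesis using u(1) v by (intro exI[of _ "\<lambda>n. v n * u n"]) simp
qed

section \<open>Weighted sequence modules\<close>

locale ell_modules =
  fixes R :: "'r normed_ring" and na :: bool and e :: "(nat \<Rightarrow> 'r) \<Rightarrow> 'm"
  assumes banach: "banach_ring R" and ultra: "na \<longrightarrow> ultrametric R (ring_norm R)" and inj_e: "inj e"
begin

sublocale cring R using banach by (simp add: banach_ring_def)

abbreviation N :: "'r \<Rightarrow> real" where "N \<equiv> ring_norm R"
abbreviation E :: "(nat \<Rightarrow> real) \<Rightarrow> ('r, 'm) normed_module" where "E \<equiv> ell_star na R e"

lemma the_inv_e [simp]: "the_inv e (e x) = x"
  using inj_e by (rule the_inv_f_f)

lemma e_eq_iff [simp]: "e x = e y \<longleftrightarrow> x = y"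
  using inj_e by (auto dest: injD)

lemma N_nonneg: "x \<in> carrier R \<Longrightarrow> 0 \<le> N x"
  and N_eq_0_iff: "x \<in> carrier R \<Longrightarrow> N x = 0 \<longleftrightarrow> x = \<zero>\<^bsub>R\<^esub>"
  and N_minus: "x \<in> carrier R \<Longrightarrow> N (\<ominus>\<^bsub>R\<^esub> x) = N x"
  and N_add: "x \<in> carrier R \<Longrightarrow> y \<in> carrier R \<Longrightarrow> N (x \<oplus>\<^bsub>R\<^esub> y) \<le> N x + N y"
  and N_mult: "x \<in> carrier R \<Longrightarrow> y \<in> carrier R \<Longrightarrow> N (x \<otimes>\<^bsub>R\<^esub> y) \<le> N x * N y"
  and N_one: "N \<one>\<^bsub>R\<^esub> \<le> 1"
  and N_complete: "(\<And>n::nat. s n \<in> carrier R) \<Longrightarrow>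
    (\<And>\<epsilon>. \<epsilon> > 0 \<Longrightarrow> \<exists>K. \<forall>m \<ge> K. \<forall>n \<ge> K. N (s m \<ominus>\<^bsub>R\<^esub> s n) < \<epsilon>) \<Longrightarrow>
    \<exists>x \<in> carrier R. (\<lambda>n. N (s n \<ominus>\<^bsub>R\<^esub> x)) \<longlonglongrightarrow> 0"
  using banach unfolding banach_ring_def complete_norm_def by blast+

lemma N_zero [simp]: "N \<zero>\<^bsub>R\<^esub> = 0"
  by (simp add: N_eq_0_iff)

text \<open>Reverse triangle inequality: replacing \<open>s k\<close> by \<open>x\<close> changes
  the distance to \<open>y\<close> by at most the distance between the two.\<close>

lemma N_limit:
  assumes s: "\<And>k. s k \<in> carrier R" "x \<in> carrier R" "y \<in> carrier R"
    and lim: "(\<lambda>k::nat. N (s k \<ominus>\<^bsub>R\<^esub> x)) \<longlonglongrightarrow> 0"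
  shows "(\<lambda>k. N (s k \<ominus>\<^bsub>R\<^esub> y)) \<longlonglongrightarrow> N (x \<ominus>\<^bsub>R\<^esub> y)"
proof -
  have "\<bar>N (s k \<ominus>\<^bsub>R\<^esub> y) - N (x \<ominus>\<^bsub>R\<^esub> y)\<bar> \<le> N (s k \<ominus>\<^bsub>R\<^esub> x)" for k
  proof -
    have "s k \<ominus>\<^bsub>R\<^esub> y = (s k \<ominus>\<^bsub>R\<^esub> x) \<oplus>\<^bsub>R\<^esub> (x \<ominus>\<^bsub>R\<^esub> y)"
      "x \<ominus>\<^bsub>R\<^esub> y = (\<ominus>\<^bsub>R\<^esub> (s k \<ominus>\<^bsub>R\<^esub> x)) \<oplus>\<^bsub>R\<^esub> (s k \<ominus>\<^bsub>R\<^esub> y)"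
      using s s(1)[of k] by algebra+
    then have "N (s k \<ominus>\<^bsub>R\<^esub> y) \<le> N (s k \<ominus>\<^bsub>R\<^esub> x) + N (x \<ominus>\<^bsub>R\<^esub> y)"
      "N (x \<ominus>\<^bsub>R\<^esub> y) \<le> N (s k \<ominus>\<^bsub>R\<^esub> x) + N (s k \<ominus>\<^bsub>R\<^esub> y)"
      using s N_add[of "s k \<ominus>\<^bsub>R\<^esub> x" "x \<ominus>\<^bsub>R\<^esub> y"] N_add[of "\<ominus>\<^bsub>R\<^esub> (s k \<ominus>\<^bsub>R\<^esub> x)" "s k \<ominus>\<^bsub>R\<^esub> y"]
        N_minus[of "s k \<ominus>\<^bsub>R\<^esub> x"] by simp_all
    then show ?thesis by linarith
  qed
  then have "(\<lambda>k. N (s k \<ominus>\<^bsub>R\<^esub> y) - N (x \<ominus>\<^bsub>R\<^esub> y)) \<longlonglongrightarrow> 0"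
    by (intro tendsto_0_le[OF lim, of _ 1] always_eventually allI) (simp add: order_trans[OF _ abs_ge_self])
  then show ?thesis by (simp add: LIM_zero_iff)
qed

definition seqs :: "(nat \<Rightarrow> real) \<Rightarrow> (nat \<Rightarrow> 'r) set" where
  "seqs w = {x. (\<forall>n. x n \<in> carrier R) \<and> admissible na (\<lambda>n. N (x n) * w n)}"

abbreviation wnorm :: "(nat \<Rightarrow> real) \<Rightarrow> (nat \<Rightarrow> 'r) \<Rightarrow> real" where
  "wnorm w x \<equiv> seq_norm na (\<lambda>n. N (x n) * w n)"

lemma carrier_E: "carrier (E w) = e ` seqs w"
  by (auto simp: ell_star_def transport_def ell1_def ell1_na_def seqs_def admissible_def)

lemma add_E [simp]: "e x \<oplus>\<^bsub>E w\<^esub> e y = e (\<lambda>n. x n \<oplus>\<^bsub>R\<^esub> y n)"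
  by (simp add: ell_star_def transport_def ell1_def ell1_na_def)

lemma zero_E: "\<zero>\<^bsub>E w\<^esub> = e (\<lambda>n. \<zero>\<^bsub>R\<^esub>)"
  by (simp add: ell_star_def transport_def ell1_def ell1_na_def)

lemma smult_E [simp]: "a \<odot>\<^bsub>E w\<^esub> e x = e (\<lambda>n. a \<otimes>\<^bsub>R\<^esub> x n)"
  by (simp add: ell_star_def transport_def ell1_def ell1_na_def)

lemma norm_E [simp]: "mod_norm (E w) (e x) = wnorm w x"
  by (simp add: ell_star_def transport_def ell1_def ell1_na_def seq_norm_def)

lemma seqs_carrier: "x \<in> seqs w \<Longrightarrow> x n \<in> carrier R"
  by (simp add: seqs_def)

lemma seqs_subset:
  assumes "x \<in> seqs w" and w: "\<And>n. 0 \<le> w' n" "\<And>n. w' n \<le> c * w n"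
  shows "x \<in> seqs w'" "0 \<le> c \<Longrightarrow> (\<And>n. 0 \<le> w n) \<Longrightarrow> wnorm w' x \<le> c * wnorm w x"
proof -
  have x: "\<And>n. x n \<in> carrier R" "admissible na (\<lambda>n. N (x n) * w n)"
    using assms by (auto simp: seqs_def)
  have le: "N (x n) * w' n \<le> c * (N (x n) * w n)" for n
    using mult_left_mono[OF w(2)[of n] N_nonneg[OF x(1)[of n]]] by (simp add: mult_ac)
  have nonneg: "0 \<le> N (x n) * w' n" for n using w x N_nonneg by simp
  show "x \<in> seqs w'"
    using x admissible_mono[OF admissible_mult[OF x(2)] nonneg le] by (simp add: seqs_def)
  assume c: "0 \<le> c" and w0: "\<And>n. 0 \<le> w n"
  have "wnorm w' x \<le> seq_norm na (\<lambda>n. c * (N (x n) * w n))"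
    using x nonneg le by (intro seq_norm_mono admissible_mult)
  also have "\<dots> \<le> c * wnorm w x"
    using x N_nonneg c w0 by (intro seq_norm_mult) auto
  finally show "wnorm w' x \<le> c * wnorm w x" .
qed

text \<open>Termwise, \<open>N (x n) * w n\<close> is at most \<open>C\<close> times the summable
  \<open>w n / u n\<close>. This upgrades a uniform bound to membership, and does so in both
  settings.\<close>

lemma seqs_bounded:
  assumes x: "\<And>n. x n \<in> carrier R" "\<And>n. N (x n) * u n \<le> C"
    and w: "\<And>n. 0 < w n" "\<And>n. 0 < u n" and sum: "summable (\<lambda>n. w n / u n)"
  shows "x \<in> seqs w" "wnorm w x \<le> (\<Sum>n. w n / u n) * C"
proof -
  have le: "N (x n) * w n \<le> C * (w n / u n)" for n
    using mult_right_mono[OF x(2)[of n], of "w n / u n"] w[of n] by (simp add: field_simps)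
  have nonneg: "0 \<le> N (x n) * w n" for n using N_nonneg[OF x(1)] w(1)[of n] by simp
  have C: "summable (\<lambda>n. C * (w n / u n))" using sum by (rule summable_mult)
  show "x \<in> seqs w"
    using x admissible_mono[OF admissible_summable[OF C] nonneg le] by (simp add: seqs_def)
  have "wnorm w x \<le> seq_norm na (\<lambda>n. C * (w n / u n))"
    using nonneg le by (intro seq_norm_mono admissible_summable C)
  also have "\<dots> \<le> (\<Sum>n. C * (w n / u n))"
    using C nonneg le order_trans by (intro seq_norm_le_suminf) blast+
  also have "\<dots> = (\<Sum>n. w n / u n) * C" by (subst suminf_mult[OF sum]) simp
  finally show "wnorm w x \<le> (\<Sum>n. w n / u n) * C" .
qed

section \<open>The Banach module attached to a fixed positive weight\<close>

context
  fixes w :: "nat \<Rightarrow> real" assumes w: "\<And>n. 0 < w n"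
begin

lemma N_w_nonneg: "x \<in> carrier R \<Longrightarrow> 0 \<le> N x * w n"
  using w[of n] N_nonneg by simp

lemma seqs_add:
  assumes "x \<in> seqs w" "y \<in> seqs w"
  shows "(\<lambda>n. x n \<oplus>\<^bsub>R\<^esub> y n) \<in> seqs w" "wnorm w (\<lambda>n. x n \<oplus>\<^bsub>R\<^esub> y n) \<le> wnorm w x + wnorm w y"
proof -
  have x: "\<And>n. x n \<in> carrier R" "admissible na (\<lambda>n. N (x n) * w n)"
    and y: "\<And>n. y n \<in> carrier R" "admissible na (\<lambda>n. N (y n) * w n)"
    using assms by (auto simp: seqs_def)
  have le: "N (x n \<oplus>\<^bsub>R\<^esub> y n) * w n \<le> N (x n) * w n + N (y n) * w n" for n
    using mult_right_mono[OF N_add[OF x(1) y(1), of n n], of "w n"] w[of n] by (simp add: distrib_right)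
  note adm = admissible_add[OF x(2) y(2)]
  show "(\<lambda>n. x n \<oplus>\<^bsub>R\<^esub> y n) \<in> seqs w"
    using x y N_w_nonneg admissible_mono[OF adm _ le] by (simp add: seqs_def)
  have "wnorm w (\<lambda>n. x n \<oplus>\<^bsub>R\<^esub> y n) \<le> seq_norm na (\<lambda>n. N (x n) * w n + N (y n) * w n)"
    using adm le x y N_w_nonneg by (intro seq_norm_mono) auto
  also have "\<dots> \<le> wnorm w x + wnorm w y"
    using x y N_w_nonneg by (intro seq_norm_add) auto
  finally show "wnorm w (\<lambda>n. x n \<oplus>\<^bsub>R\<^esub> y n) \<le> wnorm w x + wnorm w y" .
qed

lemma seqs_add_max:
  assumes na and "x \<in> seqs w" "y \<in> seqs w"
  shows "wnorm w (\<lambda>n. x n \<oplus>\<^bsub>R\<^esub> y n) \<le> max (wnorm w x) (wnorm w y)"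
proof -
  have "admissible na (\<lambda>n. N (x n) * w n)" "admissible na (\<lambda>n. N (y n) * w n)"
    using assms(2,3) by (auto simp: seqs_def)
  then have x: "\<And>n. x n \<in> carrier R" "admissible True (\<lambda>n. N (x n) * w n)"
    and y: "\<And>n. y n \<in> carrier R" "admissible True (\<lambda>n. N (y n) * w n)"
    using assms(2,3)[THEN seqs_carrier] \<open>na\<close> by simp_all
  have le: "N (x n \<oplus>\<^bsub>R\<^esub> y n) * w n \<le> max (N (x n) * w n) (N (y n) * w n)" for n
  proof -
    have "N (x n \<oplus>\<^bsub>R\<^esub> y n) \<le> max (N (x n)) (N (y n))"
      using ultra \<open>na\<close> x(1) y(1) by (simp add: ultrametric_def)
    from mult_right_mono[OF this, of "w n"] show ?thesis
      using w[of n] by (auto simp: max_def split: if_splits)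
  qed
  have adm: "admissible True (\<lambda>n. max (N (x n) * w n) (N (y n) * w n))"
    using x y N_w_nonneg by (intro admissible_mono[OF admissible_add[OF x(2) y(2)]]) (auto simp: le_max_iff_disj)
  have "wnorm w (\<lambda>n. x n \<oplus>\<^bsub>R\<^esub> y n) \<le> seq_norm True (\<lambda>n. max (N (x n) * w n) (N (y n) * w n))"
    using \<open>na\<close> adm le x y N_w_nonneg by (simp add: seq_norm_mono)
  also have "\<dots> \<le> max (wnorm w x) (wnorm w y)"
    using \<open>na\<close> x y N_w_nonneg by (simp add: seq_norm_max)
  finally show ?thesis .
qed

lemma seqs_smult:
  assumes a: "a \<in> carrier R" and "x \<in> seqs w"
  shows "(\<lambda>n. a \<otimes>\<^bsub>R\<^esub> x n) \<in> seqs w" "wnorm w (\<lambda>n. a \<otimes>\<^bsub>R\<^esub> x n) \<le> N a * wnorm w x"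
proof -
  have x: "\<And>n. x n \<in> carrier R" "admissible na (\<lambda>n. N (x n) * w n)"
    using assms by (auto simp: seqs_def)
  have le: "N (a \<otimes>\<^bsub>R\<^esub> x n) * w n \<le> N a * (N (x n) * w n)" for n
    using mult_right_mono[OF N_mult[OF a x(1), of n], of "w n"] w[of n] by (simp add: mult_ac)
  show "(\<lambda>n. a \<otimes>\<^bsub>R\<^esub> x n) \<in> seqs w"
    using a x N_w_nonneg admissible_mono[OF admissible_mult[OF x(2)] _ le] by (simp add: seqs_def)
  have "wnorm w (\<lambda>n. a \<otimes>\<^bsub>R\<^esub> x n) \<le> seq_norm na (\<lambda>n. N a * (N (x n) * w n))"
    using le a x N_w_nonneg by (intro seq_norm_mono admissible_mult) auto
  also have "\<dots> \<le> N a * wnorm w x"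
    using a x N_nonneg N_w_nonneg by (intro seq_norm_mult) auto
  finally show "wnorm w (\<lambda>n. a \<otimes>\<^bsub>R\<^esub> x n) \<le> N a * wnorm w x" .
qed

lemma seqs_minus:
  assumes "x \<in> seqs w"
  shows "(\<lambda>n. \<ominus>\<^bsub>R\<^esub> x n) \<in> seqs w" "wnorm w (\<lambda>n. \<ominus>\<^bsub>R\<^esub> x n) = wnorm w x"
  using assms by (simp_all add: seqs_def N_minus)

lemma seqs_zero: "(\<lambda>n. \<zero>\<^bsub>R\<^esub>) \<in> seqs w"
  by (simp add: seqs_def admissible_summable)

lemma wnorm_upper: "x \<in> seqs w \<Longrightarrow> N (x n) * w n \<le> wnorm w x"
  using seq_norm_upper[of na "\<lambda>n. N (x n) * w n"] N_w_nonneg by (simp add: seqs_def)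

lemma wnorm_nonneg: "x \<in> seqs w \<Longrightarrow> 0 \<le> wnorm w x"
  by (rule order_trans[OF N_w_nonneg[OF seqs_carrier] wnorm_upper])

lemma module_E: "module R (E w)"
proof (rule moduleI)
  show "abelian_group (E w)"
  proof (rule abelian_groupI)
    fix x assume "x \<in> carrier (E w)"
    then obtain x' where x': "x = e x'" "x' \<in> seqs w" by (auto simp: carrier_E)
    have "e (\<lambda>n. \<ominus>\<^bsub>R\<^esub> x' n) \<oplus>\<^bsub>E w\<^esub> x = \<zero>\<^bsub>E w\<^esub>"
      using x' by (simp add: zero_E l_neg seqs_carrier)
    then show "\<exists>y \<in> carrier (E w). y \<oplus>\<^bsub>E w\<^esub> x = \<zero>\<^bsub>E w\<^esub>"
      using x' seqs_minus by (auto simp: carrier_E)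
  next
    fix x y assume "x \<in> carrier (E w)" "y \<in> carrier (E w)"
    then show "x \<oplus>\<^bsub>E w\<^esub> y = y \<oplus>\<^bsub>E w\<^esub> x"
      by (auto simp: carrier_E seqs_carrier intro!: ext a_comm)
  qed (auto simp: carrier_E seqs_add zero_E seqs_zero seqs_carrier a_assoc)
qed (auto simp: carrier_E seqs_smult seqs_carrier l_distr r_distr m_assoc intro: is_cring)

lemma minus_E [simp]:
  assumes "x \<in> seqs w"
  shows "\<ominus>\<^bsub>E w\<^esub> e x = e (\<lambda>n. \<ominus>\<^bsub>R\<^esub> x n)"
proof -
  interpret M: module R "E w" by (rule module_E)
  show ?thesis
    using assms by (intro M.minus_equality) (auto simp: carrier_E seqs_minus zero_E l_neg seqs_carrier)
qed

lemma diff_E [simp]: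
  assumes "x \<in> seqs w" "y \<in> seqs w"
  shows "e x \<ominus>\<^bsub>E w\<^esub> e y = e (\<lambda>n. x n \<ominus>\<^bsub>R\<^esub> y n)"
  using assms by (simp add: a_minus_def)

lemma seqs_diff:
  assumes "x \<in> seqs w" "y \<in> seqs w"
  shows "(\<lambda>n. x n \<ominus>\<^bsub>R\<^esub> y n) \<in> seqs w"
  using seqs_add(1)[OF assms(1) seqs_minus(1)[OF assms(2)]] by (simp add: a_minus_def)

text \<open>Since \<open>w n\<close> is positive, a Cauchy sequence is Cauchy in each coordinate,
  and \<open>R\<close> is complete. That the coordinatewise limit is a member and is a limit in norm
  follows from \<open>admissible_limit\<close> and \<open>seq_norm_limit_le\<close>.\<close>

lemma complete_E:
  assumes s: "\<And>k. s k \<in> seqs w"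
    and Cauchy: "\<And>\<epsilon>. \<epsilon> > 0 \<Longrightarrow> \<exists>K. \<forall>m \<ge> K. \<forall>k \<ge> K. wnorm w (\<lambda>n. s m n \<ominus>\<^bsub>R\<^esub> s k n) < \<epsilon>"
  shows "\<exists>x \<in> seqs w. (\<lambda>k::nat. wnorm w (\<lambda>n. s k n \<ominus>\<^bsub>R\<^esub> x n)) \<longlonglongrightarrow> 0"
proof -
  have sc: "s k n \<in> carrier R" for k n using s seqs_carrier by blast
  have "\<exists>x \<in> carrier R. (\<lambda>k. N (s k n \<ominus>\<^bsub>R\<^esub> x)) \<longlonglongrightarrow> 0" for n
  proof (rule N_complete)
    fix \<epsilon> :: real assume "\<epsilon> > 0"
    then obtain K where K: "\<And>m k. m \<ge> K \<Longrightarrow> k \<ge> K \<Longrightarrow> wnorm w (\<lambda>n. s m n \<ominus>\<^bsub>R\<^esub> s k n) < \<epsilon> * w n"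
      using Cauchy[of "\<epsilon> * w n"] w[of n] by auto
    have "N (s m n \<ominus>\<^bsub>R\<^esub> s k n) < \<epsilon>" if "m \<ge> K" "k \<ge> K" for m k
    proof (rule mult_right_less_imp_less)
      show "N (s m n \<ominus>\<^bsub>R\<^esub> s k n) * w n < \<epsilon> * w n"
        using wnorm_upper[OF seqs_diff[OF s[of m] s[of k]], of n] K[OF that] by linarith
      show "0 \<le> w n" using w[of n] by simp
    qed
    then show "\<exists>K. \<forall>m \<ge> K. \<forall>k \<ge> K. N (s m n \<ominus>\<^bsub>R\<^esub> s k n) < \<epsilon>" by blast
  qed (rule sc)
  then obtain x where x: "\<And>n. x n \<in> carrier R" and lim: "\<And>n. (\<lambda>k. N (s k n \<ominus>\<^bsub>R\<^esub> x n)) \<longlonglongrightarrow> 0"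
    by metis
  \<comment> \<open>These are the weighted distances to \<open>s m\<close>, and they tend to
    \<open>c m\<close> pointwise as \<open>k\<close> grows. The shift by \<open>K\<close> makes the
    Cauchy estimate valid from \<open>k = 0\<close> on, as the two limit lemmas demand a bound for
    all \<open>k\<close>.\<close>
  define d where "d K m k n = N (s (k + K) n \<ominus>\<^bsub>R\<^esub> s m n) * w n" for K m k n
  define c where "c m n = N (x n \<ominus>\<^bsub>R\<^esub> s m n) * w n" for m n
  have dc: "(\<lambda>k. d K m k n) \<longlonglongrightarrow> c m n" for K m n
    unfolding d_def c_def
    by (intro tendsto_mult_right LIMSEQ_ignore_initial_segment[of "\<lambda>k. N (s k n \<ominus>\<^bsub>R\<^esub> s m n)"] N_limit lim sc x)
  have d0: "0 \<le> d K m k n" for K m k n unfolding d_def using sc by (intro N_w_nonneg) simp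
  have d_adm: "admissible na (d K m k)" for K m k
    using seqs_diff[OF s s, of "k + K" m] by (simp add: seqs_def d_def[abs_def])
  have x_in: "x \<in> seqs w"
    unfolding seqs_def
  proof (intro CollectI conjI allI x admissible_limit)
    show "0 \<le> N (x n) * w n" for n using x by (rule N_w_nonneg)
    fix \<epsilon> :: real assume "\<epsilon> > 0"
    then obtain K where K: "\<And>m k. m \<ge> K \<Longrightarrow> k \<ge> K \<Longrightarrow> wnorm w (\<lambda>n. s m n \<ominus>\<^bsub>R\<^esub> s k n) < \<epsilon>"
      using Cauchy by blast
    have "N (x n) * w n \<le> N (s K n) * w n + c K n" for n
    proof -
      have "x n = s K n \<oplus>\<^bsub>R\<^esub> (x n \<ominus>\<^bsub>R\<^esub> s K n)" using x[of n] sc[of K n] by algebra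
      then have "N (x n) \<le> N (s K n) + N (x n \<ominus>\<^bsub>R\<^esub> s K n)"
        using N_add[of "s K n" "x n \<ominus>\<^bsub>R\<^esub> s K n"] x sc by simp
      from mult_right_mono[OF this, of "w n"] show ?thesis using w[of n] by (simp add: c_def distrib_right)
    qed
    moreover have "seq_norm na (d K K k) \<le> \<epsilon>" for k
      using K[of "k + K" K] by (simp add: d_def[abs_def])
    moreover have "admissible na (\<lambda>n. N (s K n) * w n)" using s by (simp add: seqs_def)
    ultimately show "\<exists>a c d. admissible na a \<and> (\<forall>n. N (x n) * w n \<le> a n + c n) \<and>
      (\<forall>k. admissible na (d k) \<and> seq_norm na (d k) \<le> \<epsilon>) \<and> (\<forall>k n. 0 \<le> d k n) \<and>
      (\<forall>n. (\<lambda>k. d k n) \<longlonglongrightarrow> c n)"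
      using dc d0 d_adm
      by (intro exI[of _ "\<lambda>n. N (s K n) * w n"] exI[of _ "c K"] exI[of _ "d K K"]) auto
  qed
  have "(\<lambda>k. wnorm w (\<lambda>n. s k n \<ominus>\<^bsub>R\<^esub> x n)) \<longlonglongrightarrow> 0"
  proof (rule LIMSEQ_I)
    fix \<epsilon> :: real assume \<epsilon>: "\<epsilon> > 0"
    then obtain K where K: "\<And>m k. m \<ge> K \<Longrightarrow> k \<ge> K \<Longrightarrow> wnorm w (\<lambda>n. s m n \<ominus>\<^bsub>R\<^esub> s k n) < \<epsilon> / 2"
      using Cauchy[of "\<epsilon> / 2"] by auto
    have "norm (wnorm w (\<lambda>n. s m n \<ominus>\<^bsub>R\<^esub> x n) - 0) < \<epsilon>" if "m \<ge> K" for m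
    proof -
      have "N (s m n \<ominus>\<^bsub>R\<^esub> x n) = N (x n \<ominus>\<^bsub>R\<^esub> s m n)" for n
      proof -
        have "s m n \<ominus>\<^bsub>R\<^esub> x n = \<ominus>\<^bsub>R\<^esub> (x n \<ominus>\<^bsub>R\<^esub> s m n)" using x[of n] sc[of m n] by algebra
        then show ?thesis using x sc by (simp add: N_minus)
      qed
      then have "wnorm w (\<lambda>n. s m n \<ominus>\<^bsub>R\<^esub> x n) = seq_norm na (c m)" by (simp add: c_def[abs_def])
      also have "\<dots> \<le> \<epsilon> / 2"
      proof (rule seq_norm_limit_le[OF _ d_adm _ d0 dc])
        show "admissible na (c m)"
          using seqs_diff[OF x_in s, of m] by (simp add: seqs_def c_def[abs_def])
        show "seq_norm na (d K m k) \<le> \<epsilon> / 2" for k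
          using K[of "k + K" m] that by (simp add: d_def[abs_def])
      qed
      finally show ?thesis using wnorm_nonneg[OF seqs_diff[OF s x_in], of m] \<epsilon> by simp
    qed
    then show "\<exists>K. \<forall>m \<ge> K. norm (wnorm w (\<lambda>n. s m n \<ominus>\<^bsub>R\<^esub> x n) - 0) < \<epsilon>" by blast
  qed
  then show ?thesis using x_in by blast
qed

lemma complete_norm_E: "complete_norm (E w) (mod_norm (E w))"
  unfolding complete_norm_def
proof (intro conjI ballI allI impI)
  fix x assume "x \<in> carrier (E w)"
  then obtain x' where x': "x = e x'" "x' \<in> seqs w" by (auto simp: carrier_E)
  show "0 \<le> mod_norm (E w) x" "mod_norm (E w) (\<ominus>\<^bsub>E w\<^esub> x) = mod_norm (E w) x"
    using x' by (simp_all add: wnorm_nonneg seqs_minus)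
  show "mod_norm (E w) x = 0 \<longleftrightarrow> x = \<zero>\<^bsub>E w\<^esub>"
  proof
    assume "mod_norm (E w) x = 0"
    then have "N (x' n) * w n \<le> 0" for n using wnorm_upper[OF x'(2), of n] x' by simp
    then have "N (x' n) = 0" for n
      using w[of n] N_nonneg[OF seqs_carrier[OF x'(2), of n]] by (metis mult_le_0_iff not_le order_antisym)
    then show "x = \<zero>\<^bsub>E w\<^esub>" using x' seqs_carrier by (auto simp: zero_E N_eq_0_iff)
  qed (simp add: zero_E)
next
  fix x y assume "x \<in> carrier (E w)" "y \<in> carrier (E w)"
  then show "mod_norm (E w) (x \<oplus>\<^bsub>E w\<^esub> y) \<le> mod_norm (E w) x + mod_norm (E w) y"
    by (auto simp: carrier_E seqs_add)
next
  fix s :: "nat \<Rightarrow> 'm"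
  assume "\<forall>n. s n \<in> carrier (E w)"
    and Cauchy: "\<forall>\<epsilon>>0. \<exists>K. \<forall>m \<ge> K. \<forall>n \<ge> K. mod_norm (E w) (s m \<ominus>\<^bsub>E w\<^esub> s n) < \<epsilon>"
  then have "\<forall>n. \<exists>x \<in> seqs w. s n = e x" by (auto simp: carrier_E)
  then obtain t where t: "\<And>n. t n \<in> seqs w" "\<And>n. s n = e (t n)" by metis
  obtain x where "x \<in> seqs w" "(\<lambda>k. wnorm w (\<lambda>n. t k n \<ominus>\<^bsub>R\<^esub> x n)) \<longlonglongrightarrow> 0"
    using complete_E[of t] Cauchy t by auto
  then show "\<exists>x \<in> carrier (E w). (\<lambda>n. mod_norm (E w) (s n \<ominus>\<^bsub>E w\<^esub> x)) \<longlonglongrightarrow> 0"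
    using t by (auto simp: carrier_E)
qed

lemma E_in_Ban: "E w \<in> Ob (Ban na R)"
proof -
  have "ultrametric (E w) (mod_norm (E w))" if na
    unfolding ultrametric_def
  proof (intro ballI)
    fix x y assume "x \<in> carrier (E w)" "y \<in> carrier (E w)"
    then obtain x' y' where "x = e x'" "x' \<in> seqs w" "y = e y'" "y' \<in> seqs w"
      by (auto simp only: carrier_E)
    then show "mod_norm (E w) (x \<oplus>\<^bsub>E w\<^esub> y) \<le> max (mod_norm (E w) x) (mod_norm (E w) y)"
      using seqs_add_max[OF that] by (simp only: add_E norm_E)
  qed
  moreover have "banach_module R (E w)"
    using module_E complete_norm_E by (auto simp: banach_module_def carrier_E seqs_smult)
  ultimately show ?thesis by (simp add: Ban_def)
qed

end

section \<open>Inclusions between weighted modules\<close>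

lemma inclusion_bounded:
  assumes w: "\<And>n. 0 < w n" "\<And>n. 0 < w' n" "\<And>n. w' n \<le> c * w n"
  shows "(\<lambda>x \<in> carrier (E w). x) \<in> bounded_maps R (E w) (E w')"
proof -
  \<comment> \<open>The sign of \<open>c\<close> is not assumed; positivity of both weights at index
    0 forces it.\<close>
  have "0 < c * w 0" using w(2)[of 0] w(3)[of 0] by linarith
  then have c: "0 \<le> c" using w(1)[of 0] by (simp add: zero_less_mult_iff)
  have sub: "x \<in> seqs w'" "wnorm w' x \<le> c * wnorm w x" if "x \<in> seqs w" for x
    using seqs_subset[OF that, of w' c] w c by (simp_all add: less_imp_le)
  interpret M: module R "E w" by (rule module_E) (rule w)
  show ?thesis
    unfolding bounded_maps_def
  proof (intro CollectI conjI)
    show "(\<lambda>x \<in> carrier (E w). x) \<in> carrier (E w) \<rightarrow>\<^sub>E carrier (E w')"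
      using sub by (auto simp: carrier_E)
    show "\<exists>B. \<forall>x \<in> carrier (E w). mod_norm (E w') ((\<lambda>x \<in> carrier (E w). x) x) \<le> B * mod_norm (E w) x"
      using sub by (intro exI[of _ c]) (auto simp: carrier_E)
    show "\<forall>x \<in> carrier (E w). \<forall>y \<in> carrier (E w). (\<lambda>x \<in> carrier (E w). x) (x \<oplus>\<^bsub>E w\<^esub> y) =
        (\<lambda>x \<in> carrier (E w). x) x \<oplus>\<^bsub>E w'\<^esub> (\<lambda>x \<in> carrier (E w). x) y"
    proof (intro ballI)
      fix x y assume "x \<in> carrier (E w)" "y \<in> carrier (E w)"
      then show "(\<lambda>x \<in> carrier (E w). x) (x \<oplus>\<^bsub>E w\<^esub> y) =
          (\<lambda>x \<in> carrier (E w). x) x \<oplus>\<^bsub>E w'\<^esub> (\<lambda>x \<in> carrier (E w). x) y"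
        using M.a_closed[of x y] by (auto simp: carrier_E)
    qed
    show "\<forall>a \<in> carrier R. \<forall>x \<in> carrier (E w). (\<lambda>x \<in> carrier (E w). x) (a \<odot>\<^bsub>E w\<^esub> x) =
        a \<odot>\<^bsub>E w'\<^esub> (\<lambda>x \<in> carrier (E w). x) x"
    proof (intro ballI)
      fix a x assume "a \<in> carrier R" "x \<in> carrier (E w)"
      then show "(\<lambda>x \<in> carrier (E w). x) (a \<odot>\<^bsub>E w\<^esub> x) = a \<odot>\<^bsub>E w'\<^esub> (\<lambda>x \<in> carrier (E w). x) x"
        using M.smult_closed[of a x] by (auto simp: carrier_E)
    qed
  qed
qed

end

lemma op_norm_bounds:
  assumes "\<And>x. x \<in> carrier M \<Longrightarrow> mod_norm N' (f x) \<le> B * mod_norm M x" "0 \<le> B"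
  shows "0 \<le> op_norm M N' f" "op_norm M N' f \<le> B"
  using assms unfolding op_norm_def
  by (auto intro!: cInf_greatest cInf_lower bdd_belowI)

context ell_modules
begin

lemma inclusion_nuclear:
  assumes w: "\<And>n. 0 < w n" "\<And>n. 0 < w' n" and sum: "summable (\<lambda>n. w' n / w n)"
  shows "nuclear_map na R (E w) (E w') (\<lambda>x \<in> carrier (E w). x)"
proof -
  \<comment> \<open>A single term is at most the whole sum, so summability of the quotients already
    contains the domination that makes the inclusion bounded.\<close>
  have le: "w' n \<le> (\<Sum>n. w' n / w n) * w n" for n
    using sum_le_suminf[OF sum, of "{n}"] w by (simp add: pos_divide_le_eq less_imp_le)
  interpret M: module R "E w" by (rule module_E) (rule w)
  interpret M': module R "E w'" by (rule module_E) (rule w)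
  define \<xi> where "\<xi> n = (\<lambda>x \<in> carrier (E w). the_inv e x n)" for n
  define \<delta> where "\<delta> n = (\<lambda>m. if m = n then \<one>\<^bsub>R\<^esub> else \<zero>\<^bsub>R\<^esub>)" for n :: nat
  have \<xi>_bound: "N (\<xi> n x) \<le> (1 / w n) * mod_norm (E w) x" if "x \<in> carrier (E w)" for n x
    using that w wnorm_upper[of w _ n] by (auto simp: carrier_E \<xi>_def field_simps)
  have \<xi>_in: "\<xi> n \<in> bounded_maps R (E w) (self_module R)" for n
    unfolding bounded_maps_def
  proof (intro CollectI conjI ballI)
    show "\<xi> n \<in> carrier (E w) \<rightarrow>\<^sub>E carrier (self_module R)"
      by (auto simp: \<xi>_def carrier_E self_module_def seqs_carrier)
    show "\<exists>B. \<forall>x \<in> carrier (E w). mod_norm (self_module R) (\<xi> n x) \<le> B * mod_norm (E w) x"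
      using \<xi>_bound by (intro exI[of _ "1 / w n"]) (simp add: self_module_def)
    show "\<xi> n (x \<oplus>\<^bsub>E w\<^esub> y) = \<xi> n x \<oplus>\<^bsub>self_module R\<^esub> \<xi> n y"
      if "x \<in> carrier (E w)" "y \<in> carrier (E w)" for x y
      using that M.a_closed[OF that] by (auto simp: \<xi>_def carrier_E self_module_def)
    show "\<xi> n (a \<odot>\<^bsub>E w\<^esub> x) = a \<odot>\<^bsub>self_module R\<^esub> \<xi> n x"
      if "a \<in> carrier R" "x \<in> carrier (E w)" for a x
      using that M.smult_closed[OF that] by (auto simp: \<xi>_def carrier_E self_module_def)
  qed
  have \<delta>_norm: "(\<lambda>m. N (\<delta> n m) * w' m) sums (N \<one>\<^bsub>R\<^esub> * w' n)" for n
    using sums_single[of n "\<lambda>m. N \<one>\<^bsub>R\<^esub> * w' m"] by (simp add: \<delta>_def if_distrib if_distribR cong: if_cong)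
  have \<delta>: "\<delta> n \<in> seqs w'" "wnorm w' (\<delta> n) \<le> w' n" for n
  proof -
    show "\<delta> n \<in> seqs w'"
      using admissible_summable[OF sums_summable[OF \<delta>_norm]] by (simp add: seqs_def) (simp add: \<delta>_def)
    have "wnorm w' (\<delta> n) \<le> N \<one>\<^bsub>R\<^esub> * w' n"
      using seq_norm_le_suminf[OF sums_summable[OF \<delta>_norm[of n]], of na] sums_unique[OF \<delta>_norm[of n]]
        N_w_nonneg[of w'] w by (simp add: \<delta>_def)
    \<comment> \<open>Only \<open>N_one\<close> is available: the norm of the unit may be smaller
      than 1, as in the zero ring, where it is 0.\<close>
    also have "\<dots> \<le> 1 * w' n" using N_one w by (intro mult_right_mono) (auto intro: less_imp_le)
    finally show "wnorm w' (\<delta> n) \<le> w' n" by simp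
  qed
  let ?op = "\<lambda>n. op_norm (E w) (self_module R) (\<xi> n)"
  have op: "0 \<le> ?op n" "?op n \<le> 1 / w n" for n
    using op_norm_bounds[of "E w" "self_module R" "\<xi> n" "1 / w n"] \<xi>_bound w
    by (simp_all add: self_module_def less_imp_le)
  have "0 \<le> ?op n * mod_norm (E w') (e (\<delta> n))" "?op n * mod_norm (E w') (e (\<delta> n)) \<le> w' n / w n" for n
    using op[of n] \<delta>[of n] wnorm_nonneg[of w' "\<delta> n"] w
      mult_mono[OF op(2)[of n] \<delta>(2)[of n]] less_imp_le by auto
  \<comment> \<open>This covers both notions of nuclearity, because terms of a convergent series
    tend to zero.\<close>
  then have summable: "summable (\<lambda>n. ?op n * mod_norm (E w') (e (\<delta> n)))"
    by (intro summable_comparison_test'[OF sum, of 0]) (simp del: norm_E)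
  \<comment> \<open>The partial sums of the nuclear series are truncations of \<open>x\<close>, so
    the error after \<open>k\<close> terms is the tail treated in
    \<open>seq_norm_tail\<close>.\<close>
  have partial: "(\<Oplus>\<^bsub>E w'\<^esub>n \<in> {..<k}. \<xi> n (e x) \<odot>\<^bsub>E w'\<^esub> e (\<delta> n)) = e (\<lambda>m. if m < k then x m else \<zero>\<^bsub>R\<^esub>)"
    if x: "x \<in> seqs w" for x k
  proof (induction k)
    case 0
    show ?case by (simp add: zero_E)
  next
    case (Suc k)
    have "\<xi> n (e x) \<odot>\<^bsub>E w'\<^esub> e (\<delta> n) \<in> carrier (E w')" for n
      using x \<delta>(1) by (intro M'.smult_closed) (auto simp: \<xi>_def carrier_E seqs_carrier)
    then have "(\<Oplus>\<^bsub>E w'\<^esub>n \<in> {..<Suc k}. \<xi> n (e x) \<odot>\<^bsub>E w'\<^esub> e (\<delta> n)) =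
        \<xi> k (e x) \<odot>\<^bsub>E w'\<^esub> e (\<delta> k) \<oplus>\<^bsub>E w'\<^esub> e (\<lambda>m. if m < k then x m else \<zero>\<^bsub>R\<^esub>)"
      unfolding lessThan_Suc Suc.IH[symmetric] by (intro M'.finsum_insert) auto
    also have "\<dots> = e (\<lambda>m. if m < Suc k then x m else \<zero>\<^bsub>R\<^esub>)"
      using x seqs_carrier[OF x] by (auto simp: \<xi>_def \<delta>_def carrier_E fun_eq_iff less_Suc_eq)
    finally show ?case .
  qed
  have "(\<lambda>k. mod_norm (E w') ((\<Oplus>\<^bsub>E w'\<^esub>n \<in> {..<k}. \<xi> n (e x) \<odot>\<^bsub>E w'\<^esub> e (\<delta> n)) \<ominus>\<^bsub>E w'\<^esub> e x)) \<longlonglongrightarrow> 0"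
    if x: "x \<in> seqs w" for x
  proof -
    have x': "x \<in> seqs w'" using seqs_subset(1)[OF x _ le] w less_imp_le by blast
    have trunc: "(\<lambda>m. if m < k then x m else \<zero>\<^bsub>R\<^esub>) \<in> seqs w'" for k
      using x' N_w_nonneg[of w'] w
      by (auto simp: seqs_def N_nonneg intro!: admissible_mono[of na "\<lambda>n. N (x n) * w' n"])
    have "N ((if m < k then x m else \<zero>\<^bsub>R\<^esub>) \<ominus>\<^bsub>R\<^esub> x m) * w' m = (if m < k then 0 else N (x m) * w' m)" for k m
      using seqs_carrier[OF x] by (simp add: a_minus_def r_neg N_minus)
    then have "mod_norm (E w') ((\<Oplus>\<^bsub>E w'\<^esub>n \<in> {..<k}. \<xi> n (e x) \<odot>\<^bsub>E w'\<^esub> e (\<delta> n)) \<ominus>\<^bsub>E w'\<^esub> e x) =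
        seq_norm na (\<lambda>m. if m < k then 0 else N (x m) * w' m)" for k
      using partial[OF x] diff_E[OF w(2) trunc x'] by simp
    moreover have "(\<lambda>k. seq_norm na (\<lambda>m. if m < k then 0 else N (x m) * w' m)) \<longlonglongrightarrow> 0"
      using x' N_w_nonneg[of w'] w by (intro seq_norm_tail) (auto simp: seqs_def)
    ultimately show ?thesis by simp
  qed
  then show ?thesis
    unfolding nuclear_map_def
    using inclusion_bounded[OF w le] \<xi>_in \<delta>(1) summable summable_LIMSEQ_zero[OF summable]
    by (intro conjI exI[of _ \<xi>] exI[of _ "\<lambda>n. e (\<delta> n)"]) (auto simp: carrier_E simp del: norm_E)
qed

end

section \<open>Systems of weighted sequence modules\<close>

lemma Ban_simps [simp]:
  "Ob (Ban na R) = {M. banach_module R M \<and> (na \<longrightarrow> ultrametric M (mod_norm M))}"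
  "Hom (Ban na R) = bounded_maps R"
  "Id (Ban na R) M = (\<lambda>x \<in> carrier M. x)"
  "Comp (Ban na R) L M M' g f = compose (carrier L) g f"
  by (simp_all add: Ban_def)

lemma bounded_maps_compose:
  assumes M: "banach_module R M"
    and f: "f \<in> bounded_maps R L M" and g: "g \<in> bounded_maps R M M'" and L: "banach_module R L"
  shows "compose (carrier L) g f \<in> bounded_maps R L M'"
proof -
  interpret L: module R L using L by (simp add: banach_module_def)
  have f': "f \<in> carrier L \<rightarrow>\<^sub>E carrier M" and g': "g \<in> carrier M \<rightarrow>\<^sub>E carrier M'"
    using f g by (auto simp: bounded_maps_def)
  obtain B where B: "\<And>x. x \<in> carrier L \<Longrightarrow> mod_norm M (f x) \<le> B * mod_norm L x"
    using f unfolding bounded_maps_def by blast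
  obtain B' where B': "\<And>x. x \<in> carrier M \<Longrightarrow> mod_norm M' (g x) \<le> B' * mod_norm M x"
    using g unfolding bounded_maps_def by blast
  \<comment> \<open>The constants in \<open>bounded_maps\<close> carry no sign; the absolute value
    of \<open>B'\<close> is taken so that the bound for \<open>f\<close> can be multiplied by
    it.\<close>
  have "mod_norm M' (g (f x)) \<le> (\<bar>B'\<bar> * B) * mod_norm L x" if "x \<in> carrier L" for x
  proof -
    have fx: "f x \<in> carrier M" using f' that by auto
    then have "mod_norm M' (g (f x)) \<le> B' * mod_norm M (f x)" by (rule B')
    also have "\<dots> \<le> \<bar>B'\<bar> * mod_norm M (f x)"
      using M fx by (intro mult_right_mono) (auto simp: banach_module_def complete_norm_def)
    also have "\<dots> \<le> \<bar>B'\<bar> * (B * mod_norm L x)" using B[OF that] by (intro mult_left_mono) auto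
    finally show ?thesis by (simp add: mult.assoc)
  qed
  moreover have "compose (carrier L) g f \<in> carrier L \<rightarrow>\<^sub>E carrier M'"
    using f' g' by (auto simp: compose_def PiE_iff)
  ultimately show ?thesis
    using f g f' by (auto simp: bounded_maps_def compose_def PiE_iff)
qed

lemma category_Ban: "category (Ban na R)"
proof
  fix M :: "('b, 'a) normed_module" assume "M \<in> Ob (Ban na R)"
  then interpret M: module R M by (simp add: banach_module_def)
  show "Id (Ban na R) M \<in> Hom (Ban na R) M M"
    by (auto simp: bounded_maps_def intro: exI[of _ 1])
next
  fix L M M' :: "('b, 'a) normed_module" and f g
  assume "L \<in> Ob (Ban na R)" "M \<in> Ob (Ban na R)" "f \<in> Hom (Ban na R) L M" "g \<in> Hom (Ban na R) M M'"
  then show "Comp (Ban na R) L M M' g f \<in> Hom (Ban na R) L M'"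
    using bounded_maps_compose[of R M f L g M'] by simp
next
  fix L M :: "('b, 'a) normed_module" and f
  assume "f \<in> Hom (Ban na R) L M"
  then have "f \<in> carrier L \<rightarrow>\<^sub>E carrier M" by (simp add: bounded_maps_def)
  then show "Comp (Ban na R) L L M f (Id (Ban na R) L) = f" "Comp (Ban na R) L M M (Id (Ban na R) M) f = f"
    by (auto simp: compose_def fun_eq_iff PiE_iff extensional_def)
next
  fix K L M M' :: "('b, 'a) normed_module" and f g h
  assume "f \<in> Hom (Ban na R) K L"
  then have "f \<in> carrier K \<rightarrow>\<^sub>E carrier L" by (simp add: bounded_maps_def)
  then show "Comp (Ban na R) K L M' (Comp (Ban na R) L M M' h g) f =
      Comp (Ban na R) K M M' h (Comp (Ban na R) K L M g f)"
    by (auto simp: compose_def fun_eq_iff)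
qed

text \<open>Composing with an inclusion leaves the underlying function unchanged, so the identities
  between composites in the weighted systems become equalities of functions.\<close>

lemma compose_inclusion:
  "f \<in> bounded_maps R L M \<Longrightarrow> compose (carrier L) (\<lambda>x \<in> carrier M. x) f = f"
  by (auto simp: bounded_maps_def compose_def fun_eq_iff PiE_iff extensional_def)

text \<open>The arrow type of the index category of an Ind-object is arbitrary, so
  \<open>undefined\<close> serves as the only arrow. At type \<open>unit\<close> this includes
  \<open>nat_cat\<close> and its opposite.\<close>

definition thin_cat :: "'i set \<Rightarrow> ('i \<Rightarrow> 'i \<Rightarrow> bool) \<Rightarrow> ('i, 'k) cat" where
  "thin_cat A r = \<lparr>Ob = A, Hom = (\<lambda>i j. if r i j then {undefined} else {}), Id = (\<lambda>_. undefined),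
     Comp = (\<lambda>_ _ _ _ _. undefined)\<rparr>"

lemma thin_cat_simps [simp]:
  "Ob (thin_cat A r) = A"
  "u \<in> Hom (thin_cat A r) i j \<longleftrightarrow> r i j \<and> u = undefined"
  "Id (thin_cat A r) i = undefined"
  "Comp (thin_cat A r) i j k v u = undefined"
  by (simp_all add: thin_cat_def)

lemma category_thin_cat:
  assumes "\<And>i. i \<in> A \<Longrightarrow> r i i" "\<And>i j k. \<lbrakk>i \<in> A; j \<in> A; k \<in> A; r i j; r j k\<rbrakk> \<Longrightarrow> r i k"
  shows "category (thin_cat A r)"
  by (rule category.intro) (simp_all add: assms(1), blast intro: assms(2))

lemma filtered_category_thin_cat:
  assumes "category (thin_cat A r :: ('i, 'k) cat)" "A \<noteq> {}"
    and "\<And>i j. \<lbrakk>i \<in> A; j \<in> A\<rbrakk> \<Longrightarrow> \<exists>k \<in> A. r i k \<and> r j k"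
  shows "filtered_category (thin_cat A r :: ('i, 'k) cat)"
proof -
  interpret category "thin_cat A r :: ('i, 'k) cat" by fact
  show ?thesis
    using assms(2,3) Id_in by unfold_locales auto
qed

text \<open>The common form of the two given diagrams and of the two Ind-objects that represent
  their colimit and limit, so that well-definedness is proved once.\<close>

definition weight_system :: "bool \<Rightarrow> 'r normed_ring \<Rightarrow> ((nat \<Rightarrow> 'r) \<Rightarrow> 'm) \<Rightarrow> ('i \<Rightarrow> nat \<Rightarrow> real) \<Rightarrow>
    'i set \<Rightarrow> ('i \<Rightarrow> 'i \<Rightarrow> bool) \<Rightarrow> ('i, 'k, ('r, 'm) normed_module, 'm \<Rightarrow> 'm) diag" where
  "weight_system na R e \<omega> A r = \<lparr>shape = thin_cat A r, dob = (\<lambda>i. ell_star na R e (\<omega> i)),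
     dar = (\<lambda>i j u. \<lambda>x \<in> carrier (ell_star na R e (\<omega> i)). x)\<rparr>"

lemma weight_system_simps [simp]:
  "shape (weight_system na R e \<omega> A r) = thin_cat A r"
  "dob (weight_system na R e \<omega> A r) i = ell_star na R e (\<omega> i)"
  "dar (weight_system na R e \<omega> A r) i j u = (\<lambda>x \<in> carrier (ell_star na R e (\<omega> i)). x)"
  by (simp_all add: weight_system_def)

lemma kappa_diag_eq: "kappa_diag na R e \<rho> = weight_system na R e (\<lambda>j n. inverse (\<rho> j n)) UNIV (\<le>)"
  by (auto simp: kappa_diag_def weight_system_def nat_cat_def thin_cat_def fun_eq_iff)

lemma lambda_diag_eq: "lambda_diag na R e \<rho> = weight_system na R e \<rho> UNIV (\<ge>)"
  by (auto simp: lambda_diag_def weight_system_def nat_cat_def op_cat_def thin_cat_def fun_eq_iff)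

lemma (in ell_modules) diagram_in_weight_system:
  assumes cat: "category (thin_cat A r :: ('i, 'k) cat)" and pos: "\<And>i n. i \<in> A \<Longrightarrow> 0 < \<omega> i n"
    and bound: "\<And>i i'. \<lbrakk>i \<in> A; i' \<in> A; r i i'\<rbrakk> \<Longrightarrow> \<exists>c. \<forall>n. \<omega> i' n \<le> c * \<omega> i n"
  shows "diagram_in (Ban na R) (weight_system na R e \<omega> A r :: ('i, 'k, _, _) diag)"
proof (rule diagram_in.intro)
  have arrow: "(\<lambda>x \<in> carrier (E (\<omega> i)). x) \<in> bounded_maps R (E (\<omega> i)) (E (\<omega> j))"
    if "i \<in> A" "j \<in> A" "r i j" for i j
    using bound[OF that] inclusion_bounded pos that by blast
  show "category (shape (weight_system na R e \<omega> A r :: ('i, 'k, _, _) diag))" using cat by simp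
  fix i j k :: 'i and u v :: 'k
  show "dob (weight_system na R e \<omega> A r) i \<in> Ob (Ban na R)"
    if "i \<in> Ob (shape (weight_system na R e \<omega> A r :: ('i, 'k, _, _) diag))"
    using E_in_Ban[of "\<omega> i"] pos that by simp
  show "dar (weight_system na R e \<omega> A r) i j u \<in>
      Hom (Ban na R) (dob (weight_system na R e \<omega> A r) i) (dob (weight_system na R e \<omega> A r) j)"
    if "i \<in> Ob (shape (weight_system na R e \<omega> A r :: ('i, 'k, _, _) diag))"
      "j \<in> Ob (shape (weight_system na R e \<omega> A r :: ('i, 'k, _, _) diag))"
      "u \<in> Hom (shape (weight_system na R e \<omega> A r)) i j"
    using arrow that by simp
  show "dar (weight_system na R e \<omega> A r) i k (Comp (shape (weight_system na R e \<omega> A r)) i j k v u) =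
      Comp (Ban na R) (dob (weight_system na R e \<omega> A r) i) (dob (weight_system na R e \<omega> A r) j)
        (dob (weight_system na R e \<omega> A r) k) (dar (weight_system na R e \<omega> A r) j k v)
        (dar (weight_system na R e \<omega> A r) i j u)"
    if "i \<in> Ob (shape (weight_system na R e \<omega> A r :: ('i, 'k, _, _) diag))"
      "j \<in> Ob (shape (weight_system na R e \<omega> A r :: ('i, 'k, _, _) diag))"
      "u \<in> Hom (shape (weight_system na R e \<omega> A r)) i j"
    using compose_inclusion[OF arrow] that by simp
qed simp

lemma (in ell_modules) weight_system_in_ind_objects:
  assumes "category (thin_cat A r :: ('i, 'k) cat)" "\<And>i n. i \<in> A \<Longrightarrow> 0 < \<omega> i n"
    and "\<And>i i'. \<lbrakk>i \<in> A; i' \<in> A; r i i'\<rbrakk> \<Longrightarrow> \<exists>c. \<forall>n. \<omega> i' n \<le> c * \<omega> i n"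
    and "A \<noteq> {}" "\<And>i j. \<lbrakk>i \<in> A; j \<in> A\<rbrakk> \<Longrightarrow> \<exists>k \<in> A. r i k \<and> r j k"
  shows "(weight_system na R e \<omega> A r :: ('i, 'k, _, _) diag) \<in> ind_objects (Ban na R)"
  using diagram_in_weight_system[OF assms(1-3)] filtered_category_thin_cat[OF assms(1,4,5)]
  by (simp add: ind_objects_iff)

text \<open>An Ind-object is the colimit of its own stages, by \<open>is_colimit_ind_diag\<close>
  with the identity as reindexing. The system required by the definition can thus be
  \<open>S\<close> itself.\<close>

lemma nuclear_objectI:
  fixes S K :: "('i, 'k, ('r, 'm) normed_module, 'm \<Rightarrow> 'm) diag"
  assumes S: "S \<in> ind_objects (Ban na R)"
    and nuclear: "\<And>i. i \<in> Ob (shape S) \<Longrightarrow>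
      \<exists>j \<in> Ob (shape S). \<exists>u \<in> Hom (shape S) i j. nuclear_map na R (dob S i) (dob S j) (dar S i j u)"
    and iso: "isomorphic (Ind (Ban na R)) K S"
  shows "nuclear_object na R K"
proof -
  interpret category "Ban na R :: (('r, 'm) normed_module, 'm \<Rightarrow> 'm) cat" by (rule category_Ban)
  have "is_colimit (Ind (Ban na R)) (ind_diag (Ban na R) S) S
      (\<lambda>j. \<lambda>i \<in> {undefined}. germ (Ban na R) (dob S j) S (id j) (Id (Ban na R) (dob S j)))"
    using S by (intro is_colimit_ind_diag) (auto simp: ind_objects_iff bij_betw_def simp del: Ban_simps)
  then show ?thesis
    unfolding nuclear_object_def using S nuclear iso
    by (intro exI[of _ S] exI[of _ "\<lambda>j. \<lambda>i \<in> {undefined}. germ (Ban na R) (dob S j) S (id j) (Id (Ban na R) (dob S j))"])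
      (simp add: ind_objects_iff)
qed

section \<open>The Ind-objects representing kappa and lambda\<close>

locale rapid_weights = ell_modules R na e for R :: "'r normed_ring" and na and e :: "(nat \<Rightarrow> 'r) \<Rightarrow> 'm" +
  fixes d :: "(nat \<Rightarrow> real) \<Rightarrow> 'i" and \<rho> :: "nat \<Rightarrow> nat \<Rightarrow> real"
  assumes inj_d: "inj d" and \<rho>_pos: "\<And>j n. 0 < \<rho> j n"
    and \<rho>_summable: "\<And>j. summable (\<lambda>n. \<rho> j n / \<rho> (Suc j) n)"
begin

abbreviation Ban' :: "(('r, 'm) normed_module, 'm \<Rightarrow> 'm) cat" where "Ban' \<equiv> Ban na R"

sublocale Ban: category Ban' by (rule category_Ban)

lemma the_inv_d [simp]: "the_inv d (d w) = w"
  using inj_d by (rule the_inv_f_f)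

lemma \<rho>_bound:
  assumes "i \<le> j"
  shows "\<exists>c. \<forall>n. \<rho> i n \<le> c * \<rho> j n"
proof -
  \<comment> \<open>The claim is strengthened to a nonnegative constant so that the next bound can
    be multiplied by it. Each step contributes the sum of the series of quotients, which bounds
    every single quotient.\<close>
  have "\<exists>c \<ge> 0. \<forall>n. \<rho> i n \<le> c * \<rho> j n"
    using assms
  proof (induction j rule: dec_induct)
    case base
    show ?case by (intro exI[of _ 1]) simp
  next
    case (step j)
    then obtain c where c: "0 \<le> c" "\<And>n. \<rho> i n \<le> c * \<rho> j n" by blast
    define S where "S = (\<Sum>n. \<rho> j n / \<rho> (Suc j) n)"
    have S: "\<rho> j n \<le> S * \<rho> (Suc j) n" for n
      using sum_le_suminf[OF \<rho>_summable[of j], of "{n}"] \<rho>_pos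
      by (simp add: S_def pos_divide_le_eq less_imp_le)
    have "0 \<le> S"
      unfolding S_def using \<rho>_pos by (intro suminf_nonneg \<rho>_summable) (simp add: less_imp_le)
    moreover have "\<rho> i n \<le> (c * S) * \<rho> (Suc j) n" for n
      using c(2)[of n] mult_left_mono[OF S[of n] c(1)] by (simp add: mult.assoc)
    ultimately show ?case using c(1) by (intro exI[of _ "c * S"]) simp
  qed
  then show ?thesis by blast
qed

text \<open>The index type is only known to contain the codes \<open>d w\<close> of weights, so a
  natural number is coded by a constant weight.\<close>

definition \<sigma> :: "nat \<Rightarrow> 'i" where "\<sigma> j = d (\<lambda>_. real j)"

lemma inj_\<sigma>: "inj \<sigma>"
  by (rule injI) (simp add: \<sigma>_def inj_eq[OF inj_d] fun_eq_iff)

lemma the_inv_\<sigma> [simp]: "the_inv \<sigma> (\<sigma> j) = j"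
  using inj_\<sigma> by (rule the_inv_f_f)

definition kappa_system :: "('i, 'k, ('r, 'm) normed_module, 'm \<Rightarrow> 'm) diag" where
  "kappa_system = weight_system na R e (\<lambda>i n. inverse (\<rho> (the_inv \<sigma> i) n)) (range \<sigma>) (\<lambda>i i'. the_inv \<sigma> i \<le> the_inv \<sigma> i')"

lemma inverse_\<rho>_bound:
  assumes "i \<le> j"
  shows "\<exists>c. \<forall>n. inverse (\<rho> j n) \<le> c * inverse (\<rho> i n)"
proof -
  obtain c where c: "\<And>n. \<rho> i n \<le> c * \<rho> j n" using \<rho>_bound[OF assms] by blast
  have "inverse (\<rho> j n) \<le> c * inverse (\<rho> i n)" for n
    using c[of n] \<rho>_pos[of i n] \<rho>_pos[of j n] by (simp add: field_simps)
  then show ?thesis by blast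
qed

lemma kappa_system_in: "kappa_system \<in> ind_objects Ban'"
proof -
  have "\<exists>k \<in> range \<sigma>. the_inv \<sigma> i \<le> the_inv \<sigma> k \<and> the_inv \<sigma> j \<le> the_inv \<sigma> k" for i j
    by (intro bexI[of _ "\<sigma> (max (the_inv \<sigma> i) (the_inv \<sigma> j))"]) auto
  then show ?thesis
    unfolding kappa_system_def
    by (intro weight_system_in_ind_objects category_thin_cat) (simp_all add: \<rho>_pos inverse_\<rho>_bound)
qed

lemma kappa_system_nuclear:
  assumes "i \<in> Ob (shape kappa_system)"
  shows "\<exists>j \<in> Ob (shape kappa_system). \<exists>u \<in> Hom (shape kappa_system) i j.
    nuclear_map na R (dob kappa_system i) (dob kappa_system j) (dar kappa_system i j u)"
proof -
  obtain j where j: "i = \<sigma> j" using assms by (auto simp: kappa_system_def)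
  have "nuclear_map na R (E (\<lambda>n. inverse (\<rho> j n))) (E (\<lambda>n. inverse (\<rho> (Suc j) n)))
      (\<lambda>x \<in> carrier (E (\<lambda>n. inverse (\<rho> j n))). x)"
    \<comment> \<open>Passing to inverses reverses the quotient of consecutive weights, so the
      hypothesis at \<open>j\<close> is exactly the summability needed.\<close>
    using \<rho>_pos \<rho>_summable[of j] by (intro inclusion_nuclear) (simp_all add: field_simps)
  then show ?thesis
    by (intro bexI[of _ "\<sigma> (Suc j)"] bexI[of _ undefined]) (simp_all add: kappa_system_def j)
qed

lemma is_colimit_kappa_system:
  "\<exists>q. is_colimit (Ind Ban') (ind_diag Ban' (kappa_diag na R e \<rho>)) kappa_system q"
proof (intro exI, rule Ban.is_colimit_ind_diag)
  show "diagram_in Ban' (kappa_diag na R e \<rho>)"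
    unfolding kappa_diag_eq
    by (intro diagram_in_weight_system category_thin_cat inverse_\<rho>_bound) (auto simp: \<rho>_pos)
  show "bij_betw \<sigma> (Ob (shape (kappa_diag na R e \<rho>))) (Ob (shape kappa_system))"
    using inj_\<sigma> by (simp add: kappa_diag_eq kappa_system_def bij_betw_def)
  show "kappa_system \<in> ind_objects Ban'" by (rule kappa_system_in)
qed (auto simp: kappa_diag_eq kappa_system_def)

section \<open>Dominating weights and the limit lambda\<close>

definition dominating :: "(nat \<Rightarrow> real) set" where
  "dominating = {w. (\<forall>n. 0 < w n) \<and> (\<forall>j. \<exists>c. \<forall>n. \<rho> j n \<le> c * w n)}"

text \<open>Arrows point towards pointwise smaller weights, since these impose a weaker condition
  and give larger modules.\<close>

definition lambda_system :: "('i, 'k, ('r, 'm) normed_module, 'm \<Rightarrow> 'm) diag" where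
  "lambda_system = weight_system na R e (the_inv d) (d ` dominating) (\<lambda>i i'. \<forall>n. the_inv d i' n \<le> the_inv d i n)"

text \<open>The minimum is an upper bound of both weights in the order of
  \<open>lambda_system\<close>. It provides filteredness and the common stage at which germs are
  compared.\<close>

lemma dominating_min:
  assumes "w \<in> dominating" "w' \<in> dominating"
  shows "(\<lambda>n. min (w n) (w' n)) \<in> dominating"
  unfolding dominating_def
proof (intro CollectI conjI allI)
  show pos: "0 < min (w n) (w' n)" for n using assms by (simp add: dominating_def)
  fix j
  obtain c c' where c: "\<And>n. \<rho> j n \<le> c * w n" "\<And>n. \<rho> j n \<le> c' * w' n"
    using assms by (auto simp: dominating_def) blast
  have "\<rho> j n \<le> max c c' * min (w n) (w' n)" for n
  proof (cases "w n \<le> w' n")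
    case True
    then show ?thesis
      using order_trans[OF c(1)[of n] mult_right_mono[of c "max c c'" "w n"]] pos[of n] by simp
  next
    case False
    then show ?thesis
      using order_trans[OF c(2)[of n] mult_right_mono[of c' "max c c'" "w' n"]] pos[of n] by simp
  qed
  then show "\<exists>c. \<forall>n. \<rho> j n \<le> c * min (w n) (w' n)" by blast
qed

lemma dominating_refine:
  assumes "u \<in> dominating"
  shows "\<exists>w \<in> dominating. summable (\<lambda>n. w n / u n)"
  using refined_weight[of \<rho> u] \<rho>_pos \<rho>_summable assms by (auto simp: dominating_def)

lemma lambda_system_in: "lambda_system \<in> ind_objects Ban'"
  unfolding lambda_system_def
proof (rule weight_system_in_ind_objects)
  show "d ` dominating \<noteq> {}"
    using dominating_weight[of \<rho>] \<rho>_pos by (fastforce simp: dominating_def)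
  show "\<exists>k \<in> d ` dominating. (\<forall>n. the_inv d k n \<le> the_inv d i n) \<and> (\<forall>n. the_inv d k n \<le> the_inv d j n)"
    if "i \<in> d ` dominating" "j \<in> d ` dominating" for i j
    using that dominating_min by (intro bexI[of _ "d (\<lambda>n. min (the_inv d i n) (the_inv d j n))"]) auto
  show "category (thin_cat (d ` dominating) (\<lambda>i i'. \<forall>n. the_inv d i' n \<le> the_inv d i n))"
    by (rule category_thin_cat) (auto intro: order_trans)
  show "0 < the_inv d i n" if "i \<in> d ` dominating" for i n
    using that by (auto simp: dominating_def)
  show "\<exists>c. \<forall>n. the_inv d i' n \<le> c * the_inv d i n" if "\<forall>n. the_inv d i' n \<le> the_inv d i n" for i i'
    using that by (intro exI[of _ 1]) simp
qed

lemma lambda_system_nuclear: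
  assumes "i \<in> Ob (shape lambda_system)"
  shows "\<exists>j \<in> Ob (shape lambda_system). \<exists>u \<in> Hom (shape lambda_system) i j.
    nuclear_map na R (dob lambda_system i) (dob lambda_system j) (dar lambda_system i j u)"
proof -
  obtain w where w: "i = d w" "w \<in> dominating" using assms by (auto simp: lambda_system_def)
  obtain v where v: "v \<in> dominating" "summable (\<lambda>n. v n / w n)" using dominating_refine w by blast
  \<comment> \<open>Summability of \<open>v n / w n\<close> does not put \<open>v\<close> below
    \<open>w\<close> at every index, but an arrow of the system requires that; taking the minimum
    restores it and only shrinks the quotients.\<close>
  let ?v = "\<lambda>n. min (w n) (v n)"
  have v': "?v \<in> dominating" using v w by (intro dominating_min)
  have pos: "0 < w n" "0 < v n" for n using v w by (auto simp: dominating_def)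
  have "summable (\<lambda>n. ?v n / w n)"
  proof (rule summable_comparison_test'[OF v(2)])
    show "norm (?v n / w n) \<le> v n / w n" for n
      using pos[of n] by (simp add: divide_right_mono)
  qed
  then have "nuclear_map na R (E w) (E ?v) (\<lambda>x \<in> carrier (E w). x)"
    using pos by (intro inclusion_nuclear) auto
  then show ?thesis
    using v' by (intro bexI[of _ "d ?v"] bexI[of _ undefined]) (simp_all add: lambda_system_def w)
qed

text \<open>The operator bounds of \<open>h\<close> give pointwise bounds against one dominating weight; passing to a
  refinement of that weight makes them summable.\<close>

lemma bounded_maps_factor:
  assumes X: "banach_module R X" and h: "\<And>j. h \<in> bounded_maps R X (E (\<rho> j))"
  shows "\<exists>w \<in> dominating. h \<in> bounded_maps R X (E w)"
proof -
  have norm_X: "0 \<le> mod_norm X x" if "x \<in> carrier X" for x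
    using X that by (simp add: banach_module_def complete_norm_def)
  have h_in: "h x \<in> e ` seqs (\<rho> j)" if "x \<in> carrier X" for x j
    using h[of j] that by (auto simp: bounded_maps_def carrier_E)
  define t where "t x = the_inv e (h x)" for x
  have t: "h x = e (t x)" "t x \<in> seqs (\<rho> j)" if "x \<in> carrier X" for x j
    using h_in[OF that, of j] by (auto simp: t_def)
  have "\<forall>j. \<exists>B. \<forall>x \<in> carrier X. mod_norm (E (\<rho> j)) (h x) \<le> B * mod_norm X x"
    using h by (auto simp: bounded_maps_def)
  then obtain B where B: "\<And>j x. x \<in> carrier X \<Longrightarrow> mod_norm (E (\<rho> j)) (h x) \<le> B j * mod_norm X x"
    by metis
  \<comment> \<open>This weight is built from the operator bounds \<open>B\<close> of the particular
    \<open>h\<close>.\<close>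
  obtain u where u: "\<And>n. 0 < u n" "\<And>j. \<exists>c. \<forall>n. \<rho> j n \<le> c * u n"
    and u_le: "\<And>n s C. 0 \<le> s \<Longrightarrow> 0 \<le> C \<Longrightarrow> (\<And>j. s * \<rho> j n \<le> B j * C) \<Longrightarrow> s * u n \<le> C"
    using dominating_weight[of \<rho> B] \<rho>_pos by blast
  then obtain w where w: "w \<in> dominating" "summable (\<lambda>n. w n / u n)"
    using dominating_refine[of u] by (auto simp: dominating_def)
  then have w_pos: "0 < w n" for n by (simp add: dominating_def)
  have tu: "N (t x n) * u n \<le> mod_norm X x" if x: "x \<in> carrier X" for x n
  proof (rule u_le)
    show "N (t x n) * \<rho> j n \<le> B j * mod_norm X x" for j
      using wnorm_upper[where w = "\<rho> j", OF \<rho>_pos t(2)[OF x], of n] B[OF x, of j] t(1)[OF x] by simp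
  qed (use x norm_X t(2)[OF x] seqs_carrier N_nonneg in blast)+
  have tw: "t x \<in> seqs w" "wnorm w (t x) \<le> (\<Sum>n. w n / u n) * mod_norm X x" if x: "x \<in> carrier X" for x
    using seqs_bounded[of "t x" u "mod_norm X x" w] tu[OF x] w_pos u(1) w(2) seqs_carrier[OF t(2)[OF x]]
    by blast+
  have "h \<in> bounded_maps R X (E w)"
    unfolding bounded_maps_def
  proof (intro CollectI conjI ballI)
    show "h \<in> carrier X \<rightarrow>\<^sub>E carrier (E w)"
      using h[of 0] tw(1) t(1) by (auto simp: bounded_maps_def PiE_iff carrier_E)
    show "\<exists>B. \<forall>x \<in> carrier X. mod_norm (E w) (h x) \<le> B * mod_norm X x"
      using tw t(1) by (intro exI[of _ "\<Sum>n. w n / u n"]) simp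
    show "h (x \<oplus>\<^bsub>X\<^esub> y) = h x \<oplus>\<^bsub>E w\<^esub> h y" if "x \<in> carrier X" "y \<in> carrier X" for x y
    proof -
      \<comment> \<open>The weight enters only the carrier and the norm, so additivity known in the
        module of \<open>\<rho> 0\<close> carries over to that of \<open>w\<close>; the same holds
        for scalars below.\<close>
      have "h (x \<oplus>\<^bsub>X\<^esub> y) = h x \<oplus>\<^bsub>E (\<rho> 0)\<^esub> h y"
        using h[of 0] that by (simp add: bounded_maps_def)
      then show ?thesis using t(1) that by simp
    qed
    show "h (a \<odot>\<^bsub>X\<^esub> x) = a \<odot>\<^bsub>E w\<^esub> h x" if "a \<in> carrier R" "x \<in> carrier X" for a x
    proof -
      have "h (a \<odot>\<^bsub>X\<^esub> x) = a \<odot>\<^bsub>E (\<rho> 0)\<^esub> h x"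
        using h[of 0] that by (simp add: bounded_maps_def)
      then show ?thesis using t(1) that by simp
    qed
  qed
  then show ?thesis using w by blast
qed

lemma is_limit_lambda_system:
  "\<exists>p. is_limit (Ind Ban') (ind_diag Ban' (lambda_diag na R e \<rho>))
    (lambda_system :: ('i, 'k, ('r, 'm) normed_module, 'm \<Rightarrow> 'm) diag) p"
proof (intro exI, rule Ban.is_limit_ind_diag)
  let ?F = "lambda_system :: ('i, 'k, ('r, 'm) normed_module, 'm \<Rightarrow> 'm) diag"
  let ?D = "lambda_diag na R e \<rho>"
  let ?\<pi> = "\<lambda>i j. \<lambda>x \<in> carrier (E (the_inv d i)). x"
  note simps = lambda_system_def lambda_diag_eq
  have incl: "(\<lambda>x \<in> carrier (E w). x) \<in> bounded_maps R (E w) (E (\<rho> j))" if w: "w \<in> dominating" for w j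
  proof -
    obtain c where "\<And>n. \<rho> j n \<le> c * w n" using w unfolding dominating_def by blast
    then show ?thesis using w \<rho>_pos by (intro inclusion_bounded) (auto simp: dominating_def)
  qed
  show "diagram_in Ban' ?D"
    unfolding lambda_diag_eq
    by (intro diagram_in_weight_system category_thin_cat \<rho>_bound) (auto simp: \<rho>_pos)
  show F: "?F \<in> ind_objects Ban'" by (rule lambda_system_in)
  interpret F: diagram_in Ban' ?F using F by (simp add: ind_objects_iff)
  show \<pi>: "?\<pi> i j \<in> Hom Ban' (dob ?F i) (dob ?D j)"
    if "i \<in> Ob (shape ?F)" "j \<in> Ob (shape ?D)" for i j
    using that incl by (auto simp: simps)
  show "Comp Ban' (dob ?F i) (dob ?F i') (dob ?D j) (?\<pi> i' j) (dar ?F i i' u) = ?\<pi> i j"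
    if "i \<in> Ob (shape ?F)" "i' \<in> Ob (shape ?F)" "u \<in> Hom (shape ?F) i i'" "j \<in> Ob (shape ?D)" for i i' u j
    using compose_inclusion[of "dar ?F i i' u" R "dob ?F i" "dob ?F i'"] F.dar_in[OF that(1-3)]
    by (simp add: simps)
  show "Comp Ban' (dob ?F i) (dob ?D j) (dob ?D j') (dar ?D j j' v) (?\<pi> i j) = ?\<pi> i j'"
    if "i \<in> Ob (shape ?F)" "j \<in> Ob (shape ?D)" "j' \<in> Ob (shape ?D)" "v \<in> Hom (shape ?D) j j'" for i j j' v
    using compose_inclusion[of "?\<pi> i j" R "dob ?F i" "dob ?D j"] \<pi>[OF that(1,2)]
    by (simp add: simps)
  show "\<exists>i \<in> Ob (shape ?F). \<exists>g \<in> Hom Ban' X (dob ?F i).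
      \<forall>j \<in> Ob (shape ?D). Comp Ban' X (dob ?F i) (dob ?D j) (?\<pi> i j) g = h j"
    if cone: "is_cone Ban' ?D X h" for X h
  proof -
    have X: "banach_module R X" and h_in: "\<And>j. h j \<in> bounded_maps R X (E (\<rho> j))"
      and h_eq: "\<And>j j'. j' \<le> j \<Longrightarrow> compose (carrier X) (\<lambda>x \<in> carrier (E (\<rho> j)). x) (h j) = h j'"
      using cone by (auto simp: is_cone_def lambda_diag_eq)
    \<comment> \<open>The arrow from \<open>j\<close> to 0 is an inclusion, which does not change
      the function, so the cone condition says that all components of a cone coincide.\<close>
    have h0: "h j = h 0" for j
      using h_eq[of 0 j] compose_inclusion[OF h_in] by simp
    have "h 0 \<in> bounded_maps R X (E (\<rho> j))" for j using h_in[of j] unfolding h0[of j] .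
    then obtain w where w: "w \<in> dominating" "h 0 \<in> bounded_maps R X (E w)"
      using bounded_maps_factor[OF X] by blast
    have "Comp Ban' X (dob ?F (d w)) (dob ?D j) (?\<pi> (d w) j) (h 0) = h j" for j
      using compose_inclusion[OF w(2)] h0[of j] by (simp add: simps)
    moreover have "d w \<in> Ob (shape ?F)" "h 0 \<in> Hom Ban' X (dob ?F (d w))"
      using w by (simp_all add: simps)
    ultimately show ?thesis by blast
  qed
  show "germ Ban' X ?F i g = germ Ban' X ?F i' g'"
    if X: "X \<in> Ob Ban'" and i: "i \<in> Ob (shape ?F)" "i' \<in> Ob (shape ?F)"
      and g: "g \<in> Hom Ban' X (dob ?F i)" "g' \<in> Hom Ban' X (dob ?F i')"
      and eq: "\<And>j. j \<in> Ob (shape ?D) \<Longrightarrow>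
        Comp Ban' X (dob ?F i) (dob ?D j) (?\<pi> i j) g = Comp Ban' X (dob ?F i') (dob ?D j) (?\<pi> i' j) g'" for X i i' g g'
  proof -
    have ge: "compose (carrier X) (\<lambda>x \<in> carrier (E (the_inv d i)). x) g = g"
      "compose (carrier X) (\<lambda>x \<in> carrier (E (the_inv d i')). x) g' = g'"
      using g by (auto simp: simps intro!: compose_inclusion)
    \<comment> \<open>One projection suffices, because it leaves the underlying function unchanged.
      The two germs then agree at the stage given by the minimum of the two weights.\<close>
    then have "g = g'" using eq[of 0] by (simp add: simps)
    define k where "k = d (\<lambda>n. min (the_inv d i n) (the_inv d i' n))"
    have k: "k \<in> Ob (shape ?F)" "undefined \<in> Hom (shape ?F) i k" "undefined \<in> Hom (shape ?F) i' k"
      using i dominating_min by (auto simp: simps k_def)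
    show ?thesis
      using ge \<open>g = g'\<close> by (intro Ban.germ_eqI[OF F X i(1) g(1) i(2) g(2) k]) (simp add: simps)
  qed
qed

end

theorem mainTheorem2:
  fixes R :: "'r normed_ring" and na :: bool
    and e :: "(nat \<Rightarrow> 'r) \<Rightarrow> 'm" and d :: "(nat \<Rightarrow> real) \<Rightarrow> 'i"
    and \<rho> :: "nat \<Rightarrow> nat \<Rightarrow> real"
  assumes "banach_ring R"
    and "na \<longrightarrow> ultrametric R (ring_norm R)"
    and "inj e" and "inj d"
    and "\<And>j n. \<rho> j n > 0"
    and "\<And>j. summable (\<lambda>n. \<rho> j n / \<rho> (Suc j) n)"
  shows "(\<exists>K :: ('i, 'k, ('r, 'm) normed_module, 'm \<Rightarrow> 'm) diag. is_kappa na R e \<rho> K) \<and>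
         (\<forall>K :: ('i, 'k, ('r, 'm) normed_module, 'm \<Rightarrow> 'm) diag.
            is_kappa na R e \<rho> K \<longrightarrow> nuclear_object na R K) \<and>
         (\<exists>L :: ('i, 'k, ('r, 'm) normed_module, 'm \<Rightarrow> 'm) diag. is_lambda na R e \<rho> L) \<and>
         (\<forall>L :: ('i, 'k, ('r, 'm) normed_module, 'm \<Rightarrow> 'm) diag.
            is_lambda na R e \<rho> L \<longrightarrow> nuclear_object na R L)"
proof -
  interpret rapid_weights R na e d \<rho>
    using assms by unfold_locales
  interpret Ind: category "Ind Ban' :: (('i, 'k, ('r, 'm) normed_module, 'm \<Rightarrow> 'm) diag, _) cat"
    by (rule Ban.category_Ind)
  \<comment> \<open>Any object with the universal property is isomorphic to the explicit system, and
    \<open>nuclear_object\<close> is defined up to isomorphism.\<close>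
  have "nuclear_object na R K" if "is_kappa na R e \<rho> K"
    for K :: "('i, 'k, ('r, 'm) normed_module, 'm \<Rightarrow> 'm) diag"
  proof (rule nuclear_objectI[OF kappa_system_in kappa_system_nuclear])
    show "isomorphic (Ind Ban') K kappa_system"
      using that is_colimit_kappa_system Ind.colimit_isomorphic unfolding is_kappa_def by blast
  qed
  moreover have "nuclear_object na R L" if "is_lambda na R e \<rho> L"
    for L :: "('i, 'k, ('r, 'm) normed_module, 'm \<Rightarrow> 'm) diag"
  proof (rule nuclear_objectI[OF lambda_system_in lambda_system_nuclear])
    show "isomorphic (Ind Ban') L lambda_system"
      using that is_limit_lambda_system Ind.limit_isomorphic unfolding is_lambda_def by blast
  qed
  ultimately show ?thesis
    using is_colimit_kappa_system is_limit_lambda_system unfolding is_kappa_def is_lambda_def by blast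
qed

end
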